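(* Consider the following request process. Let $\{\tau_n,\,-\infty<n<\infty\}$ be the points of a unit-rate Poisson process on $\mathbb{R}$. Let $\{J_t\}$ be a finite-state, stationary and ergodic semi-Markov process, independent of $\{\tau_n\}$, with state space $\{1,\dots,M\}$, almost surely strictly increasing jump points $\{T_n\}$ ($T_0\le0<T_1$), piecewise constant and right-continuous with $J_t=J_{T_n}$ for $T_n\le t<T_{n+1}$, whose embedded chain $\{J_{T_n}\}$ is an irreducible Markov chain, and whose stationary distribution $\pi_r=\mathbb{P}[J_t=r]$ satisfies $\min_r\pi_r>0$. For each state $r$ let $(q_i^{(r)})_{i\ge1}$ be a probability mass function on $\{1,2,\dots\}$, and let the requested documents $R_n$ satisfy $$\mathbb{P}[R_l=i_l,\,1\le l\le n\mid J_t,\,0\le t\le\tau_n]=\prod_{l=1}^n q_{i_l}^{(J_{\tau_l})},\qquad n\ge1,$$ with $q_i=\mathbb{P}[R_n=i]=\sum_r\pi_rq_i^{(r)}>0$ for all $i\ge1$. Document $i$ has size $s_i\in\{\sigma_1,\dots,\sigma_D\}$, where $D<\infty$ and $0<\sigma_1,\dots,\sigma_D<\infty$, and documents are enumerated so that $q_1/s_1\ge q_2/s_2\ge\cdots$. A cache of size $x$ may hold any set of documents of total size at most $x$. Caching policies $\pi$ have cache content $\mathcal{C}^\pi_t$ at time $t$, leave the content unchanged at a request time $\tau_n$ if $R_n\in\mathcal{C}^\pi_{\tau_n}$, and otherwise update the content (optionally, possibly leaving it unchanged) subject to the size constraint, with the decision a function only of $R_1,\dots,R_n$ and $\mathcal{C}^\pi_{\tau_0},\dots,\mathcal{C}^\pi_{\tau_n}$.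 Define $$P(\pi,x)=\limsup_{T\to\infty}\frac1T\,\mathbb{E}\Big[\sum_{\tau_n\in[0,T]}1[R_n\notin\mathcal{C}^\pi_{\tau_n}]\Big].$$ Assume $\sum_{j>i}q_j\sim\sum_{j\ge i}q_j$ as $i\to\infty$. Then the static policy that keeps in the cache the documents with the smallest indices subject to the constraint that their total size is at most $x$ (i.e., the documents $1,\dots,m$ with $m$ the largest integer satisfying $\sum_{i\le m}s_i\le x$) is asymptotically optimal: its long-run fault probability $P_s(x)$ satisfies $P_s(x)\sim\inf_\pi P(\pi,x)$ as $x\to\infty$, the infimum being over all such policies.
   Context: $a(x)\sim b(x)$ means $a(x)/b(x)\to1$ in the indicated limit. *)

theory Defs
  imports "HOL-Probability.Probability" "HOL-Library.Landau_Symbols"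
begin

section \<open>Path spaces\<close>

definition path_space :: "(real \<Rightarrow> nat) measure" where
  "path_space = PiM UNIV (\<lambda>_::real. count_space UNIV)"

definition tau_space :: "(int \<Rightarrow> real) measure" where
  "tau_space = PiM UNIV (\<lambda>_::int. borel)"

definition indep_J_tau :: "'a measure \<Rightarrow> (real \<Rightarrow> 'a \<Rightarrow> nat) \<Rightarrow> (int \<Rightarrow> 'a \<Rightarrow> real) \<Rightarrow> bool" where
  "indep_J_tau M J \<tau> \<longleftrightarrow>
     prob_space.indep_set M
       {(\<lambda>\<omega> t. J t \<omega>) -` A \<inter> space M | A. A \<in> sets path_space}
       {(\<lambda>\<omega> n. \<tau> n \<omega>) -` B \<inter> space M | B. B \<in> sets tau_space}"

section \<open>Unit-rate Poisson process on the real line, points indexed by int\<close>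

definition pcount :: "(int \<Rightarrow> 'a \<Rightarrow> real) \<Rightarrow> 'a \<Rightarrow> real \<Rightarrow> real \<Rightarrow> nat" where
  "pcount \<tau> \<omega> a b = card {n. a < \<tau> n \<omega> \<and> \<tau> n \<omega> \<le> b}"

definition unit_poisson :: "'a measure \<Rightarrow> (int \<Rightarrow> 'a \<Rightarrow> real) \<Rightarrow> bool" where
  "unit_poisson M \<tau> \<longleftrightarrow>
     (\<forall>n. \<tau> n \<in> borel_measurable M) \<and>
     (AE \<omega> in M. strict_mono (\<lambda>n. \<tau> n \<omega>) \<and> \<tau> 0 \<omega> \<le> 0 \<and> 0 < \<tau> 1 \<omega>) \<and>
     (\<forall>a b k. a \<le> b \<longrightarrow>
        measure M {\<omega> \<in> space M. pcount \<tau> \<omega> a b = k} = exp (-(b - a)) * (b - a) ^ k / fact k) \<and>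
     (\<forall>(t :: nat \<Rightarrow> real) m. strict_mono t \<longrightarrow>
        prob_space.indep_vars M (\<lambda>_. count_space UNIV)
          (\<lambda>i \<omega>. pcount \<tau> \<omega> (t i) (t (Suc i))) {..<m})"

section \<open>Stationary ergodic finite-state semi-Markov process\<close>

text \<open>Sigma-algebra generated by the embedded chain and the jump points up to index n.\<close>
definition mr_filt :: "'a measure \<Rightarrow> (real \<Rightarrow> 'a \<Rightarrow> nat) \<Rightarrow> (int \<Rightarrow> 'a \<Rightarrow> real) \<Rightarrow> int \<Rightarrow> 'a measure" where
  "mr_filt M J T n = sigma (space M)
     ({(\<lambda>\<omega>. J (T k \<omega>) \<omega>) -` A \<inter> space M | k A. k \<le> n} \<union>
      {T k -` B \<inter> space M | k B. k \<le> n \<and> B \<in> sets borel})"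

definition semi_markov ::
  "'a measure \<Rightarrow> nat \<Rightarrow> (real \<Rightarrow> 'a \<Rightarrow> nat) \<Rightarrow> (int \<Rightarrow> 'a \<Rightarrow> real) \<Rightarrow> bool" where
  "semi_markov M Ms J T \<longleftrightarrow>
     (\<forall>t. J t \<in> measurable M (count_space UNIV)) \<and>
     (\<lambda>(t, \<omega>). J t \<omega>) \<in> measurable (borel \<Otimes>\<^sub>M M) (count_space UNIV) \<and>
     (\<forall>n. T n \<in> borel_measurable M) \<and>
     (AE \<omega> in M. strict_mono (\<lambda>n. T n \<omega>) \<and> T 0 \<omega> \<le> 0 \<and> 0 < T 1 \<omega> \<and>
        (\<forall>t. \<exists>n. T n \<omega> \<le> t \<and> t < T (n + 1) \<omega>) \<and>
        (\<forall>n t. T n \<omega> \<le> t \<and> t < T (n + 1) \<omega> \<longrightarrow> J t \<omega> = J (T n \<omega>) \<omega>) \<and>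
        (\<forall>t. J t \<omega> \<in> {1..Ms})) \<and>
     (\<exists>(Q :: nat \<Rightarrow> nat \<Rightarrow> real \<Rightarrow> real) (P :: nat \<Rightarrow> nat \<Rightarrow> real).
        \<comment> \<open>Markov renewal property (semi-Markov kernel Q)\<close>
        (\<forall>n \<ge> 1. \<forall>j t. AE \<omega> in M.
           real_cond_exp M (mr_filt M J T n)
             (indicator {\<omega> \<in> space M. J (T (n + 1) \<omega>) \<omega> = j \<and> T (n + 1) \<omega> - T n \<omega> \<le> t}) \<omega>
           = Q (J (T n \<omega>) \<omega>) j t) \<and>
        \<comment> \<open>embedded chain is a Markov chain with transition matrix P\<close>
        (\<forall>n \<ge> 1. \<forall>j. AE \<omega> in M.
           real_cond_exp M (mr_filt M J T n)
             (indicator {\<omega> \<in> space M. J (T (n + 1) \<omega>) \<omega> = j}) \<omega>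
           = P (J (T n \<omega>) \<omega>) j) \<and>
        \<comment> \<open>irreducibility of the embedded chain\<close>
        (\<forall>i \<in> {1..Ms}. \<forall>j \<in> {1..Ms}. (i, j) \<in> {(a, b). P a b > 0}\<^sup>*))"

definition stationary_ergodic :: "'a measure \<Rightarrow> (real \<Rightarrow> 'a \<Rightarrow> nat) \<Rightarrow> bool" where
  "stationary_ergodic M J \<longleftrightarrow>
     (\<forall>s. distr M path_space (\<lambda>\<omega> t. J (t + s) \<omega>) = distr M path_space (\<lambda>\<omega> t. J t \<omega>)) \<and>
     (\<forall>A \<in> sets path_space. (\<forall>s f. ((\<lambda>t. f (t + s)) \<in> A) = (f \<in> A)) \<longrightarrow>
        measure (distr M path_space (\<lambda>\<omega> t. J t \<omega>)) A \<in> {0, 1})"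

definition stat_dist :: "'a measure \<Rightarrow> (real \<Rightarrow> 'a \<Rightarrow> nat) \<Rightarrow> nat \<Rightarrow> real" where
  "stat_dist M J r = measure M {\<omega> \<in> space M. J 0 \<omega> = r}"

section \<open>Request process\<close>

text \<open>Information: request times tau_1..tau_n and the environment J_t, 0 <= t <= tau_n.\<close>
definition req_filt :: "'a measure \<Rightarrow> (real \<Rightarrow> 'a \<Rightarrow> nat) \<Rightarrow> (int \<Rightarrow> 'a \<Rightarrow> real) \<Rightarrow> nat \<Rightarrow> 'a measure" where
  "req_filt M J \<tau> n = sigma (space M)
     ({\<tau> (int l) -` B \<inter> space M | l B. 1 \<le> l \<and> l \<le> n \<and> B \<in> sets borel} \<union>
      {(\<lambda>\<omega>. J (min t (\<tau> (int n) \<omega>)) \<omega>) -` A \<inter> space M | t A. 0 \<le> t})"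

definition request_model ::
  "'a measure \<Rightarrow> nat \<Rightarrow> (real \<Rightarrow> 'a \<Rightarrow> nat) \<Rightarrow> (int \<Rightarrow> 'a \<Rightarrow> real) \<Rightarrow> (nat \<Rightarrow> 'a \<Rightarrow> nat)
     \<Rightarrow> (nat \<Rightarrow> nat \<Rightarrow> real) \<Rightarrow> bool" where
  "request_model M Ms J \<tau> R q \<longleftrightarrow>
     (\<forall>n. R n \<in> measurable M (count_space UNIV)) \<and>
     (\<forall>r \<in> {1..Ms}. (\<forall>i. 0 \<le> q r i) \<and> (\<lambda>i. q r (Suc i)) sums 1) \<and>
     (\<forall>n \<ge> 1. \<forall>i :: nat \<Rightarrow> nat. (\<forall>l \<in> {1..n}. 1 \<le> i l) \<longrightarrow>
        (AE \<omega> in M. real_cond_exp M (req_filt M J \<tau> n)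
            (indicator {\<omega> \<in> space M. \<forall>l \<in> {1..n}. R l \<omega> = i l}) \<omega>
          = (\<Prod>l = 1..n. q (J (\<tau> (int l) \<omega>) \<omega>) (i l))))"

definition avg_pop :: "'a measure \<Rightarrow> nat \<Rightarrow> (real \<Rightarrow> 'a \<Rightarrow> nat) \<Rightarrow> (nat \<Rightarrow> nat \<Rightarrow> real) \<Rightarrow> nat \<Rightarrow> real" where
  "avg_pop M Ms J q i = (\<Sum>r = 1..Ms. stat_dist M J r * q r i)"

section \<open>Caching policies\<close>

definition cache_ok :: "(nat \<Rightarrow> real) \<Rightarrow> real \<Rightarrow> nat set \<Rightarrow> bool" where
  "cache_ok s x C \<longleftrightarrow> finite C \<and> C \<subseteq> {1..} \<and> (\<Sum>i\<in>C. s i) \<le> x"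

text \<open>A policy is an initial content C0 (at tau_0) and a decision rule f that, after a miss at
  tau_n, maps the requests [R_1..R_n] and contents [C_0..C_n] to the new content.
  cache_hist C0 f r n = [C_0, ..., C_n], where C_k is the content at tau_k.\<close>
fun cache_hist :: "nat set \<Rightarrow> (nat list \<Rightarrow> nat set list \<Rightarrow> nat set) \<Rightarrow> (nat \<Rightarrow> nat) \<Rightarrow> nat \<Rightarrow> nat set list" where
  "cache_hist C0 f r 0 = [C0]"
| "cache_hist C0 f r (Suc 0) = [C0, C0]"
| "cache_hist C0 f r (Suc (Suc n)) =
     (let cs = cache_hist C0 f r (Suc n); c = last cs
      in cs @ [if r (Suc n) \<in> c then c else f (map r [1..<Suc (Suc n)]) cs])"

definition content :: "nat set \<Rightarrow> (nat list \<Rightarrow> nat set list \<Rightarrow> nat set) \<Rightarrow> (nat \<Rightarrow> nat) \<Rightarrow> nat \<Rightarrow> nat set" where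
  "content C0 f r n = last (cache_hist C0 f r n)"

definition policies :: "(nat \<Rightarrow> real) \<Rightarrow> real \<Rightarrow> (nat set \<times> (nat list \<Rightarrow> nat set list \<Rightarrow> nat set)) set" where
  "policies s x = {(C0, f). cache_ok s x C0 \<and> (\<forall>rs cs. cache_ok s x (f rs cs))}"

definition fault_prob ::
  "'a measure \<Rightarrow> (int \<Rightarrow> 'a \<Rightarrow> real) \<Rightarrow> (nat \<Rightarrow> 'a \<Rightarrow> nat)
     \<Rightarrow> nat set \<times> (nat list \<Rightarrow> nat set list \<Rightarrow> nat set) \<Rightarrow> ereal" where
  "fault_prob M \<tau> R p = Limsup at_top (\<lambda>T::real.
     enn2ereal (\<integral>\<^sup>+ \<omega>. of_nat (card {n::nat. 1 \<le> n \<and> 0 \<le> \<tau> (int n) \<omega> \<and> \<tau> (int n) \<omega> \<le> T \<and>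
                         R n \<omega> \<notin> content (fst p) (snd p) (\<lambda>k. R k \<omega>) n}) \<partial>M) / ereal T)"

definition static_set :: "(nat \<Rightarrow> real) \<Rightarrow> real \<Rightarrow> nat set" where
  "static_set s x = {1..(GREATEST m. (\<Sum>i = 1..m. s i) \<le> x)}"

definition static_policy :: "(nat \<Rightarrow> real) \<Rightarrow> real \<Rightarrow> nat set \<times> (nat list \<Rightarrow> nat set list \<Rightarrow> nat set)" where
  "static_policy s x = (static_set s x, (\<lambda>rs cs. last cs))"

end

theory Submission
  imports Defs
begin

text \<open>
  Let \<open>W\<close> be the time that the environment spends in state \<open>r\<close> during \<open>[0, L]\<close>. The conditional expectation of \<open>W / L\<close> given
  the past up to a jump is a function of the current state of the embedded chain that is harmonic up to \<open>o(1)\<close>, hence by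
  irreducibility nearly constant. So \<open>W\<close> is nearly uncorrelated with the event \<open>J 0 = r\<close>, and by stationarity its
  variance is \<open>o(L\<^sup>2)\<close>. Conditionally on the environment, the number of requests made in state \<open>r\<close> is Poisson with mean \<open>W\<close>;
  second moments are obtained by discretising time, and so this number is \<open>\<pi> r * L + o(L)\<close> in the mean.

  For a lower bound on the faults, cut time into blocks of a fixed large length \<open>L\<close>. A block contains a fault as soon as
  some request misses the content held at its beginning. Given the environment, requests are independent, so this has
  probability at least \<open>L * \<delta> * (1 - \<epsilon>) - O(\<delta>\<^sup>2)\<close>, where \<open>\<delta>\<close> is the smallest possible mean miss probability of a content.
  By the fractional knapsack bound, \<open>\<delta>\<close> is at least the popularity of the documents after \<open>m + 1\<close>, where the static policy
  stores the first \<open>m\<close> documents and has fault probability at most the popularity of the documents after \<open>m\<close>. These two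
  tails are asymptotically equal, and \<open>\<delta> \<rightarrow> 0\<close>.
\<close>

section \<open>Occupation times of the semi-Markov process\<close>

text \<open>The lower bound needs the number of requests made in each single state, not only their
  total. A content may miss rarely in one state and often in another, and only when state
  \<open>r\<close> is met about \<open>\<pi> r * L\<close> times does the miss probability of a
  block depend on the content through its mean over the states. Mean-square control over one fixed
  window suffices for this. No moments of the sojourn times are assumed. Every shift of a window is
  therefore bounded by the minimum of the shift and the window length, whose mean is still
  \<open>o(L)\<close>. The order of the choices matters: \<open>L\<close> depends on the tolerance
  alone and is fixed before the cache size, the policy and the position of the block. Only then is
  the error quadratic in \<open>\<delta>\<close> negligible as the cache grows. The request law is
  given at deterministic indices, whereas a time block holds a random range of them; hence outcomes
  are sorted into events with prescribed index range.\<close>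

locale markov_renewal = prob_space M for M :: "'a measure" +
  fixes Ms :: nat and J :: "real \<Rightarrow> 'a \<Rightarrow> nat" and T :: "int \<Rightarrow> 'a \<Rightarrow> real"
    and Q :: "nat \<Rightarrow> nat \<Rightarrow> real \<Rightarrow> real" and P :: "nat \<Rightarrow> nat \<Rightarrow> real"
  assumes J_joint: "(\<lambda>(t, \<omega>). J t \<omega>) \<in> measurable (borel \<Otimes>\<^sub>M M) (count_space UNIV)"
    and T_meas [measurable]: "\<And>n. T n \<in> borel_measurable M"
    and path: "AE \<omega> in M. strict_mono (\<lambda>n. T n \<omega>) \<and> T 0 \<omega> \<le> 0 \<and> 0 < T 1 \<omega> \<and>
        (\<forall>t. \<exists>n. T n \<omega> \<le> t \<and> t < T (n + 1) \<omega>) \<and>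
        (\<forall>n t. T n \<omega> \<le> t \<and> t < T (n + 1) \<omega> \<longrightarrow> J t \<omega> = J (T n \<omega>) \<omega>) \<and>
        (\<forall>t. J t \<omega> \<in> {1..Ms})"
    and renewal: "\<And>n j t. n \<ge> 1 \<Longrightarrow> AE \<omega> in M.
           real_cond_exp M (mr_filt M J T n)
             (indicator {\<omega> \<in> space M. J (T (n + 1) \<omega>) \<omega> = j \<and> T (n + 1) \<omega> - T n \<omega> \<le> t}) \<omega>
           = Q (J (T n \<omega>) \<omega>) j t"
    and chain: "\<And>n j. n \<ge> 1 \<Longrightarrow> AE \<omega> in M.
           real_cond_exp M (mr_filt M J T n)
             (indicator {\<omega> \<in> space M. J (T (n + 1) \<omega>) \<omega> = j}) \<omega>
           = P (J (T n \<omega>) \<omega>) j"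
    and irred: "\<And>i j. i \<in> {1..Ms} \<Longrightarrow> j \<in> {1..Ms} \<Longrightarrow> (i, j) \<in> {(a, b). P a b > 0}\<^sup>*"
begin

abbreviation "F \<equiv> mr_filt M J T"

definition X :: "int \<Rightarrow> 'a \<Rightarrow> nat" where "X n \<omega> = J (T n \<omega>) \<omega>"

text \<open>Joint measurability in time and outcome permits evaluating the environment at random
  times such as \<open>T n\<close> and \<open>\<tau> n\<close>.\<close>

lemma J_at_measurable [measurable (raw)]:
  assumes [measurable]: "f \<in> borel_measurable N" "g \<in> measurable N M"
  shows "(\<lambda>\<omega>. J (f \<omega>) (g \<omega>)) \<in> measurable N (count_space UNIV)"
proof -
  have "(\<lambda>\<omega>. (f \<omega>, g \<omega>)) \<in> measurable N (borel \<Otimes>\<^sub>M M)" by simp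
  from measurable_compose[OF this J_joint] show ?thesis by simp
qed

lemma J_eq_measurable [measurable (raw)]:
  assumes [measurable]: "f \<in> borel_measurable N" "g \<in> measurable N M"
  shows "Measurable.pred N (\<lambda>\<omega>. J (f \<omega>) (g \<omega>) = r)"
  using measurable_sets[OF J_at_measurable[OF assms], of "{r}"] by (simp add: pred_def vimage_def Int_def conj_commute)

abbreviation at_state :: "int \<Rightarrow> nat \<Rightarrow> 'a set" where
  "at_state n i \<equiv> {\<omega> \<in> space M. X n \<omega> = i}"

lemma X_M [measurable]: "X n \<in> measurable M (count_space UNIV)"
  unfolding X_def by simp

section \<open>The filtration of the renewal process, and the renewal property on its events\<close>

lemma gen_F: "({(\<lambda>\<omega>. J (T k \<omega>) \<omega>) -` A \<inter> space M | k A. k \<le> n} \<union>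
      {T k -` B \<inter> space M | k B. k \<le> n \<and> B \<in> sets borel}) \<subseteq> sets M"
  using measurable_sets[OF J_at_measurable[OF T_meas measurable_ident]] measurable_sets[OF T_meas] by auto

lemma sets_F: "sets (F n) = sigma_sets (space M) ({(\<lambda>\<omega>. J (T k \<omega>) \<omega>) -` A \<inter> space M | k A. k \<le> n} \<union>
      {T k -` B \<inter> space M | k B. k \<le> n \<and> B \<in> sets borel})"
  unfolding mr_filt_def by (rule sets_measure_of) (use gen_F sets.space_closed in blast)

lemma space_F [simp]: "space (F n) = space M"
  unfolding mr_filt_def by (rule space_measure_of) (use gen_F sets.space_closed in blast)

lemma subalg_F: "subalgebra M (F n)"
  unfolding subalgebra_def sets_F using gen_F by (auto intro!: sets.sigma_sets_subset)

lemma space_in_F: "space M \<in> sets (F n)"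
  using sets.top[of "F n"] by simp

lemma F_in_M: "G \<in> sets (F n) \<Longrightarrow> G \<in> sets M"
  using subalg_F by (auto simp: subalgebra_def)

lemma F_mono: "n \<le> m \<Longrightarrow> sets (F n) \<subseteq> sets (F m)"
  unfolding sets_F by (intro sigma_sets_mono' Un_mono) (blast intro: order_trans)+

lemma X_F: "k \<le> n \<Longrightarrow> X k \<in> measurable (F n) (count_space UNIV)"
  by (rule measurableI) (auto simp: X_def[abs_def] sets_F intro!: sigma_sets.Basic)

lemma T_F: "k \<le> n \<Longrightarrow> T k \<in> borel_measurable (F n)"
  by (rule measurableI) (auto simp: sets_F intro!: sigma_sets.Basic)

sublocale Fsub: finite_measure_subalgebra M "F n" for n
  by unfold_locales (rule subalg_F)

lemma X_range: "AE \<omega> in M. X n \<omega> \<in> {1..Ms}"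
  using path by (auto simp: X_def)

text \<open>On an event of \<open>F n\<close> inside \<open>X n = i\<close> the conditional
  expectation is the constant \<open>c i\<close>, so integrating it there gives a product. Later
  arguments on the renewal process use this form and not conditional expectations.\<close>

lemma cond_exp_step:
  assumes G: "G \<in> sets (F n)" and E: "E \<in> sets M"
    and ce: "AE \<omega> in M. real_cond_exp M (F n) (indicator E) \<omega> = c (J (T n \<omega>) \<omega>)"
  shows "measure M (G \<inter> at_state n i \<inter> E)
    = c i * measure M (G \<inter> at_state n i)"
proof -
  have [measurable]: "G \<in> sets M" "E \<in> sets M" using G E F_in_M by auto
  have G': "G \<inter> at_state n i \<in> sets (F n)"
    using measurable_sets[OF X_F[of n n], of "{i}"] G by (intro sets.Int) (auto simp: vimage_def Int_def conj_commute)
  let ?G = "G \<inter> at_state n i"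
  have "measure M (?G \<inter> E) = (\<integral>\<omega>. indicator ?G \<omega> * indicator E \<omega> \<partial>M)"
    by (simp flip: indicator_inter_arith)
  also have "\<dots> = (\<integral>\<omega>. indicator ?G \<omega> * real_cond_exp M (F n) (indicator E) \<omega> \<partial>M)"
    by (rule Fsub.real_cond_exp_intg(2)[symmetric])
       (use G' in \<open>auto simp flip: indicator_inter_arith intro!: integrable_real_indicator simp: less_top[symmetric]\<close>)
  also have "\<dots> = (\<integral>\<omega>. c i * indicator ?G \<omega> \<partial>M)"
    using ce by (intro integral_cong_AE) (auto simp: indicator_def X_def)
  also have "\<dots> = c i * measure M ?G" by simp
  finally show ?thesis .
qed

lemma renewal_step:
  assumes "n \<ge> 1" "G \<in> sets (F n)"
  shows "measure M (G \<inter> at_state n i \<inter> {\<omega> \<in> space M. X (n + 1) \<omega> = j \<and> T (n + 1) \<omega> - T n \<omega> \<le> t})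
    = Q i j t * measure M (G \<inter> at_state n i)"
  by (rule cond_exp_step[OF assms(2)]) (use renewal[OF assms(1)] in \<open>auto simp: X_def\<close>)

lemma chain_step:
  assumes "n \<ge> 1" "G \<in> sets (F n)"
  shows "measure M (G \<inter> at_state n i \<inter> at_state (n + 1) j)
    = P i j * measure M (G \<inter> at_state n i)"
  by (rule cond_exp_step[OF assms(2)]) (use chain[OF assms(1)] in \<open>auto simp: X_def\<close>)

text \<open>By \<open>chain_step\<close> an edge from \<open>y\<close> to \<open>z\<close> carries
  the mass of its source times \<open>P y z\<close>, so positive mass is passed on.\<close>

lemma visited_rtrancl:
  assumes "(i, j) \<in> {(a, b). P a b > 0}\<^sup>*" "\<exists>n\<ge>1. measure M (at_state n i) > 0"
  shows "\<exists>n\<ge>1. measure M (at_state n j) > 0"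
  using assms
proof (induction rule: rtrancl_induct)
  case (step y z)
  then obtain n where n: "n \<ge> 1" "measure M (at_state n y) > 0" by auto
  have "0 < P y z * measure M (space M \<inter> at_state n y)"
    using n step(2) by (simp add: Int_def)
  also have "\<dots> = measure M (space M \<inter> at_state n y \<inter> at_state (n + 1) z)"
    using n by (subst chain_step) (auto intro: space_in_F)
  also have "\<dots> \<le> measure M (at_state (n + 1) z)"
    by (rule finite_measure_mono) auto
  finally show ?case using n(1) by (intro exI[of _ "n + 1"]) auto
qed simp

lemma sum_X: 
  assumes [measurable]: "G \<in> sets M"
  shows "measure M G = (\<Sum>i\<in>{1..Ms}. measure M (G \<inter> at_state n i))"
proof -
  have "measure M G = measure M (\<Union>i\<in>{1..Ms}. G \<inter> at_state n i)"
    using X_range[of n] by (intro finite_measure_eq_AE) (auto elim!: AE_mp)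
  also have "\<dots> = (\<Sum>i\<in>{1..Ms}. measure M (G \<inter> at_state n i))"
    by (intro finite_measure_finite_Union) (auto simp: disjoint_family_on_def)
  finally show ?thesis .
qed

text \<open>Some state carries mass at epoch 1, and irreducibility spreads it. The renewal
  hypotheses determine \<open>P\<close> and \<open>Q\<close> only at states charged at some epoch
  \<open>n \<ge> 1\<close>, so every state needs such an epoch.\<close>

lemma visited:
  assumes "i \<in> {1..Ms}"
  shows "\<exists>n\<ge>1. measure M (at_state n i) > 0"
proof -
  have "\<exists>k\<in>{1..Ms}. measure M (space M \<inter> at_state 1 k) \<noteq> 0"
  proof (rule ccontr)
    assume "\<not> ?thesis"
    then have "(\<Sum>k\<in>{1..Ms}. measure M (space M \<inter> at_state 1 k)) = 0"
      by (intro sum.neutral) blast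
    then show False unfolding sum_X[OF sets.top, of 1, symmetric] prob_space by simp
  qed
  then obtain k where k: "k \<in> {1..Ms}" "measure M (space M \<inter> at_state 1 k) \<noteq> 0"
    by blast
  have "space M \<inter> at_state 1 k = at_state 1 k" by auto
  with k(2) have "measure M (at_state 1 k) > 0"
    by (simp add: zero_less_measure_iff)
  then have "\<exists>n\<ge>1. measure M (at_state n k) > 0"
    by (intro exI[of _ 1]) simp
  from visited_rtrancl[OF irred[OF k(1) assms] this] show ?thesis .
qed

text \<open>\<open>P\<close> comes from an existential statement that does not say that it is
  stochastic; sign and row sums are read off at a charged epoch.\<close>

lemma P_nonneg: 
  assumes "i \<in> {1..Ms}"
  shows "0 \<le> P i j"
proof -
  from visited[OF assms] obtain n where n: "n \<ge> 1" "measure M (at_state n i) > 0" by blast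
  have "0 \<le> P i j * measure M (space M \<inter> at_state n i)"
    unfolding chain_step[OF n(1) space_in_F, symmetric] by simp
  moreover have "space M \<inter> at_state n i = at_state n i" by auto
  ultimately show ?thesis using n(2) by (metis mult_less_0_iff not_le)
qed

lemma P_sum:
  assumes "i \<in> {1..Ms}"
  shows "(\<Sum>j\<in>{1..Ms}. P i j) = 1"
proof -
  from visited[OF assms] obtain n where n: "n \<ge> 1" "measure M (at_state n i) > 0" by blast
  let ?A = "space M \<inter> at_state n i"
  have "(\<Sum>j\<in>{1..Ms}. P i j) * measure M ?A = (\<Sum>j\<in>{1..Ms}. measure M (?A \<inter> at_state (n + 1) j))"
    unfolding sum_distrib_right by (intro sum.cong refl chain_step[OF n(1) space_in_F, symmetric])
  also have "\<dots> = measure M ?A" by (rule sum_X[symmetric]) simp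
  finally have "(\<Sum>j\<in>{1..Ms}. P i j) * measure M ?A = measure M ?A" .
  moreover have "?A = at_state n i" by auto
  ultimately show ?thesis using n(2) by simp
qed

section \<open>The semi-Markov kernel as a family of measures\<close>

definition "nvis i = (SOME n. n \<ge> 1 \<and> measure M (at_state n i) > 0)"

lemma nvis:
  assumes "i \<in> {1..Ms}"
  shows "nvis i \<ge> 1" "measure M (at_state (nvis i) i) > 0"
  using someI_ex[OF visited[OF assms]] unfolding nvis_def[symmetric] by blast+

text \<open>The semi-Markov kernel as a measure, read off at one epoch at which the state is charged.\<close>
definition kern :: "nat \<Rightarrow> nat \<Rightarrow> real measure" where
  "kern i j = distr (density M (\<lambda>\<omega>. indicator {\<omega> \<in> space M. X (nvis i) \<omega> = i \<and> X (nvis i + 1) \<omega> = j} \<omega>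
       / ennreal (measure M (at_state (nvis i) i))))
     borel (\<lambda>\<omega>. T (nvis i + 1) \<omega> - T (nvis i) \<omega>)"

lemma sets_kern [simp, measurable_cong]: "sets (kern i j) = sets borel" and space_kern [simp]: "space (kern i j) = UNIV"
  by (auto simp: kern_def)

lemma emeasure_kern:
  assumes "i \<in> {1..Ms}" and [measurable]: "B \<in> sets borel"
  shows "emeasure (kern i j) B = ennreal (measure M {\<omega> \<in> space M. X (nvis i) \<omega> = i \<and> X (nvis i + 1) \<omega> = j \<and>
     T (nvis i + 1) \<omega> - T (nvis i) \<omega> \<in> B} / measure M (at_state (nvis i) i))"
proof -
  let ?p = "measure M (at_state (nvis i) i)"
  let ?D = "\<lambda>\<omega>. T (nvis i + 1) \<omega> - T (nvis i) \<omega>"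
  have "emeasure (kern i j) B = (\<integral>\<^sup>+\<omega>. indicator {\<omega> \<in> space M. X (nvis i) \<omega> = i \<and> X (nvis i + 1) \<omega> = j} \<omega>
       / ennreal ?p * indicator (?D -` B \<inter> space M) \<omega> \<partial>M)"
    unfolding kern_def by (subst emeasure_distr) (auto simp: emeasure_density)
  also have "\<dots> = (\<integral>\<^sup>+\<omega>. indicator {\<omega> \<in> space M. X (nvis i) \<omega> = i \<and> X (nvis i + 1) \<omega> = j \<and> ?D \<omega> \<in> B} \<omega> / ennreal ?p \<partial>M)"
    by (intro nn_integral_cong) (auto simp: indicator_def)
  also have "\<dots> = emeasure M {\<omega> \<in> space M. X (nvis i) \<omega> = i \<and> X (nvis i + 1) \<omega> = j \<and> ?D \<omega> \<in> B} / ennreal ?p"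
    by (subst nn_integral_divide) auto
  also have "\<dots> = ennreal (measure M {\<omega> \<in> space M. X (nvis i) \<omega> = i \<and> X (nvis i + 1) \<omega> = j \<and> ?D \<omega> \<in> B} / ?p)"
    using nvis(2)[OF assms(1)] by (simp add: emeasure_eq_measure divide_ennreal)
  finally show ?thesis .
qed

lemma finite_kern: "i \<in> {1..Ms} \<Longrightarrow> finite_measure (kern i j)"
  by (rule finite_measureI) (subst space_kern, subst emeasure_kern, auto)

text \<open>The renewal property at the chosen epoch identifies \<open>Q i j\<close> as the
  distribution function of \<open>kern i j\<close>. As \<open>Q\<close> is common to all epochs, the
  measure read off at one of them governs all.\<close>

lemma measure_kern_atMost: 
  assumes i: "i \<in> {1..Ms}"
  shows "measure (kern i j) {..t} = Q i j t"
proof -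
  let ?n = "nvis i"
  have "measure (kern i j) {..t} = measure M {\<omega> \<in> space M. X (nvis i) \<omega> = i \<and> X (nvis i + 1) \<omega> = j \<and>
     T (nvis i + 1) \<omega> - T (nvis i) \<omega> \<in> {..t}} / measure M (at_state (nvis i) i)"
    unfolding measure_def[of "kern i j"] by (subst emeasure_kern[OF i]) (auto intro!: enn2real_ennreal)
  also have "{\<omega> \<in> space M. X (nvis i) \<omega> = i \<and> X (nvis i + 1) \<omega> = j \<and> T (nvis i + 1) \<omega> - T (nvis i) \<omega> \<in> {..t}}
     = space M \<inter> {\<omega> \<in> space M. X ?n \<omega> = i} \<inter> {\<omega> \<in> space M. X (?n + 1) \<omega> = j \<and> T (?n + 1) \<omega> - T ?n \<omega> \<le> t}" by auto
  also have "measure M \<dots> = Q i j t * measure M (space M \<inter> {\<omega> \<in> space M. X ?n \<omega> = i})"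
    by (rule renewal_step) (use nvis[OF i] in \<open>auto intro: space_in_F\<close>)
  finally show ?thesis using nvis(2)[OF i] by (simp add: Int_def)
qed

text \<open>Both sides are finite Borel measures in \<open>B\<close> whose distribution functions
  agree by \<open>renewal_step\<close>; uniqueness extends the identity from half-lines to all Borel
  sets.\<close>

lemma kernel_step:
  assumes n: "n \<ge> 1" and G: "G \<in> sets (F n)" and i: "i \<in> {1..Ms}" and B: "B \<in> sets borel"
  shows "emeasure M (G \<inter> at_state n i \<inter> {\<omega> \<in> space M. X (n + 1) \<omega> = j \<and> T (n + 1) \<omega> - T n \<omega> \<in> B})
    = emeasure M (G \<inter> at_state n i) * emeasure (kern i j) B"
proof -
  have [measurable]: "G \<in> sets M" using G F_in_M by auto
  let ?G = "G \<inter> at_state n i" and ?H = "G \<inter> at_state n i \<inter> at_state (n + 1) j"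
  define \<mu> where "\<mu> = distr (density M (indicator ?H)) borel (\<lambda>\<omega>. T (n + 1) \<omega> - T n \<omega>)"
  define \<nu> where "\<nu> = scale_measure (ennreal (measure M ?G)) (kern i j)"
  have \<mu>: "emeasure \<mu> C = emeasure M (?G \<inter> {\<omega> \<in> space M. X (n + 1) \<omega> = j \<and> T (n + 1) \<omega> - T n \<omega> \<in> C})" 
    if [measurable]: "C \<in> sets borel" for C
  proof -
    have "emeasure \<mu> C = (\<integral>\<^sup>+\<omega>. indicator ?H \<omega> * indicator ((\<lambda>\<omega>. T (n + 1) \<omega> - T n \<omega>) -` C \<inter> space M) \<omega> \<partial>M)"
      unfolding \<mu>_def by (subst emeasure_distr) (auto simp: emeasure_density)
    also have "\<dots> = (\<integral>\<^sup>+\<omega>. indicator (?G \<inter> {\<omega> \<in> space M. X (n + 1) \<omega> = j \<and> T (n + 1) \<omega> - T n \<omega> \<in> C}) \<omega> \<partial>M)"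
      by (intro nn_integral_cong) (auto simp: indicator_def)
    finally show ?thesis by simp
  qed
  have \<nu>: "emeasure \<nu> C = emeasure M ?G * emeasure (kern i j) C" for C
    unfolding \<nu>_def by (simp add: emeasure_eq_measure)
  interpret Kf: finite_measure "kern i j" by (rule finite_kern[OF i])
  have fin: "finite_borel_measure \<mu>" "finite_borel_measure \<nu>"
  proof -
    have [simp]: "sets \<mu> = sets borel" "space \<mu> = UNIV" "sets \<nu> = sets borel" "space \<nu> = UNIV"
      by (auto simp: \<mu>_def \<nu>_def space_scale_measure)
    have "finite_measure \<mu>" by (rule finite_measureI) (simp add: \<mu>)
    moreover have "finite_measure \<nu>"
      by (rule finite_measureI) (simp add: \<nu> emeasure_eq_measure Kf.emeasure_eq_measure ennreal_mult[symmetric])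
    ultimately show "finite_borel_measure \<mu>" "finite_borel_measure \<nu>"
      by (auto simp: finite_borel_measure_def finite_borel_measure_axioms_def)
  qed
  have "cdf \<mu> = cdf \<nu>"
  proof
    fix t
    have "cdf \<mu> t = measure M (?G \<inter> {\<omega> \<in> space M. X (n + 1) \<omega> = j \<and> T (n + 1) \<omega> - T n \<omega> \<in> {..t}})"
      unfolding cdf_def measure_def using \<mu>[of "{..t}"] by simp
    also have "\<dots> = Q i j t * measure M ?G" using renewal_step[OF n G, of i j t] by simp
    also have "\<dots> = cdf \<nu> t"
      unfolding cdf_def using \<nu>[of "{..t}"] measure_kern_atMost[OF i, of j t] 
      by (simp add: measure_def[of \<nu>] enn2real_mult) (simp add: measure_def)
    finally show "cdf \<mu> t = cdf \<nu> t" .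
  qed
  from cdf_unique'[OF fin this] have "\<mu> = \<nu>" .
  then have "emeasure \<mu> B = emeasure \<nu> B" by (rule arg_cong)
  also have "emeasure \<mu> B = emeasure M (?G \<inter> {\<omega> \<in> space M. X (n + 1) \<omega> = j \<and> T (n + 1) \<omega> - T n \<omega> \<in> B})"
    by (rule \<mu>[OF B])
  also have "emeasure \<nu> B = emeasure M ?G * emeasure (kern i j) B" by (rule \<nu>)
  finally show ?thesis .
qed

text \<open>Given \<open>X n = i\<close>, the next state and the sojourn are independent of the
  past, here represented by \<open>A\<close>. It suffices to compare the joint law of
  \<open>A\<close> and the sojourn with a product measure on rectangles.\<close>

lemma kernel_integral:
  assumes n: "n \<ge> 1" and G: "G \<in> sets (F n)" and i: "i \<in> {1..Ms}"
    and A: "A \<in> borel_measurable (F n)" and h: "h \<in> borel_measurable (borel \<Otimes>\<^sub>M borel)"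
  shows "(\<integral>\<^sup>+\<omega>. indicator (G \<inter> at_state n i \<inter> at_state (n + 1) j) \<omega> * h (A \<omega>, T (n + 1) \<omega> - T n \<omega>) \<partial>M)
    = (\<integral>\<^sup>+\<omega>. indicator (G \<inter> at_state n i) \<omega> * (\<integral>\<^sup>+d. h (A \<omega>, d) \<partial>kern i j) \<partial>M)"
proof -
  note [measurable] = h
  have [measurable]: "G \<in> sets M" "A \<in> borel_measurable M"
    using G F_in_M measurable_from_subalg[OF subalg_F A] by auto
  let ?G = "G \<inter> at_state n i" and ?H = "G \<inter> at_state n i \<inter> at_state (n + 1) j"
  let ?D = "\<lambda>\<omega>. T (n + 1) \<omega> - T n \<omega>"
  define \<mu> where "\<mu> = distr (density M (indicator ?G)) borel A"
  define \<rho> where "\<rho> = distr (density M (indicator ?H)) (borel \<Otimes>\<^sub>M borel) (\<lambda>\<omega>. (A \<omega>, ?D \<omega>))"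
  interpret Kf: finite_measure "kern i j" by (rule finite_kern[OF i])
  have fin: "finite_measure \<mu>"
  proof (rule finite_measureI)
    have "emeasure \<mu> (space \<mu>) = (\<integral>\<^sup>+\<omega>. indicator ?G \<omega> * indicator (A -` UNIV \<inter> space M) \<omega> \<partial>M)"
      unfolding \<mu>_def space_distr by (subst emeasure_distr) (auto simp: emeasure_density)
    also have "\<dots> \<le> (\<integral>\<^sup>+\<omega>. 1 \<partial>M)" by (intro nn_integral_mono) (auto simp: indicator_def)
    finally show "emeasure \<mu> (space \<mu>) \<noteq> \<infinity>" by (auto simp: emeasure_space_1 top_unique)
  qed
  interpret \<mu>: finite_measure \<mu> by (rule fin)
  interpret pair_sigma_finite \<mu> "kern i j" ..
  have "\<mu> \<Otimes>\<^sub>M kern i j = \<rho>"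
  proof (rule pair_measure_eqI)
    show "sigma_finite_measure \<mu>" "sigma_finite_measure (kern i j)" by unfold_locales
    show "sets (\<mu> \<Otimes>\<^sub>M kern i j) = sets \<rho>"
      by (simp add: \<rho>_def \<mu>_def cong: sets_pair_measure_cong)
    fix U B assume "U \<in> sets \<mu>" "B \<in> sets (kern i j)"
    then have [measurable]: "U \<in> sets borel" "B \<in> sets borel" by (auto simp: \<mu>_def)
    \<comment> \<open>The condition on \<open>A\<close> is absorbed into the event, so that
      \<open>kernel_step\<close> applies to each rectangle.\<close>
    have G': "G \<inter> (A -` U \<inter> space M) \<in> sets (F n)"
      using measurable_sets[OF A, of U] G by auto
    have "emeasure \<mu> U = emeasure M ((G \<inter> (A -` U \<inter> space M)) \<inter> at_state n i)"
    proof -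
      have "emeasure \<mu> U = (\<integral>\<^sup>+\<omega>. indicator ?G \<omega> * indicator (A -` U \<inter> space M) \<omega> \<partial>M)"
        unfolding \<mu>_def by (subst emeasure_distr) (auto simp: emeasure_density)
      also have "\<dots> = (\<integral>\<^sup>+\<omega>. indicator ((G \<inter> (A -` U \<inter> space M)) \<inter> at_state n i) \<omega> \<partial>M)"
        by (intro nn_integral_cong) (auto simp: indicator_def)
      finally show ?thesis by simp
    qed
    moreover have "emeasure \<rho> (U \<times> B) = emeasure M ((G \<inter> (A -` U \<inter> space M)) \<inter> at_state n i \<inter>
         {\<omega> \<in> space M. X (n + 1) \<omega> = j \<and> ?D \<omega> \<in> B})"
    proof -
      have "emeasure \<rho> (U \<times> B) = (\<integral>\<^sup>+\<omega>. indicator ?H \<omega> * indicator ((\<lambda>\<omega>. (A \<omega>, ?D \<omega>)) -` (U \<times> B) \<inter> space M) \<omega> \<partial>M)"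
        unfolding \<rho>_def by (subst emeasure_distr) (auto simp: emeasure_density)
      also have "\<dots> = (\<integral>\<^sup>+\<omega>. indicator ((G \<inter> (A -` U \<inter> space M)) \<inter> at_state n i \<inter>
         {\<omega> \<in> space M. X (n + 1) \<omega> = j \<and> ?D \<omega> \<in> B}) \<omega> \<partial>M)"
        by (intro nn_integral_cong) (auto simp: indicator_def)
      finally show ?thesis by simp
    qed
    ultimately show "emeasure \<mu> U * emeasure (kern i j) B = emeasure \<rho> (U \<times> B)"
      using kernel_step[OF n G' i, of B j] by simp
  qed
  have "(\<integral>\<^sup>+\<omega>. indicator ?H \<omega> * h (A \<omega>, ?D \<omega>) \<partial>M) = (\<integral>\<^sup>+z. h z \<partial>\<rho>)"
    unfolding \<rho>_def by (subst nn_integral_distr) (auto simp: nn_integral_density)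
  also have "\<dots> = (\<integral>\<^sup>+a. \<integral>\<^sup>+d. h (a, d) \<partial>kern i j \<partial>\<mu>)"
    unfolding \<open>\<mu> \<Otimes>\<^sub>M kern i j = \<rho>\<close>[symmetric]
    by (subst Kf.nn_integral_fst[symmetric]) (auto simp: \<mu>_def cong: measurable_cong_sets)
  also have "\<dots> = (\<integral>\<^sup>+\<omega>. indicator ?G \<omega> * (\<integral>\<^sup>+d. h (A \<omega>, d) \<partial>kern i j) \<partial>M)"
    unfolding \<mu>_def by (subst nn_integral_distr) (auto simp: nn_integral_density)
  finally show ?thesis .
qed

section \<open>Occupation times and their expectations given the past\<close>

definition occ :: "nat \<Rightarrow> real \<Rightarrow> real \<Rightarrow> 'a \<Rightarrow> ennreal" where
  "occ r s L \<omega> = (\<integral>\<^sup>+t. of_bool (s \<le> t \<and> t < s + L \<and> J t \<omega> = r) \<partial>lborel)"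

text \<open>The cut-off after \<open>N\<close> sojourns allows a recursion over jumps. The deadline
  \<open>B\<close> is a random time so that it can stay fixed while the starting epoch advances in
  the induction.\<close>

definition occN :: "nat \<Rightarrow> nat \<Rightarrow> int \<Rightarrow> ('a \<Rightarrow> real) \<Rightarrow> 'a \<Rightarrow> ennreal" where
  "occN r N n B \<omega> = (\<integral>\<^sup>+t. of_bool (T n \<omega> \<le> t \<and> t < T (n + int N) \<omega> \<and> t < B \<omega> \<and> J t \<omega> = r) \<partial>lborel)"

lemma occ_measurable [measurable (raw)]:
  assumes [measurable]: "f \<in> borel_measurable N" "g \<in> borel_measurable N" "h \<in> measurable N M"
  shows "(\<lambda>x. occ r (f x) (g x) (h x)) \<in> borel_measurable N"
  unfolding occ_def by measurable

lemma occN_measurable [measurable (raw)]: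
  assumes [measurable]: "B \<in> borel_measurable M"
  shows "occN r N n B \<in> borel_measurable M"
  unfolding occN_def by measurable

text \<open>\<open>V r N i a\<close> is the expected time that the process spends in \<open>r\<close> during the next \<open>N\<close> sojourns and the next \<open>a\<close>
  time units, when a sojourn in \<open>i\<close> begins now.\<close>
primrec V :: "nat \<Rightarrow> nat \<Rightarrow> nat \<Rightarrow> real \<Rightarrow> ennreal" where
  "V r 0 i a = 0"
| "V r (Suc N) i a = (\<Sum>j\<in>{1..Ms}. \<integral>\<^sup>+d. (if i = r then ennreal (min d a) else 0) + V r N j (a - d) \<partial>kern i j)"

lemma V_measurable: "i \<in> {1..Ms} \<Longrightarrow> V r N i \<in> borel_measurable borel"
proof (induction N arbitrary: i)
  case (Suc N)
  have "(\<lambda>a. \<integral>\<^sup>+d. (if i = r then ennreal (min d a) else 0) + V r N j (a - d) \<partial>kern i j) \<in> borel_measurable borel"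
    if j: "j \<in> {1..Ms}" for j
  proof -
    interpret Kf: finite_measure "kern i j" by (rule finite_kern[OF Suc.prems])
    note [measurable] = Suc.IH[OF j]
    show ?thesis by measurable
  qed
  then show ?case by (simp add: borel_measurable_sum)
qed (simp add: V.simps(1)[abs_def])

lemma V_mono: "V r N i a \<le> V r (Suc N) i a"
proof (induction N arbitrary: i a)
  case (Suc N)
  show ?case
    unfolding V.simps(2)[of r "Suc N" i a] V.simps(2)[of r N i a]
    by (intro sum_mono nn_integral_mono add_left_mono Suc.IH)
qed simp

lemma path_mono: "AE \<omega> in M. \<forall>m n. m < n \<longrightarrow> T m \<omega> < T n \<omega>"
  using path by eventually_elim (auto simp: strict_mono_def)

lemma path_const: "AE \<omega> in M. \<forall>n t. T n \<omega> \<le> t \<and> t < T (n + 1) \<omega> \<longrightarrow> J t \<omega> = J (T n \<omega>) \<omega>"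
  using path by eventually_elim (elim conjE)

lemma path_cover: "AE \<omega> in M. \<forall>t. \<exists>n. T n \<omega> \<le> t \<and> t < T (n + 1) \<omega>"
  using path by eventually_elim (elim conjE)

lemma occN_Suc:
  "AE \<omega> in M. occN r (Suc N) n B \<omega> = (if X n \<omega> = r then ennreal (min (T (n + 1) \<omega> - T n \<omega>) (B \<omega> - T n \<omega>)) else 0)
      + occN r N (n + 1) B \<omega>"
proof -
  show ?thesis
    using path_const path_mono AE_space
  proof eventually_elim
    case (elim \<omega>)
    have le: "T n \<omega> < T (n + 1) \<omega>" "T (n + 1) \<omega> \<le> T (n + 1 + int N) \<omega>"
      using elim(2)[rule_format, of n "n + 1"] elim(2)[rule_format, of "n + 1" "n + 1 + int N"]
      by (simp, cases "N = 0") auto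
    have J: "J t \<omega> = X n \<omega>" if "T n \<omega> \<le> t" "t < T (n + 1) \<omega>" for t
      unfolding X_def using elim(1)[rule_format, of n t] that by simp
    have [measurable]: "Measurable.pred borel (\<lambda>t. J t \<omega> = r)"
      by (rule J_eq_measurable) (use \<open>\<omega> \<in> space M\<close> in auto)
    have "occN r (Suc N) n B \<omega> = (\<integral>\<^sup>+t. of_bool (X n \<omega> = r) * indicator {T n \<omega>..<min (T (n + 1) \<omega>) (B \<omega>)} t
       + of_bool (T (n + 1) \<omega> \<le> t \<and> t < T (n + 1 + int N) \<omega> \<and> t < B \<omega> \<and> J t \<omega> = r) \<partial>lborel)"
      unfolding occN_def
    proof (rule nn_integral_cong)
      fix t
      have N: "n + int (Suc N) = n + 1 + int N" by simp
      consider "t < T n \<omega>" | "T n \<omega> \<le> t" "t < T (n + 1) \<omega>" | "T (n + 1) \<omega> \<le> t" by linarith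
      then show "of_bool (T n \<omega> \<le> t \<and> t < T (n + int (Suc N)) \<omega> \<and> t < B \<omega> \<and> J t \<omega> = r) =
         of_bool (X n \<omega> = r) * (indicator {T n \<omega>..<min (T (n + 1) \<omega>) (B \<omega>)} t :: ennreal)
          + of_bool (T (n + 1) \<omega> \<le> t \<and> t < T (n + 1 + int N) \<omega> \<and> t < B \<omega> \<and> J t \<omega> = r)"
      proof cases
        case 2
        then show ?thesis unfolding N using J[OF 2] le by (cases "t < B \<omega>") simp_all
      qed (use le in \<open>unfold N, simp_all\<close>)
    qed
    also have "\<dots> = of_bool (X n \<omega> = r) * emeasure lborel {T n \<omega>..<min (T (n + 1) \<omega>) (B \<omega>)} + occN r N (n + 1) B \<omega>"
      unfolding occN_def by (subst nn_integral_add) (auto simp: nn_integral_cmult)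
    \<comment> \<open>For a deadline before \<open>T n\<close> both sides are 0, since
      \<open>ennreal\<close> sends negative numbers to 0. \<open>V\<close> relies on the same
      convention once the time \<open>a\<close> is used up.\<close>
    also have "emeasure lborel {T n \<omega>..<min (T (n + 1) \<omega>) (B \<omega>)} = ennreal (min (T (n + 1) \<omega> - T n \<omega>) (B \<omega> - T n \<omega>))"
    proof (cases "B \<omega> < T n \<omega>")
      case True
      then show ?thesis by (auto simp: ennreal_neg min_def)
    next
      case False
      then show ?thesis using le by (auto simp: min_def)
    qed
    finally show ?case by simp
  qed
qed

text \<open>Induction over the number of sojourns with \<open>n\<close> arbitrary: the deadline
  remains measurable for \<open>F (n + 1)\<close>, and \<open>kernel_integral\<close>, with the
  remaining time \<open>B - T n\<close> as the variable of the past, integrates out one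
  sojourn.\<close>

lemma occN_V:
  assumes "n \<ge> 1" "G \<in> sets (F n)" "B \<in> borel_measurable (F n)"
  shows "(\<integral>\<^sup>+\<omega>. indicator G \<omega> * occN r N n B \<omega> \<partial>M)
    = (\<Sum>i\<in>{1..Ms}. \<integral>\<^sup>+\<omega>. indicator (G \<inter> at_state n i) \<omega> * V r N i (B \<omega> - T n \<omega>) \<partial>M)"
  using assms
proof (induction N arbitrary: n)
  case 0
  have "of_bool (T n \<omega> \<le> t \<and> t < T n \<omega> \<and> t < B \<omega> \<and> J t \<omega> = r) = (0 :: ennreal)" for t \<omega>
    by simp
  then show ?case by (simp only: occN_def V.simps int_ops add_0_right) simp
next
  case (Suc N)
  note n = Suc.prems(1) and G = Suc.prems(2) and B = Suc.prems(3)
  have [measurable]: "G \<in> sets M" "B \<in> borel_measurable M"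
    using G F_in_M measurable_from_subalg[OF subalg_F B] by auto
  have A: "(\<lambda>\<omega>. B \<omega> - T n \<omega>) \<in> borel_measurable (F n)"
    using B T_F[of n n] by measurable
  define h where "h i j = (\<lambda>(a, d). (if i = r then ennreal (min d a) else 0) + V r N j (a - d))" for i j
  have h: "h i j \<in> borel_measurable (borel \<Otimes>\<^sub>M borel)" if "j \<in> {1..Ms}" for i j
  proof -
    note [measurable] = V_measurable[OF that]
    show ?thesis unfolding h_def by measurable
  qed
  let ?D = "\<lambda>\<omega>. T (n + 1) \<omega> - T n \<omega>" and ?A = "\<lambda>\<omega>. B \<omega> - T n \<omega>"
  let ?m = "\<lambda>\<omega>. (if X n \<omega> = r then ennreal (min (?D \<omega>) (?A \<omega>)) else 0)"
  let ?I = "\<lambda>i j \<omega>. indicator (G \<inter> at_state n i \<inter> at_state (n + 1) j) \<omega> :: ennreal"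
  have Vm [measurable]: "(\<lambda>\<omega>. V r N j (B \<omega> - T (n + 1) \<omega>)) \<in> borel_measurable M" if "j \<in> {1..Ms}" for j
    by (rule measurable_compose[OF _ V_measurable[OF that]]) measurable
  have sub: "sets (F n) \<subseteq> sets (F (n + 1))" by (rule F_mono) simp
  have "B \<in> borel_measurable (F (n + 1))"
    using sub B by (auto simp: measurable_def)
  with Suc.IH[of "n + 1"] n G sub
  have IH: "(\<integral>\<^sup>+\<omega>. indicator G \<omega> * occN r N (n + 1) B \<omega> \<partial>M) =
    (\<Sum>j\<in>{1..Ms}. \<integral>\<^sup>+\<omega>. indicator (G \<inter> at_state (n + 1) j) \<omega> * V r N j (B \<omega> - T (n + 1) \<omega>) \<partial>M)"
    by auto
  have "(\<integral>\<^sup>+\<omega>. indicator G \<omega> * occN r (Suc N) n B \<omega> \<partial>M) = (\<integral>\<^sup>+\<omega>. indicator G \<omega> * ?m \<omega> + indicator G \<omega> * occN r N (n + 1) B \<omega> \<partial>M)"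
    using occN_Suc[of r N n B] by (intro nn_integral_cong_AE) (auto elim!: eventually_mono simp: distrib_left)
  also have "\<dots> = (\<integral>\<^sup>+\<omega>. indicator G \<omega> * ?m \<omega> \<partial>M) + (\<integral>\<^sup>+\<omega>. indicator G \<omega> * occN r N (n + 1) B \<omega> \<partial>M)"
    by (rule nn_integral_add) auto
  also have "\<dots> = (\<integral>\<^sup>+\<omega>. indicator G \<omega> * ?m \<omega> \<partial>M) + 
     (\<integral>\<^sup>+\<omega>. (\<Sum>j\<in>{1..Ms}. indicator (G \<inter> at_state (n + 1) j) \<omega> * V r N j (B \<omega> - T (n + 1) \<omega>)) \<partial>M)"
    unfolding IH by (subst nn_integral_sum) auto
  also have "\<dots> = (\<integral>\<^sup>+\<omega>. indicator G \<omega> * ?m \<omega> + (\<Sum>j\<in>{1..Ms}. indicator (G \<inter> at_state (n + 1) j) \<omega> * V r N j (B \<omega> - T (n + 1) \<omega>)) \<partial>M)"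
    by (rule nn_integral_add[symmetric]) auto
  \<comment> \<open>For almost every outcome only the pair \<open>i = X n\<close>,
    \<open>j = X (n + 1)\<close> survives in the double sum, which brings the integrand into the
    form of \<open>kernel_integral\<close>.\<close>
  also have "\<dots> = (\<integral>\<^sup>+\<omega>. (\<Sum>i\<in>{1..Ms}. \<Sum>j\<in>{1..Ms}. ?I i j \<omega> * h i j (?A \<omega>, ?D \<omega>)) \<partial>M)"
  proof (rule nn_integral_cong_AE)
    show "AE \<omega> in M. indicator G \<omega> * ?m \<omega> + (\<Sum>j\<in>{1..Ms}. indicator (G \<inter> at_state (n + 1) j) \<omega> * V r N j (B \<omega> - T (n + 1) \<omega>))
       = (\<Sum>i\<in>{1..Ms}. \<Sum>j\<in>{1..Ms}. ?I i j \<omega> * h i j (?A \<omega>, ?D \<omega>))"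
      using X_range[of n] X_range[of "n + 1"] AE_space
    proof eventually_elim
      case (elim \<omega>)
      have "?I i j \<omega> * h i j (?A \<omega>, ?D \<omega>) = (if j = X (n + 1) \<omega> then (if i = X n \<omega> then indicator G \<omega> * h i j (?A \<omega>, ?D \<omega>) else 0) else 0)" for i j
        using elim by (auto simp: indicator_def)
      then have *: "(\<Sum>j\<in>{1..Ms}. ?I i j \<omega> * h i j (?A \<omega>, ?D \<omega>))
          = (if i = X n \<omega> then indicator G \<omega> * h i (X (n + 1) \<omega>) (?A \<omega>, ?D \<omega>) else 0)" for i
        using elim by (simp add: sum.delta)
      have **: "indicator (G \<inter> at_state (n + 1) j) \<omega> * V r N j (B \<omega> - T (n + 1) \<omega>)
        = (if j = X (n + 1) \<omega> then indicator G \<omega> * V r N j (B \<omega> - T (n + 1) \<omega>) else 0)" for j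
        using elim by (auto simp: indicator_def)
      show ?case
        unfolding * ** using elim by (simp add: sum.delta' sum.delta h_def distrib_left)
    qed
  qed
  also have "\<dots> = (\<Sum>i\<in>{1..Ms}. \<Sum>j\<in>{1..Ms}. \<integral>\<^sup>+\<omega>. ?I i j \<omega> * h i j (?A \<omega>, ?D \<omega>) \<partial>M)"
  proof -
    have [measurable]: "(\<lambda>\<omega>. h i j (?A \<omega>, ?D \<omega>)) \<in> borel_measurable M" if "j \<in> {1..Ms}" for i j
      by (rule measurable_compose[OF _ h[OF that]]) measurable
    show ?thesis by (subst nn_integral_sum, measurable, subst nn_integral_sum) auto
  qed
  also have "\<dots> = (\<Sum>i\<in>{1..Ms}. \<Sum>j\<in>{1..Ms}. \<integral>\<^sup>+\<omega>. indicator (G \<inter> at_state n i) \<omega> * (\<integral>\<^sup>+d. h i j (?A \<omega>, d) \<partial>kern i j) \<partial>M)"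
    by (intro sum.cong refl kernel_integral n G A h)
  also have "\<dots> = (\<Sum>i\<in>{1..Ms}. \<integral>\<^sup>+\<omega>. (\<Sum>j\<in>{1..Ms}. indicator (G \<inter> at_state n i) \<omega> * (\<integral>\<^sup>+d. h i j (?A \<omega>, d) \<partial>kern i j)) \<partial>M)"
  proof (intro sum.cong refl nn_integral_sum[symmetric])
    fix i j assume i: "i \<in> {1..Ms}" and j: "j \<in> {1..Ms}"
    interpret Kf: finite_measure "kern i j" by (rule finite_kern[OF i])
    note [measurable] = h[OF j]
    show "(\<lambda>\<omega>. indicator (G \<inter> at_state n i) \<omega> * (\<integral>\<^sup>+d. h i j (?A \<omega>, d) \<partial>kern i j)) \<in> borel_measurable M"
      by measurable
  qed
  also have "\<dots> = (\<Sum>i\<in>{1..Ms}. \<integral>\<^sup>+\<omega>. indicator (G \<inter> at_state n i) \<omega> * V r (Suc N) i (B \<omega> - T n \<omega>) \<partial>M)"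
    by (simp add: h_def sum_distrib_left)
  finally show ?case .
qed

lemma occ_le: 
  assumes "L \<ge> 0" shows "occ r s L \<omega> \<le> ennreal L"
proof -
  have "occ r s L \<omega> \<le> (\<integral>\<^sup>+t. indicator {s..s + L} t \<partial>lborel)"
    unfolding occ_def by (intro nn_integral_mono) (auto simp: indicator_def)
  then show ?thesis using assms by simp
qed

text \<open>The jump points exhaust the line, so each time lies before \<open>T (n + int N)\<close>
  for large \<open>N\<close>; dominated convergence on the window does the rest.\<close>

lemma occN_tendsto:
  assumes "L \<ge> 0"
  shows "AE \<omega> in M. (\<lambda>N. occN r N n (\<lambda>\<omega>. T n \<omega> + L) \<omega>) \<longlonglongrightarrow> occ r (T n \<omega>) L \<omega>"
  using path_cover path_mono AE_space
proof eventually_elim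
  case (elim \<omega>)
  have [measurable]: "Measurable.pred borel (\<lambda>t. J t \<omega> = r)"
    by (rule J_eq_measurable) (use elim in auto)
  show ?case
    unfolding occN_def occ_def
  proof (rule nn_integral_dominated_convergence[where w = "indicator {T n \<omega>..T n \<omega> + L}"])
    show "AE t in lborel. (\<lambda>N. of_bool (T n \<omega> \<le> t \<and> t < T (n + int N) \<omega> \<and> t < T n \<omega> + L \<and> J t \<omega> = r) :: ennreal)
        \<longlonglongrightarrow> of_bool (T n \<omega> \<le> t \<and> t < T n \<omega> + L \<and> J t \<omega> = r)"
    proof (rule AE_I2, rule tendsto_eventually)
      fix t
      obtain m where m: "t < T (m + 1) \<omega>" using elim(1) by blast
      have "t < T (n + int N) \<omega>" if "N \<ge> nat (m + 1 - n)" for N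
      proof -
        have "m + 1 \<le> n + int N" using that by linarith
        then have "T (m + 1) \<omega> \<le> T (n + int N) \<omega>" 
          using elim(2)[rule_format, of "m + 1" "n + int N"] by (cases "m + 1 = n + int N") auto
        with m show ?thesis by simp
      qed
      then show "\<forall>\<^sub>F N in sequentially. (of_bool (T n \<omega> \<le> t \<and> t < T (n + int N) \<omega> \<and> t < T n \<omega> + L \<and> J t \<omega> = r) :: ennreal)
        = of_bool (T n \<omega> \<le> t \<and> t < T n \<omega> + L \<and> J t \<omega> = r)"
        unfolding eventually_sequentially by (intro exI[of _ "nat (m + 1 - n)"]) auto
    qed
    show "(\<integral>\<^sup>+t. indicator {T n \<omega>..T n \<omega> + L} t \<partial>lborel) < \<infinity>" using assms by simp
  qed (auto simp: indicator_def)
qed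

definition Vl :: "nat \<Rightarrow> nat \<Rightarrow> real \<Rightarrow> ennreal" where "Vl r i a = (SUP N. V r N i a)"

lemma V_tendsto: "(\<lambda>N. V r N i a) \<longlonglongrightarrow> Vl r i a"
  unfolding Vl_def by (rule LIMSEQ_SUP) (auto simp: incseq_Suc_iff V_mono simp del: V.simps)

text \<open>The Markov property for occupation times: the past enters only through
  \<open>X n\<close>. This is \<open>occN_V\<close> with the deadline \<open>T n + a\<close>, for
  which the remaining time is the constant \<open>a\<close>, followed by the limit in
  \<open>N\<close>.\<close>

lemma occ_V:
  assumes n: "n \<ge> 1" and G: "G \<in> sets (F n)" and a: "a \<ge> 0"
  shows "(\<integral>\<^sup>+\<omega>. indicator G \<omega> * occ r (T n \<omega>) a \<omega> \<partial>M) = (\<Sum>i\<in>{1..Ms}. Vl r i a * emeasure M (G \<inter> at_state n i))"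
proof (rule LIMSEQ_unique)
  have [measurable]: "G \<in> sets M" using G F_in_M by auto
  let ?f = "\<lambda>N. \<integral>\<^sup>+\<omega>. indicator G \<omega> * occN r N n (\<lambda>\<omega>. T n \<omega> + a) \<omega> \<partial>M"
  show "?f \<longlonglongrightarrow> (\<integral>\<^sup>+\<omega>. indicator G \<omega> * occ r (T n \<omega>) a \<omega> \<partial>M)"
  proof (rule nn_integral_dominated_convergence[where w = "\<lambda>_. ennreal a"])
    fix N
    show "AE \<omega> in M. indicator G \<omega> * occN r N n (\<lambda>\<omega>. T n \<omega> + a) \<omega> \<le> ennreal a"
    proof (rule AE_I2)
      fix \<omega>
      have "occN r N n (\<lambda>\<omega>. T n \<omega> + a) \<omega> \<le> occ r (T n \<omega>) a \<omega>"
        unfolding occN_def occ_def by (intro nn_integral_mono) auto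
      also have "\<dots> \<le> ennreal a" by (rule occ_le[OF a])
      finally show "indicator G \<omega> * occN r N n (\<lambda>\<omega>. T n \<omega> + a) \<omega> \<le> ennreal a"
        by (cases "\<omega> \<in> G") simp_all
    qed
    show "(\<integral>\<^sup>+\<omega>. ennreal a \<partial>M) < \<infinity>" by (simp add: emeasure_space_1)
    show "AE \<omega> in M. (\<lambda>N. indicator G \<omega> * occN r N n (\<lambda>\<omega>. T n \<omega> + a) \<omega>) \<longlonglongrightarrow> indicator G \<omega> * occ r (T n \<omega>) a \<omega>"
      using occN_tendsto[OF a, of r n]
      by eventually_elim (auto simp: indicator_def)
  qed measurable
  have "?f = (\<lambda>N. \<Sum>i\<in>{1..Ms}. V r N i a * emeasure M (G \<inter> at_state n i))"
  proof
    fix N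
    have "(\<lambda>\<omega>. T n \<omega> + a) \<in> borel_measurable (F n)" using T_F[of n n] by measurable
    from occN_V[OF n G this, of r N] show "?f N = (\<Sum>i\<in>{1..Ms}. V r N i a * emeasure M (G \<inter> at_state n i))"
      by (simp add: mult.commute[of "indicator _ _"] nn_integral_cmult)
  qed
  then show "?f \<longlonglongrightarrow> (\<Sum>i\<in>{1..Ms}. Vl r i a * emeasure M (G \<inter> at_state n i))"
    unfolding mult.commute[of _ "emeasure M _"]
    by (simp only:) (intro tendsto_sum ennreal_tendsto_cmult V_tendsto, simp add: emeasure_eq_measure)
qed

lemma X_eq_F: "at_state n i \<in> sets (F n)"
  using measurable_sets[OF X_F[of n n], of "{i}"] by (simp add: vimage_def Int_def conj_commute)

text \<open>The bound is not visible from the recursion. It follows by reading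
  \<open>Vl r i a\<close>, at a charged epoch, as the mean occupation time of a window of length
  \<open>a\<close>.\<close>

lemma Vl_le:
  assumes i: "i \<in> {1..Ms}" and a: "a \<ge> 0"
  shows "Vl r i a \<le> ennreal a"
proof -
  define n where "n = nvis i"
  let ?G = "at_state n i"
  have n: "n \<ge> 1" and p: "measure M ?G > 0" using nvis[OF i] by (auto simp: n_def)
  have "Vl r i a * emeasure M ?G = Vl r i a * emeasure M (?G \<inter> at_state n i)" by simp
  also have "\<dots> \<le> (\<Sum>j\<in>{1..Ms}. Vl r j a * emeasure M (?G \<inter> at_state n j))"
    using i by (intro member_le_sum[of i "{1..Ms}" "\<lambda>j. Vl r j a * emeasure M (?G \<inter> at_state n j)"]) auto
  also have "\<dots> = (\<integral>\<^sup>+\<omega>. indicator ?G \<omega> * occ r (T n \<omega>) a \<omega> \<partial>M)"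
    by (rule occ_V[OF n X_eq_F a, symmetric])
  also have "\<dots> \<le> (\<integral>\<^sup>+\<omega>. ennreal a * indicator ?G \<omega> \<partial>M)"
    by (intro nn_integral_mono) (auto simp: indicator_def occ_le[OF a])
  also have "\<dots> = ennreal a * emeasure M ?G" by (simp add: nn_integral_cmult)
  finally show ?thesis
    using p by (subst (asm) (1 2) mult.commute) (simp add: ennreal_mult_le_mult_iff emeasure_eq_measure)
qed

definition u :: "nat \<Rightarrow> nat \<Rightarrow> real \<Rightarrow> real" where "u r i a = enn2real (Vl r i a)"
definition W :: "nat \<Rightarrow> real \<Rightarrow> real \<Rightarrow> 'a \<Rightarrow> real" where "W r s L \<omega> = enn2real (occ r s L \<omega>)"

lemma u_Vl: "i \<in> {1..Ms} \<Longrightarrow> a \<ge> 0 \<Longrightarrow> Vl r i a = ennreal (u r i a)"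
  unfolding u_def using Vl_le[of i a r] by (intro ennreal_enn2real[symmetric]) (auto intro: le_less_trans)

lemma u_nonneg: "0 \<le> u r i a" by (simp add: u_def)

lemma W_occ: "L \<ge> 0 \<Longrightarrow> occ r s L \<omega> = ennreal (W r s L \<omega>)"
  unfolding W_def using occ_le[of L r s \<omega>] by (intro ennreal_enn2real[symmetric]) (auto intro: le_less_trans)

lemma W_bounds: "L \<ge> 0 \<Longrightarrow> 0 \<le> W r s L \<omega>" "L \<ge> 0 \<Longrightarrow> W r s L \<omega> \<le> L"
  using occ_le[of L r s \<omega>] by (auto simp: W_occ) (simp add: W_def)

lemma W_measurable [measurable (raw)]:
  assumes [measurable]: "f \<in> borel_measurable N" "g \<in> borel_measurable N" "h \<in> measurable N M"
  shows "(\<lambda>x. W r (f x) (g x) (h x)) \<in> borel_measurable N"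
  unfolding W_def by measurable

text \<open>Each window exceeds the other by an interval of length at most
  \<open>\<bar>s - s'\<bar>\<close>, and both values lie between 0 and \<open>L\<close>. The minimum
  keeps the bound integrable when the shift is a random time without moments.\<close>

lemma W_shift:
  assumes \<omega>: "\<omega> \<in> space M" and L: "L \<ge> 0"
  shows "\<bar>W r s L \<omega> - W r s' L \<omega>\<bar> \<le> min \<bar>s - s'\<bar> L"
proof -
  have [measurable]: "Measurable.pred borel (\<lambda>t. J t \<omega> = r)"
    by (rule J_eq_measurable) (use \<omega> in auto)
  have 1: "W r s L \<omega> \<le> W r s' L \<omega> + \<bar>s - s'\<bar>" for s s'
  proof -
    have "ennreal (W r s L \<omega>) = occ r s L \<omega>" using L by (simp add: W_occ)
    also have "\<dots> \<le> (\<integral>\<^sup>+t. of_bool (s' \<le> t \<and> t < s' + L \<and> J t \<omega> = r) + 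
        indicator (if s \<le> s' then {s..s'} else {s' + L..s + L}) t \<partial>lborel)"
      unfolding occ_def by (intro nn_integral_mono) (auto simp: indicator_def)
    also have "\<dots> = occ r s' L \<omega> + (\<integral>\<^sup>+t. indicator (if s \<le> s' then {s..s'} else {s' + L..s + L}) t \<partial>lborel)"
      unfolding occ_def by (rule nn_integral_add) auto
    also have "\<dots> = occ r s' L \<omega> + ennreal \<bar>s - s'\<bar>" by auto
    also have "\<dots> = ennreal (W r s' L \<omega> + \<bar>s - s'\<bar>)" using L W_bounds[OF L] by (simp add: W_occ)
    finally show ?thesis using W_bounds[OF L] by (subst (asm) ennreal_le_iff) auto
  qed
  show ?thesis using 1[of s s'] 1[of s' s] W_bounds[OF L, of r s \<omega>] W_bounds[OF L, of r s' \<omega>] by (auto simp: abs_minus_commute)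
qed

lemma W_integrable: "L \<ge> 0 \<Longrightarrow> f \<in> borel_measurable M \<Longrightarrow> integrable M (\<lambda>\<omega>. W r (f \<omega>) L \<omega>)"
  by (rule integrable_const_bound[of _ L]) (auto simp: W_bounds)

lemma W_G_integrable: "L \<ge> 0 \<Longrightarrow> f \<in> borel_measurable M \<Longrightarrow> G \<in> sets M \<Longrightarrow> integrable M (\<lambda>\<omega>. indicator G \<omega> * W r (f \<omega>) L \<omega>)"
  by (rule integrable_const_bound[of _ L]) (auto simp: W_bounds indicator_def)

lemma expectation_W:
  assumes n: "n \<ge> 1" and G: "G \<in> sets (F n)" and a: "a \<ge> 0"
  shows "(\<integral>\<omega>. indicator G \<omega> * W r (T n \<omega>) a \<omega> \<partial>M) = (\<Sum>i\<in>{1..Ms}. u r i a * measure M (G \<inter> at_state n i))"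
proof -
  have [measurable]: "G \<in> sets M" using G F_in_M by auto
  have "ennreal (\<integral>\<omega>. indicator G \<omega> * W r (T n \<omega>) a \<omega> \<partial>M) = (\<integral>\<^sup>+\<omega>. ennreal (indicator G \<omega> * W r (T n \<omega>) a \<omega>) \<partial>M)"
    by (rule nn_integral_eq_integral[symmetric]) (auto intro!: W_G_integrable a simp: W_bounds a)
  also have "\<dots> = (\<integral>\<^sup>+\<omega>. indicator G \<omega> * occ r (T n \<omega>) a \<omega> \<partial>M)"
    by (intro nn_integral_cong) (simp add: W_occ[OF a] indicator_def)
  also have "\<dots> = (\<Sum>i\<in>{1..Ms}. ennreal (u r i a * measure M (G \<inter> at_state n i)))"
    unfolding occ_V[OF n G a] by (intro sum.cong refl) (simp add: u_Vl[OF _ a] emeasure_eq_measure ennreal_mult u_nonneg)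
  also have "\<dots> = ennreal (\<Sum>i\<in>{1..Ms}. u r i a * measure M (G \<inter> at_state n i))"
    by (rule sum_ennreal) (simp add: u_nonneg)
  finally show ?thesis
    by (subst (asm) ennreal_inj) (auto intro!: sum_nonneg integral_nonneg_AE AE_I2 simp: u_nonneg W_bounds a)
qed

section \<open>Nearly harmonic functions on the state space\<close>

text \<open>The relation in the irreducibility hypothesis lives on all of \<open>nat\<close>; this
  keeps its paths inside \<open>{1..Ms}\<close>.\<close>

lemma P_support: 
  assumes i: "i \<in> {1..Ms}" and "P i j > 0"
  shows "j \<in> {1..Ms}"
proof (rule ccontr)
  assume j: "j \<notin> {1..Ms}"
  define n where "n = nvis i"
  have n: "n \<ge> 1" and p: "measure M (at_state n i) > 0" using nvis[OF i] by (auto simp: n_def)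
  have eq: "space M \<inter> at_state n i = at_state n i" by auto
  have "P i j * measure M (at_state n i) = measure M ((at_state n i) \<inter> at_state (n + 1) j)"
    using chain_step[OF n space_in_F, of i j] unfolding eq by simp
  also have "\<dots> = measure M {}"
  proof (rule finite_measure_eq_AE)
    show "AE \<omega> in M. (\<omega> \<in> (at_state n i) \<inter> at_state (n + 1) j) = (\<omega> \<in> {})"
      using X_range[of "n + 1"] by eventually_elim (use j in auto)
  qed auto
  finally show False using p assms by simp
qed

text \<open>A maximum principle for functions \<open>v \<le> m\<close> on the states that are harmonic up to an error \<open>e\<close>.\<close>
lemma harmonic_step_bound:
  assumes "(i, k) \<in> {(a, b). P a b > 0}\<^sup>*" "i \<in> {1..Ms}"
  shows "k \<in> {1..Ms} \<and> (\<exists>C\<ge>0. \<forall>v m e. 0 \<le> e \<longrightarrow> (\<forall>j\<in>{1..Ms}. v j \<le> m) \<longrightarrow> 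
      (\<forall>j\<in>{1..Ms}. \<bar>v j - (\<Sum>l\<in>{1..Ms}. P j l * v l)\<bar> \<le> e) \<longrightarrow> m - v k \<le> C * (m - v i + (e::real)))"
  using assms(1)
proof (induction rule: rtrancl_induct)
  case base
  show ?case using assms(2) by (intro conjI exI[of _ 1]) auto
next
  case (step y z)
  then obtain C where y: "y \<in> {1..Ms}" and C: "C \<ge> 0" and
    H: "\<And>v m e. 0 \<le> e \<Longrightarrow> (\<forall>j\<in>{1..Ms}. v j \<le> m) \<Longrightarrow>
      (\<forall>j\<in>{1..Ms}. \<bar>v j - (\<Sum>l\<in>{1..Ms}. P j l * v l)\<bar> \<le> e) \<Longrightarrow> m - v y \<le> C * (m - v i + (e::real))" by blast
  have Pyz: "P y z > 0" using step(2) by simp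
  have z: "z \<in> {1..Ms}" using P_support[OF y Pyz] .
  show ?case
  proof (intro conjI exI[of _ "(C + 1) / P y z"] allI impI z)
    show "0 \<le> (C + 1) / P y z" using C Pyz by simp
    fix v m and e :: real
    assume e: "0 \<le> e" and m: "\<forall>j\<in>{1..Ms}. v j \<le> m" and har: "\<forall>j\<in>{1..Ms}. \<bar>v j - (\<Sum>l\<in>{1..Ms}. P j l * v l)\<bar> \<le> e"
    \<comment> \<open>All gaps \<open>m - v l\<close> are nonnegative, so one weighted gap is at
      most their \<open>P\<close>-average, which near-harmonicity bounds by
      \<open>m - v y + e\<close>. The extra \<open>e\<close> is at most \<open>m - v i + e\<close>
      and accounts for the 1 in \<open>C + 1\<close>.\<close>
    have "P y z * (m - v z) \<le> (\<Sum>l\<in>{1..Ms}. P y l * (m - v l))"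
      using m y z by (intro member_le_sum[of z _ "\<lambda>l. P y l * (m - v l)"]) (auto intro!: mult_nonneg_nonneg P_nonneg)
    also have "\<dots> = m * (\<Sum>l\<in>{1..Ms}. P y l) - (\<Sum>l\<in>{1..Ms}. P y l * v l)"
      by (simp add: algebra_simps sum_subtractf sum_distrib_left)
    also have "\<dots> = m - (\<Sum>l\<in>{1..Ms}. P y l * v l)" unfolding P_sum[OF y] by simp
    also have "\<dots> \<le> m - v y + e" using har y by (auto dest!: bspec[of _ _ y])
    also have "\<dots> \<le> C * (m - v i + e) + (m - v i + e)"
      using H[OF e m har] m assms(2) by (auto dest!: bspec[of _ _ i])
    finally show "m - v z \<le> (C + 1) / P y z * (m - v i + e)"
      using Pyz by (simp add: field_simps)
  qed
qed

text \<open>Started from a maximiser \<open>l\<close> with \<open>m = v l\<close>, the step bound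
  has initial gap 0, so only a multiple of \<open>e\<close> remains. Summing the constants over all
  pairs of states gives a single \<open>C\<close> for all functions.\<close>

lemma harmonic_oscillation:
  obtains C where "C \<ge> 0" "\<And>v e i k. 0 \<le> e \<Longrightarrow> (\<forall>j\<in>{1..Ms}. \<bar>v j - (\<Sum>l\<in>{1..Ms}. P j l * v l)\<bar> \<le> e) \<Longrightarrow>
      i \<in> {1..Ms} \<Longrightarrow> k \<in> {1..Ms} \<Longrightarrow> v i - v k \<le> C * (e::real)"
proof -
  define good where "good i k C \<longleftrightarrow> (\<forall>v m e. 0 \<le> e \<longrightarrow> (\<forall>j\<in>{1..Ms}. v j \<le> m) \<longrightarrow> 
      (\<forall>j\<in>{1..Ms}. \<bar>v j - (\<Sum>l\<in>{1..Ms}. P j l * v l)\<bar> \<le> e) \<longrightarrow> m - v k \<le> C * (m - v i + (e::real)))" for i k C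
  define C where "C i k = (SOME C. C \<ge> 0 \<and> good i k C)" for i k
  have C': "C i k \<ge> 0 \<and> good i k (C i k)" if "i \<in> {1..Ms}" "k \<in> {1..Ms}" for i k
    unfolding C_def
    by (rule someI_ex) (use harmonic_step_bound[OF irred[OF that] that(1)] in \<open>unfold good_def, elim conjE\<close>)
  then have C1: "\<And>i k. i \<in> {1..Ms} \<Longrightarrow> k \<in> {1..Ms} \<Longrightarrow> C i k \<ge> 0" by blast
  have C2: "m - v k \<le> C i k * (m - v i + e)" if "i \<in> {1..Ms}" "k \<in> {1..Ms}" "0 \<le> e" "\<forall>j\<in>{1..Ms}. v j \<le> m"
      "\<forall>j\<in>{1..Ms}. \<bar>v j - (\<Sum>l\<in>{1..Ms}. P j l * v l)\<bar> \<le> e" for i k v m and e :: real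
    using C'[OF that(1,2), THEN conjunct2, unfolded good_def, rule_format, of e v m] that by blast
  let ?C = "\<Sum>(i, k)\<in>{1..Ms}\<times>{1..Ms}. C i k"
  show ?thesis
  proof (rule that[of ?C])
    show "?C \<ge> 0" using C1 by (intro sum_nonneg) auto
    fix v and e :: real and i k
    assume e: "0 \<le> e" and har: "\<forall>j\<in>{1..Ms}. \<bar>v j - (\<Sum>l\<in>{1..Ms}. P j l * v l)\<bar> \<le> e" and i: "i \<in> {1..Ms}" and k: "k \<in> {1..Ms}"
    have "Max (v ` {1..Ms}) \<in> v ` {1..Ms}" using i by (intro Max_in) auto
    then obtain l where l: "l \<in> {1..Ms}" "Max (v ` {1..Ms}) = v l" by auto
    have le: "\<forall>j\<in>{1..Ms}. v j \<le> v l" using l(2) Max_ge[of "v ` {1..Ms}"] by auto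
    have "v i - v k \<le> v l - v k" using le i by auto
    also have "\<dots> \<le> C l k * (v l - v l + e)" by (rule C2[OF l(1) k e le har])
    also have "\<dots> \<le> ?C * e"
      using member_le_sum[of "(l, k)" "{1..Ms}\<times>{1..Ms}" "\<lambda>(i, k). C i k"] l k C1 e
      by (auto intro!: mult_right_mono)
    finally show "v i - v k \<le> ?C * e" .
  qed
qed

text \<open>Bounds, for all states at once, the mean change of an occupation time when its window of
  length \<open>a\<close> is moved by one sojourn. The truncation at \<open>a\<close> stands in for
  integrability of the sojourns.\<close>

definition harmonic_defect :: "real \<Rightarrow> real" where
  "harmonic_defect a = (\<Sum>i\<in>{1..Ms}. (\<integral>\<omega>. min \<bar>T (nvis i) \<omega> - T (nvis i + 1) \<omega>\<bar> a \<partial>M) / measure M (at_state (nvis i) i))"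

lemma min_integrable:
  fixes f :: "'a \<Rightarrow> real" and a :: real
  assumes [measurable]: "f \<in> borel_measurable M" and "a \<ge> 0"
  shows "integrable M (\<lambda>\<omega>. min \<bar>f \<omega>\<bar> a)"
  by (rule integrable_const_bound[of _ a]) (use assms in auto)

text \<open>Dominated convergence with bound 1: the truncated mean of any real random variable,
  integrable or not, is \<open>o(a)\<close>.\<close>

lemma min_tendsto:
  fixes f :: "'a \<Rightarrow> real"
  assumes [measurable]: "f \<in> borel_measurable M"
  shows "((\<lambda>a. (\<integral>\<omega>. min \<bar>f \<omega>\<bar> a \<partial>M) / a) \<longlongrightarrow> 0) at_top"
proof -
  have "((\<lambda>a. \<integral>\<omega>. min \<bar>f \<omega>\<bar> a / a \<partial>M) \<longlongrightarrow> (\<integral>\<omega>. 0 \<partial>M)) at_top"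
  proof (rule integral_dominated_convergence_at_top[where w = "\<lambda>_. 1"])
    show "\<forall>\<^sub>F a in at_top. AE \<omega> in M. norm (min \<bar>f \<omega>\<bar> a / a) \<le> 1"
      using eventually_gt_at_top[of 0] by eventually_elim (auto simp: field_simps)
    show "AE \<omega> in M. ((\<lambda>a. min \<bar>f \<omega>\<bar> a / a) \<longlongrightarrow> 0) at_top"
    proof (rule AE_I2)
      fix \<omega>
      have "((\<lambda>a. \<bar>f \<omega>\<bar> / a) \<longlongrightarrow> 0) at_top"
        by (intro tendsto_divide_0[OF tendsto_const] filterlim_at_top_imp_at_infinity filterlim_ident)
      moreover have "\<forall>\<^sub>F a in at_top. \<bar>f \<omega>\<bar> / a = min \<bar>f \<omega>\<bar> a / a"
        using eventually_ge_at_top[of "\<bar>f \<omega>\<bar>"] by eventually_elim (simp add: min_def)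
      ultimately show "((\<lambda>a. min \<bar>f \<omega>\<bar> a / a) \<longlongrightarrow> 0) at_top" by (rule Lim_transform_eventually)
    qed
  qed auto
  then show ?thesis by simp
qed

lemma harmonic_defect_tendsto: "((\<lambda>a. harmonic_defect a / a) \<longlongrightarrow> 0) at_top"
proof -
  have "((\<lambda>a. \<Sum>i\<in>{1..Ms}. (\<integral>\<omega>. min \<bar>T (nvis i) \<omega> - T (nvis i + 1) \<omega>\<bar> a \<partial>M) / a / measure M (at_state (nvis i) i))
     \<longlongrightarrow> (\<Sum>i\<in>{1..Ms}. 0 / measure M (at_state (nvis i) i))) at_top"
    by (intro tendsto_sum tendsto_divide min_tendsto tendsto_const) (use nvis(2) in \<open>auto simp: less_imp_neq[symmetric]\<close>)
  then show ?thesis by (simp add: harmonic_defect_def sum_divide_distrib field_simps)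
qed

text \<open>At a charged epoch \<open>n\<close> of state \<open>i\<close>, compare the windows that
  start at \<open>T n\<close> and at \<open>T (n + 1)\<close>. On \<open>X n = i\<close> their means
  are proportional to \<open>u r i a\<close> and to the \<open>P\<close>-average of
  \<open>u\<close>, and \<open>W_shift\<close> bounds the difference.\<close>

lemma u_harmonic:
  assumes i: "i \<in> {1..Ms}" and a: "a \<ge> 0"
  shows "\<bar>u r i a - (\<Sum>l\<in>{1..Ms}. P i l * u r l a)\<bar> \<le> harmonic_defect a"
proof -
  define n where "n = nvis i"
  let ?G = "at_state n i"
  define p where "p = measure M ?G"
  have n: "n \<ge> 1" and p: "p > 0" using nvis[OF i] by (auto simp: n_def p_def)
  have G: "?G \<in> sets (F n)" "?G \<in> sets (F (n + 1))" using X_eq_F F_mono[of n "n + 1"] by auto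
  have "(\<integral>\<omega>. indicator ?G \<omega> * W r (T n \<omega>) a \<omega> \<partial>M) = (\<Sum>j\<in>{1..Ms}. u r j a * measure M (?G \<inter> at_state n j))"
    by (rule expectation_W[OF n G(1) a])
  also have "\<dots> = (\<Sum>j\<in>{1..Ms}. if j = i then u r i a * p else 0)"
  proof (intro sum.cong refl)
    fix j
    have "?G \<inter> at_state n j = (if j = i then ?G else {})" by auto
    then show "u r j a * measure M (?G \<inter> at_state n j) = (if j = i then u r i a * p else 0)"
      by (simp add: p_def)
  qed
  also have "\<dots> = u r i a * p" using i by simp
  finally have 1: "(\<integral>\<omega>. indicator ?G \<omega> * W r (T n \<omega>) a \<omega> \<partial>M) = u r i a * p" .
  have "(\<integral>\<omega>. indicator ?G \<omega> * W r (T (n + 1) \<omega>) a \<omega> \<partial>M) = (\<Sum>j\<in>{1..Ms}. u r j a * measure M (?G \<inter> at_state (n + 1) j))"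
    using n by (intro expectation_W G a) auto
  also have "\<dots> = (\<Sum>j\<in>{1..Ms}. P i j * u r j a) * p"
  proof -
    have eq: "space M \<inter> ?G = ?G" by auto
    show ?thesis using chain_step[OF n space_in_F, of i] unfolding eq
      by (simp add: sum_distrib_right sum_distrib_left p_def mult_ac)
  qed
  finally have 2: "(\<integral>\<omega>. indicator ?G \<omega> * W r (T (n + 1) \<omega>) a \<omega> \<partial>M) = (\<Sum>j\<in>{1..Ms}. P i j * u r j a) * p" .
  have "\<bar>u r i a - (\<Sum>j\<in>{1..Ms}. P i j * u r j a)\<bar> * p = \<bar>u r i a * p - (\<Sum>j\<in>{1..Ms}. P i j * u r j a) * p\<bar>"
    using p by (simp add: abs_mult flip: left_diff_distrib)
  also have "\<dots> = \<bar>\<integral>\<omega>. indicator ?G \<omega> * W r (T n \<omega>) a \<omega> - indicator ?G \<omega> * W r (T (n + 1) \<omega>) a \<omega> \<partial>M\<bar>"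
    unfolding 1[symmetric] 2[symmetric] by (subst Bochner_Integration.integral_diff) (auto intro!: W_G_integrable a)
  also have "\<dots> \<le> (\<integral>\<omega>. \<bar>indicator ?G \<omega> * W r (T n \<omega>) a \<omega> - indicator ?G \<omega> * W r (T (n + 1) \<omega>) a \<omega>\<bar> \<partial>M)"
    by (rule integral_abs_bound)
  also have "\<dots> \<le> (\<integral>\<omega>. min \<bar>T n \<omega> - T (n + 1) \<omega>\<bar> a \<partial>M)"
  proof (rule integral_mono)
    fix \<omega> assume "\<omega> \<in> space M"
    from W_shift[OF this a, of r "T n \<omega>" "T (n + 1) \<omega>"] a
    show "\<bar>indicator ?G \<omega> * W r (T n \<omega>) a \<omega> - indicator ?G \<omega> * W r (T (n + 1) \<omega>) a \<omega>\<bar> \<le> min \<bar>T n \<omega> - T (n + 1) \<omega>\<bar> a"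
      by (auto simp: indicator_def)
  qed (auto intro!: integrable_abs Bochner_Integration.integrable_diff W_G_integrable a min_integrable)
  finally have "\<bar>u r i a - (\<Sum>j\<in>{1..Ms}. P i j * u r j a)\<bar> \<le> (\<integral>\<omega>. min \<bar>T n \<omega> - T (n + 1) \<omega>\<bar> a \<partial>M) / p"
    using p by (simp add: field_simps)
  also have "\<dots> \<le> harmonic_defect a"
    unfolding harmonic_defect_def n_def p_def using i a
    by (intro member_le_sum[of i "{1..Ms}" "\<lambda>i. (\<integral>\<omega>. min \<bar>T (nvis i) \<omega> - T (nvis i + 1) \<omega>\<bar> a \<partial>M) / measure M (at_state (nvis i) i)"])
       (auto intro!: divide_nonneg_nonneg integral_nonneg_AE AE_I2)
  finally show ?thesis .
qed

lemma Ms_pos: "1 \<in> {1..Ms}"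
proof -
  have "\<exists>\<omega>. X 0 \<omega> \<in> {1..Ms}"
    using X_range[of 0] by (metis (mono_tags, lifting) AE_False eventually_mono)
  then show ?thesis by auto
qed

text \<open>An event of \<open>F 1\<close> is tested against the window after \<open>T 1\<close>,
  whose mean given the past is \<open>u r (X 1) a\<close>; by the oscillation bound this is nearly
  the constant \<open>u r 1 a\<close>. Moving the window from 0 to \<open>T 1\<close> costs the
  truncated mean of \<open>T 1\<close>. The rate does not depend on \<open>G\<close>.\<close>

lemma decorrelation:
  obtains \<epsilon> where "(\<epsilon> \<longlongrightarrow> 0) at_top"
    "\<And>G a. G \<in> sets (F 1) \<Longrightarrow> a > 0 \<Longrightarrow>
      \<bar>(\<integral>\<omega>. indicator G \<omega> * W r 0 a \<omega> \<partial>M) - measure M G * (\<integral>\<omega>. W r 0 a \<omega> \<partial>M)\<bar> \<le> \<epsilon> a * a"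
proof -
  obtain C where C: "C \<ge> 0" "\<And>v e i k. 0 \<le> e \<Longrightarrow> (\<forall>j\<in>{1..Ms}. \<bar>v j - (\<Sum>l\<in>{1..Ms}. P j l * v l)\<bar> \<le> e) \<Longrightarrow>
      i \<in> {1..Ms} \<Longrightarrow> k \<in> {1..Ms} \<Longrightarrow> v i - v k \<le> C * (e::real)"
    by (rule harmonic_oscillation) blast
  define \<delta> where "\<delta> a = C * harmonic_defect a + (\<integral>\<omega>. min \<bar>T 1 \<omega>\<bar> a \<partial>M)" for a
  have h0: "0 \<le> harmonic_defect a" if "a \<ge> 0" for a using u_harmonic[OF Ms_pos that, of 0] by linarith
  have osc: "\<bar>u r i a - u r 1 a\<bar> \<le> C * harmonic_defect a" if "i \<in> {1..Ms}" "a \<ge> 0" for i a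
    using C(2)[OF h0, of a "\<lambda>i. u r i a" i 1] C(2)[OF h0, of a "\<lambda>i. u r i a" 1 i] u_harmonic[OF _ that(2)] that Ms_pos by auto
  have main: "\<bar>(\<integral>\<omega>. indicator G \<omega> * W r 0 a \<omega> \<partial>M) - measure M G * u r 1 a\<bar> \<le> \<delta> a" if G: "G \<in> sets (F 1)" and a: "a > 0" for G a
  proof -
    have [measurable]: "G \<in> sets M" using G F_in_M by auto
    have "\<bar>(\<integral>\<omega>. indicator G \<omega> * W r 0 a \<omega> \<partial>M) - (\<integral>\<omega>. indicator G \<omega> * W r (T 1 \<omega>) a \<omega> \<partial>M)\<bar>
      = \<bar>\<integral>\<omega>. indicator G \<omega> * W r 0 a \<omega> - indicator G \<omega> * W r (T 1 \<omega>) a \<omega> \<partial>M\<bar>"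
      using a by (subst Bochner_Integration.integral_diff) (auto intro!: W_G_integrable)
    also have "\<dots> \<le> (\<integral>\<omega>. \<bar>indicator G \<omega> * W r 0 a \<omega> - indicator G \<omega> * W r (T 1 \<omega>) a \<omega>\<bar> \<partial>M)"
      by (rule integral_abs_bound)
    also have "\<dots> \<le> (\<integral>\<omega>. min \<bar>T 1 \<omega>\<bar> a \<partial>M)"
    proof (rule integral_mono)
      fix \<omega> assume "\<omega> \<in> space M"
      from W_shift[OF this, of a r 0 "T 1 \<omega>"] a
      show "\<bar>indicator G \<omega> * W r 0 a \<omega> - indicator G \<omega> * W r (T 1 \<omega>) a \<omega>\<bar> \<le> min \<bar>T 1 \<omega>\<bar> a"
        by (auto simp: indicator_def)
    qed (use a in \<open>auto intro!: integrable_abs Bochner_Integration.integrable_diff W_G_integrable min_integrable\<close>)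
    finally have 1: "\<bar>(\<integral>\<omega>. indicator G \<omega> * W r 0 a \<omega> \<partial>M) - (\<integral>\<omega>. indicator G \<omega> * W r (T 1 \<omega>) a \<omega> \<partial>M)\<bar> \<le> (\<integral>\<omega>. min \<bar>T 1 \<omega>\<bar> a \<partial>M)" .
    let ?p = "\<lambda>i. measure M (G \<inter> at_state 1 i)"
    have "(\<integral>\<omega>. indicator G \<omega> * W r (T 1 \<omega>) a \<omega> \<partial>M) - measure M G * u r 1 a = (\<Sum>i\<in>{1..Ms}. (u r i a - u r 1 a) * ?p i)"
      using a by (subst expectation_W[OF _ G], simp, simp, subst sum_X[of G 1])
         (auto simp: left_diff_distrib sum_subtractf sum_distrib_right sum_distrib_left mult_ac)
    also have "\<bar>\<dots>\<bar> \<le> (\<Sum>i\<in>{1..Ms}. C * harmonic_defect a * ?p i)"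
      using osc a by (intro order_trans[OF sum_abs] sum_mono) (auto simp: abs_mult intro!: mult_right_mono)
    also have "\<dots> = C * harmonic_defect a * measure M G" by (subst sum_X[of G 1]) (auto simp: sum_distrib_left)
    also have "\<dots> \<le> C * harmonic_defect a" using C(1) h0[of a] a by (simp add: mult_left_le)
    finally show ?thesis unfolding \<delta>_def using 1 by linarith
  qed
  show ?thesis
  proof (rule that[of "\<lambda>a. 2 * (\<delta> a / a)"])
    have "((\<lambda>a. 2 * (C * (harmonic_defect a / a) + (\<integral>\<omega>. min \<bar>T 1 \<omega>\<bar> a \<partial>M) / a)) \<longlongrightarrow> 2 * (C * 0 + 0)) at_top"
      by (intro tendsto_intros harmonic_defect_tendsto min_tendsto) auto
    then show "((\<lambda>a. 2 * (\<delta> a / a)) \<longlongrightarrow> 0) at_top" by (simp add: \<delta>_def add_divide_distrib)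
    fix G and a :: real assume G: "G \<in> sets (F 1)" and a: "a > 0"
    \<comment> \<open>Applied to the whole space, the same estimate places the mean of
      \<open>W r 0 a\<close> near \<open>u r 1 a\<close>. The two errors explain the factor 2 in the
      rate.\<close>
    have 1: "\<bar>(\<integral>\<omega>. indicator (space M) \<omega> * W r 0 a \<omega> \<partial>M) - measure M (space M) * u r 1 a\<bar> \<le> \<delta> a"
      by (rule main[OF space_in_F a])
    have "(\<integral>\<omega>. indicator (space M) \<omega> * W r 0 a \<omega> \<partial>M) = (\<integral>\<omega>. W r 0 a \<omega> \<partial>M)"
      by (intro Bochner_Integration.integral_cong) auto
    with 1 have 1: "\<bar>(\<integral>\<omega>. W r 0 a \<omega> \<partial>M) - u r 1 a\<bar> \<le> \<delta> a" by (simp add: prob_space)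
    have "measure M G * \<bar>(\<integral>\<omega>. W r 0 a \<omega> \<partial>M) - u r 1 a\<bar> \<le> 1 * \<delta> a"
      by (intro mult_mono 1) auto
    then have "\<bar>measure M G * (\<integral>\<omega>. W r 0 a \<omega> \<partial>M) - measure M G * u r 1 a\<bar> \<le> \<delta> a"
      by (simp add: abs_mult flip: right_diff_distrib)
    with main[OF G a] have "\<bar>(\<integral>\<omega>. indicator G \<omega> * W r 0 a \<omega> \<partial>M) - measure M G * (\<integral>\<omega>. W r 0 a \<omega> \<partial>M)\<bar> \<le> 2 * \<delta> a"
      by linarith
    then show "\<bar>(\<integral>\<omega>. indicator G \<omega> * W r 0 a \<omega> \<partial>M) - measure M G * (\<integral>\<omega>. W r 0 a \<omega> \<partial>M)\<bar> \<le> 2 * (\<delta> a / a) * a"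
      using a by simp
  qed
qed

end

section \<open>Variance of occupation times under stationarity\<close>

locale stationary_markov_renewal = markov_renewal +
  assumes stationary: "\<And>s. distr M path_space (\<lambda>\<omega> t. J (t + s) \<omega>) = distr M path_space (\<lambda>\<omega> t. J t \<omega>)"
begin

sublocale lborel_M: pair_sigma_finite lborel M
  by unfold_locales

lemma path_measurable [measurable]: "(\<lambda>\<omega> t. J (t + s) \<omega>) \<in> measurable M path_space" "(\<lambda>\<omega> t. J t \<omega>) \<in> measurable M path_space"
  unfolding path_space_def by (rule measurable_abs_UNIV, measurable)+

lemma path_component [measurable]: "(\<lambda>f. f t) \<in> measurable path_space (count_space UNIV)"
  unfolding path_space_def by (rule measurable_component_singleton) simp

lemma path_component_eq [measurable]: "Measurable.pred path_space (\<lambda>f. f t = r)"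
  by (rule pred_eq_const1[OF path_component]) simp

lemma stationary_integral:
  fixes g :: "(real \<Rightarrow> nat) \<Rightarrow> real"
  assumes [measurable]: "g \<in> borel_measurable path_space"
  shows "(\<integral>\<omega>. g (\<lambda>t. J (t + s) \<omega>) \<partial>M) = (\<integral>\<omega>. g (\<lambda>t. J t \<omega>) \<partial>M)"
proof -
  have "(\<integral>\<omega>. g (\<lambda>t. J (t + s) \<omega>) \<partial>M) = (\<integral>f. g f \<partial>distr M path_space (\<lambda>\<omega> t. J (t + s) \<omega>))"
    by (subst integral_distr) auto
  also have "\<dots> = (\<integral>\<omega>. g (\<lambda>t. J t \<omega>) \<partial>M)"
    unfolding stationary by (subst integral_distr) auto
  finally show ?thesis .
qed

lemma stationary_measure:
  assumes [measurable]: "Measurable.pred path_space A"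
  shows "measure M {\<omega> \<in> space M. A (\<lambda>t. J (t + s) \<omega>)} = measure M {\<omega> \<in> space M. A (\<lambda>t. J t \<omega>)}"
proof -
  have *: "measure M {\<omega> \<in> space M. A (\<lambda>t. g t \<omega>)} = (\<integral>\<omega>. of_bool (A (\<lambda>t. g t \<omega>)) \<partial>M)" 
    if [measurable]: "(\<lambda>\<omega> t. g t \<omega>) \<in> measurable M path_space" for g :: "real \<Rightarrow> 'a \<Rightarrow> nat"
  proof -
    have "(\<integral>\<omega>. of_bool (A (\<lambda>t. g t \<omega>)) \<partial>M) = (\<integral>\<omega>. indicator {\<omega> \<in> space M. A (\<lambda>t. g t \<omega>)} \<omega> \<partial>M)"
      by (intro Bochner_Integration.integral_cong) (auto simp: indicator_def)
    also have "\<dots> = measure M {\<omega> \<in> space M. A (\<lambda>t. g t \<omega>)}" by simp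
    finally show ?thesis by simp
  qed
  show ?thesis
    unfolding *[OF path_measurable(1)] *[OF path_measurable(2)]
    by (rule stationary_integral[of "\<lambda>f. of_bool (A f)"]) measurable
qed

definition \<pi> :: "nat \<Rightarrow> real" where "\<pi> r = stat_dist M J r"
text \<open>The uncentred autocovariance of the indicator of state \<open>r\<close> at lag
  \<open>v\<close>.\<close>

definition jcov :: "nat \<Rightarrow> real \<Rightarrow> real" where "jcov r v = measure M {\<omega> \<in> space M. J 0 \<omega> = r \<and> J v \<omega> = r}"

lemma prob_J: "measure M {\<omega> \<in> space M. J t \<omega> = r} = \<pi> r"
  using stationary_measure[of "\<lambda>f. f 0 = r" t] by (simp add: \<pi>_def stat_dist_def)

lemma prob_J2: "measure M {\<omega> \<in> space M. J s \<omega> = r \<and> J t \<omega> = r} = jcov r \<bar>s - t\<bar>"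
proof (cases "s \<le> t")
  case True
  then show ?thesis using stationary_measure[of "\<lambda>f. f 0 = r \<and> f (t - s) = r" s] by (simp add: jcov_def)
next
  case False
  then show ?thesis using stationary_measure[of "\<lambda>f. f 0 = r \<and> f (s - t) = r" t] by (simp add: jcov_def conj_commute)
qed

lemma nn_J: "(\<integral>\<^sup>+\<omega>. of_bool (J t \<omega> = r) \<partial>M) = ennreal (\<pi> r)"
proof -
  have "(\<integral>\<^sup>+\<omega>. of_bool (J t \<omega> = r) \<partial>M) = (\<integral>\<^sup>+\<omega>. indicator {\<omega> \<in> space M. J t \<omega> = r} \<omega> \<partial>M)"
    by (intro nn_integral_cong) (auto simp: indicator_def)
  then show ?thesis by (simp add: emeasure_eq_measure prob_J)
qed

lemma nn_J2: "(\<integral>\<^sup>+\<omega>. of_bool (J s \<omega> = r \<and> J t \<omega> = r) \<partial>M) = ennreal (jcov r \<bar>s - t\<bar>)"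
proof -
  have "(\<integral>\<^sup>+\<omega>. of_bool (J s \<omega> = r \<and> J t \<omega> = r) \<partial>M) = (\<integral>\<^sup>+\<omega>. indicator {\<omega> \<in> space M. J s \<omega> = r \<and> J t \<omega> = r} \<omega> \<partial>M)"
    by (intro nn_integral_cong) (auto simp: indicator_def)
  then show ?thesis by (simp add: emeasure_eq_measure prob_J2)
qed

lemma jcov_measurable [measurable]: "jcov r \<in> borel_measurable borel"
proof -
  have "(\<lambda>v. enn2real (\<integral>\<^sup>+\<omega>. of_bool (J 0 \<omega> = r \<and> J v \<omega> = r) \<partial>M)) \<in> borel_measurable borel" by measurable
  also have "(\<lambda>v. enn2real (\<integral>\<^sup>+\<omega>. of_bool (J 0 \<omega> = r \<and> J v \<omega> = r) \<partial>M)) = (\<lambda>v. jcov r \<bar>v\<bar>)"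
    using nn_J2[of 0 r] by (auto simp: jcov_def)
  also have "\<dots> = jcov r" using prob_J2[of 0 r] by (auto simp: jcov_def)
  finally show ?thesis .
qed

lemma expectation_W0: assumes "L \<ge> 0" shows "(\<integral>\<omega>. W r 0 L \<omega> \<partial>M) = \<pi> r * L"
proof -
  have "ennreal (\<integral>\<omega>. W r 0 L \<omega> \<partial>M) = (\<integral>\<^sup>+\<omega>. occ r 0 L \<omega> \<partial>M)"
    using assms by (subst nn_integral_eq_integral[symmetric]) (auto intro!: W_integrable nn_integral_cong simp: W_bounds W_occ)
  also have "\<dots> = (\<integral>\<^sup>+t. \<integral>\<^sup>+\<omega>. of_bool (0 \<le> t \<and> t < 0 + L \<and> J t \<omega> = r) \<partial>M \<partial>lborel)"
    unfolding occ_def by (rule lborel_M.Fubini') measurable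
  also have "\<dots> = (\<integral>\<^sup>+t. ennreal (\<pi> r) * indicator {0..<L} t \<partial>lborel)"
  proof (intro nn_integral_cong)
    fix t
    show "(\<integral>\<^sup>+\<omega>. of_bool (0 \<le> t \<and> t < 0 + L \<and> J t \<omega> = r) \<partial>M) = ennreal (\<pi> r) * indicator {0..<L} t"
      using nn_J[of t r] by (cases "0 \<le> t \<and> t < L") auto
  qed
  also have "\<dots> = ennreal (\<pi> r * L)" using assms by (simp add: nn_integral_cmult ennreal_mult \<pi>_def stat_dist_def)
  finally show ?thesis using assms by (subst (asm) ennreal_inj) (auto intro!: integral_nonneg_AE AE_I2 simp: W_bounds \<pi>_def stat_dist_def)
qed

definition Cint :: "nat \<Rightarrow> real \<Rightarrow> ennreal" where "Cint r a = (\<integral>\<^sup>+v. ennreal (jcov r v) * indicator {0..<a} v \<partial>lborel)"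

text \<open>Time 0 lies in the sojourn from \<open>T 0\<close> to \<open>T 1\<close>. This puts the
  event \<open>J 0 = r\<close> into \<open>F 1\<close> up to a null set, as
  \<open>decorrelation\<close> requires.\<close>

lemma X_0_eq_J_0: "AE \<omega> in M. X 0 \<omega> = J 0 \<omega>"
proof -
  have "AE \<omega> in M. T 0 \<omega> \<le> 0 \<and> 0 < T (0 + 1) \<omega>" using path by eventually_elim simp
  then show ?thesis
    using path_const
  proof eventually_elim
    case (elim \<omega>)
    from elim(2)[rule_format, OF elim(1)] show ?case by (simp add: X_def)
  qed
qed

text \<open>Fubini turns the integrated covariance into the mean of an occupation time on an event
  of the past, the quantity that \<open>decorrelation\<close> controls.\<close>

lemma Cint_eq: 
  assumes "a \<ge> 0"
  shows "Cint r a = ennreal (\<integral>\<omega>. indicator (at_state 0 r) \<omega> * W r 0 a \<omega> \<partial>M)"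
proof -
  have "ennreal (\<integral>\<omega>. indicator (at_state 0 r) \<omega> * W r 0 a \<omega> \<partial>M) 
     = (\<integral>\<^sup>+\<omega>. of_bool (J 0 \<omega> = r) * occ r 0 a \<omega> \<partial>M)"
  proof (subst nn_integral_eq_integral[symmetric])
    show "(\<integral>\<^sup>+\<omega>. ennreal (indicator (at_state 0 r) \<omega> * W r 0 a \<omega>) \<partial>M) = (\<integral>\<^sup>+\<omega>. of_bool (J 0 \<omega> = r) * occ r 0 a \<omega> \<partial>M)"
      using X_0_eq_J_0 AE_space by (intro nn_integral_cong_AE, eventually_elim) (use assms in \<open>auto simp: W_occ indicator_def\<close>)
  qed (use assms in \<open>auto intro!: W_G_integrable simp: W_bounds\<close>)
  also have "\<dots> = (\<integral>\<^sup>+\<omega>. \<integral>\<^sup>+t. of_bool (J 0 \<omega> = r) * of_bool (0 \<le> t \<and> t < 0 + a \<and> J t \<omega> = r) \<partial>lborel \<partial>M)"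
    unfolding occ_def by (intro nn_integral_cong nn_integral_cmult[symmetric]) measurable
  also have "\<dots> = (\<integral>\<^sup>+t. \<integral>\<^sup>+\<omega>. of_bool (J 0 \<omega> = r) * of_bool (0 \<le> t \<and> t < 0 + a \<and> J t \<omega> = r) \<partial>M \<partial>lborel)"
    by (rule lborel_M.Fubini') measurable
  also have "\<dots> = Cint r a"
    unfolding Cint_def
  proof (intro nn_integral_cong)
    fix t
    show "(\<integral>\<^sup>+\<omega>. of_bool (J 0 \<omega> = r) * of_bool (0 \<le> t \<and> t < 0 + a \<and> J t \<omega> = r) \<partial>M) = ennreal (jcov r t) * indicator {0..<a} t"
      using nn_J2[of 0 r t] by (cases "0 \<le> t \<and> t < a") (auto simp: of_bool_conj)
  qed
  finally show ?thesis by simp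
qed

text \<open>For large \<open>a\<close> decorrelation gives \<open>(\<pi> r)\<^sup>2 * a\<close> up
  to \<open>e * a\<close>; below the threshold \<open>a0\<close> the trivial bound by
  \<open>a\<close> is absorbed into \<open>B\<close>.\<close>

lemma Cint_bound:
  assumes e: "e > 0"
  obtains B where "B \<ge> 0" "\<And>a. a \<ge> 0 \<Longrightarrow> Cint r a \<le> ennreal (((\<pi> r)\<^sup>2 + e) * a + B)"
proof -
  let ?G = "at_state 0 r"
  obtain \<epsilon> where \<epsilon>: "(\<epsilon> \<longlongrightarrow> 0) at_top" "\<And>G a. G \<in> sets (F 1) \<Longrightarrow> a > 0 \<Longrightarrow>
      \<bar>(\<integral>\<omega>. indicator G \<omega> * W r 0 a \<omega> \<partial>M) - measure M G * (\<integral>\<omega>. W r 0 a \<omega> \<partial>M)\<bar> \<le> \<epsilon> a * a"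
    by (rule decorrelation) blast
  have G: "?G \<in> sets (F 1)" using X_eq_F F_mono[of 0 1] by auto
  have "measure M ?G = measure M {\<omega> \<in> space M. J 0 \<omega> = r}"
    using X_0_eq_J_0 by (intro finite_measure_eq_AE) (auto elim!: eventually_mono)
  then have pG: "measure M ?G = \<pi> r" by (simp add: prob_J)
  from \<epsilon>(1) e have "\<forall>\<^sub>F a in at_top. \<epsilon> a < e" by (rule order_tendstoD)
  then obtain a0 where a0: "\<And>a. a \<ge> a0 \<Longrightarrow> \<epsilon> a < e" unfolding eventually_at_top_linorder by auto
  show ?thesis
  proof (rule that[of "max a0 0"])
    fix a :: real assume a: "a \<ge> 0"
    have "(\<integral>\<omega>. indicator ?G \<omega> * W r 0 a \<omega> \<partial>M) \<le> ((\<pi> r)\<^sup>2 + e) * a + max a0 0"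
    proof (cases "a > 0 \<and> a \<ge> a0")
      case True
      then have "(\<integral>\<omega>. indicator ?G \<omega> * W r 0 a \<omega> \<partial>M) \<le> \<pi> r * (\<pi> r * a) + \<epsilon> a * a"
        using \<epsilon>(2)[OF G, of a] unfolding pG expectation_W0[OF a] by linarith
      also have "\<dots> \<le> \<pi> r * (\<pi> r * a) + e * a" using a0[of a] True by (intro add_left_mono mult_right_mono) auto
      also have "\<dots> = ((\<pi> r)\<^sup>2 + e) * a" by (simp add: power2_eq_square algebra_simps)
      finally show ?thesis by simp
    next
      case False
      then have "a \<le> max a0 0" using a by auto
      have "(\<integral>\<omega>. indicator ?G \<omega> * W r 0 a \<omega> \<partial>M) \<le> (\<integral>\<omega>. a \<partial>M)"
        by (intro integral_mono W_G_integrable a) (use a in \<open>auto simp: indicator_def W_bounds\<close>)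
      also have "\<dots> = a" by (simp add: prob_space)
      also have "\<dots> \<le> ((\<pi> r)\<^sup>2 + e) * a + max a0 0"
      proof -
        have "0 \<le> ((\<pi> r)\<^sup>2 + e) * a" using a e by (intro mult_nonneg_nonneg add_nonneg_nonneg) auto
        then show ?thesis using \<open>a \<le> max a0 0\<close> by linarith
      qed
      finally show ?thesis .
    qed
    then show "Cint r a \<le> ennreal (((\<pi> r)\<^sup>2 + e) * a + max a0 0)"
      unfolding Cint_eq[OF a] by (rule ennreal_leI)
  qed simp
qed

lemma inner_bound:
  assumes "0 \<le> s" "s \<le> L"
  shows "(\<integral>\<^sup>+t. ennreal (jcov r \<bar>s - t\<bar>) * indicator {0..<L} t \<partial>lborel) \<le> Cint r s + Cint r (L - s)"
proof -
  have "(\<integral>\<^sup>+t. ennreal (jcov r \<bar>s - t\<bar>) * indicator {0..<L} t \<partial>lborel)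
    \<le> (\<integral>\<^sup>+t. ennreal (jcov r (s - t)) * indicator {0<..s} t + ennreal (jcov r (t - s)) * indicator {s..<L} t \<partial>lborel)"
  proof (rule nn_integral_mono_AE)
    \<comment> \<open>The reflection of \<open>{0..<s}\<close> by \<open>s - t\<close> is
      \<open>{0<..s}\<close>, so the point 0 has to be dropped as a null set.\<close>
    have "AE t in lborel. t \<noteq> (0::real)" by (rule AE_lborel_singleton)
    then show "AE t in lborel. ennreal (jcov r \<bar>s - t\<bar>) * indicator {0..<L} t
       \<le> ennreal (jcov r (s - t)) * indicator {0<..s} t + ennreal (jcov r (t - s)) * indicator {s..<L} t"
    proof eventually_elim
      case (elim t)
      consider "t \<notin> {0..<L}" | "0 < t" "t \<le> s" | "s < t" "t < L" using elim by fastforce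
      then show ?case
      proof cases
        case 2
        then have "\<bar>s - t\<bar> = s - t" by simp
        with 2 show ?thesis by (simp add: indicator_def)
      next
        case 3
        then have "\<bar>s - t\<bar> = t - s" by simp
        with 3 assms show ?thesis by (simp add: indicator_def)
      qed simp
    qed
  qed
  also have "\<dots> = (\<integral>\<^sup>+t. ennreal (jcov r (s - t)) * indicator {0<..s} t \<partial>lborel) + (\<integral>\<^sup>+t. ennreal (jcov r (t - s)) * indicator {s..<L} t \<partial>lborel)"
    by (rule nn_integral_add) auto
  also have "(\<integral>\<^sup>+t. ennreal (jcov r (s - t)) * indicator {0<..s} t \<partial>lborel) = Cint r s"
    unfolding Cint_def
    by (subst nn_integral_real_affine[of _ "-1" s]) (auto intro!: nn_integral_cong simp: indicator_def)
  also have "(\<integral>\<^sup>+t. ennreal (jcov r (t - s)) * indicator {s..<L} t \<partial>lborel) = Cint r (L - s)"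
    unfolding Cint_def
    by (subst nn_integral_real_affine[of _ "1" s]) (auto intro!: nn_integral_cong simp: indicator_def)
  finally show ?thesis .
qed

abbreviation occ_var :: "nat \<Rightarrow> real \<Rightarrow> real" where
  "occ_var r L \<equiv> (\<integral>\<omega>. (W r 0 L \<omega> - \<pi> r * L)\<^sup>2 \<partial>M)"

text \<open>The second moment of \<open>W\<close> is the double integral of \<open>jcov\<close> over
  a square. Splitting the inner integral at \<open>s\<close> gives two pieces of total length
  \<open>L\<close>, so its leading term is \<open>(\<pi> r)\<^sup>2 * L\<close> for every
  \<open>s\<close> and cancels against the squared mean.\<close>

lemma occupation_variance:
  assumes e: "e > 0"
  obtains B where "B \<ge> 0" "\<And>L. L \<ge> 0 \<Longrightarrow> occ_var r L \<le> e * L\<^sup>2 + B * L"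
proof -
  obtain B where B: "B \<ge> 0" "\<And>a. a \<ge> 0 \<Longrightarrow> Cint r a \<le> ennreal (((\<pi> r)\<^sup>2 + e) * a + B)"
    by (rule Cint_bound[OF e, of r]) blast
  show ?thesis
  proof (rule that[of "2 * B"])
    show "2 * B \<ge> 0" using B by simp
    fix L :: real assume L: "L \<ge> 0"
    have W2: "integrable M (\<lambda>\<omega>. (W r 0 L \<omega>)\<^sup>2)"
      by (rule integrable_const_bound[of _ "L\<^sup>2"]) (use L in \<open>auto simp: W_bounds intro!: power_mono\<close>)
    have "ennreal (\<integral>\<omega>. (W r 0 L \<omega>)\<^sup>2 \<partial>M) = (\<integral>\<^sup>+\<omega>. occ r 0 L \<omega> * occ r 0 L \<omega> \<partial>M)"
      using L by (subst nn_integral_eq_integral[symmetric, OF W2]) (auto simp: W_occ power2_eq_square ennreal_mult W_bounds)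
    also have "\<dots> = (\<integral>\<^sup>+\<omega>. \<integral>\<^sup>+s. of_bool (0 \<le> s \<and> s < 0 + L \<and> J s \<omega> = r) * occ r 0 L \<omega> \<partial>lborel \<partial>M)"
      by (subst (1) occ_def, intro nn_integral_cong nn_integral_multc[symmetric]) measurable
    also have "\<dots> = (\<integral>\<^sup>+\<omega>. \<integral>\<^sup>+s. \<integral>\<^sup>+t. of_bool (0 \<le> s \<and> s < 0 + L \<and> J s \<omega> = r) * of_bool (0 \<le> t \<and> t < 0 + L \<and> J t \<omega> = r) \<partial>lborel \<partial>lborel \<partial>M)"
      unfolding occ_def by (intro nn_integral_cong nn_integral_cmult[symmetric]) measurable
    also have "\<dots> = (\<integral>\<^sup>+s. \<integral>\<^sup>+\<omega>. \<integral>\<^sup>+t. of_bool (0 \<le> s \<and> s < 0 + L \<and> J s \<omega> = r) * of_bool (0 \<le> t \<and> t < 0 + L \<and> J t \<omega> = r) \<partial>lborel \<partial>M \<partial>lborel)"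
      by (rule lborel_M.Fubini') measurable
    also have "\<dots> = (\<integral>\<^sup>+s. \<integral>\<^sup>+t. \<integral>\<^sup>+\<omega>. of_bool (0 \<le> s \<and> s < 0 + L \<and> J s \<omega> = r) * of_bool (0 \<le> t \<and> t < 0 + L \<and> J t \<omega> = r) \<partial>M \<partial>lborel \<partial>lborel)"
      by (intro nn_integral_cong lborel_M.Fubini') measurable
    also have "\<dots> = (\<integral>\<^sup>+s. \<integral>\<^sup>+t. ennreal (jcov r \<bar>s - t\<bar>) * indicator {0..<L} t * indicator {0..<L} s \<partial>lborel \<partial>lborel)"
    proof (intro nn_integral_cong)
      fix s t
      show "(\<integral>\<^sup>+\<omega>. of_bool (0 \<le> s \<and> s < 0 + L \<and> J s \<omega> = r) * of_bool (0 \<le> t \<and> t < 0 + L \<and> J t \<omega> = r) \<partial>M)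
        = ennreal (jcov r \<bar>s - t\<bar>) * indicator {0..<L} t * indicator {0..<L} s"
        using nn_J2[of s r t] by (cases "0 \<le> t \<and> t < L"; cases "0 \<le> s \<and> s < L") (auto simp: of_bool_conj)
    qed
    also have "\<dots> = (\<integral>\<^sup>+s. (\<integral>\<^sup>+t. ennreal (jcov r \<bar>s - t\<bar>) * indicator {0..<L} t \<partial>lborel) * indicator {0..<L} s \<partial>lborel)"
      by (intro nn_integral_cong nn_integral_multc) measurable
    also have "\<dots> \<le> (\<integral>\<^sup>+s. ennreal (((\<pi> r)\<^sup>2 + e) * L + 2 * B) * indicator {0..<L} s \<partial>lborel)"
    proof (intro nn_integral_mono)
      fix s
      show "(\<integral>\<^sup>+t. ennreal (jcov r \<bar>s - t\<bar>) * indicator {0..<L} t \<partial>lborel) * indicator {0..<L} s \<le> ennreal (((\<pi> r)\<^sup>2 + e) * L + 2 * B) * indicator {0..<L} s"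
      proof (cases "s \<in> {0..<L}")
        case True
        then have "(\<integral>\<^sup>+t. ennreal (jcov r \<bar>s - t\<bar>) * indicator {0..<L} t \<partial>lborel) \<le> Cint r s + Cint r (L - s)"
          by (intro inner_bound) auto
        also have "\<dots> \<le> ennreal (((\<pi> r)\<^sup>2 + e) * s + B) + ennreal (((\<pi> r)\<^sup>2 + e) * (L - s) + B)"
          using True by (intro add_mono B) auto
        also have "\<dots> = ennreal (((\<pi> r)\<^sup>2 + e) * L + 2 * B)"
        proof -
          have "0 \<le> ((\<pi> r)\<^sup>2 + e) * s + B" "0 \<le> ((\<pi> r)\<^sup>2 + e) * (L - s) + B"
            using True e B(1) by (auto intro!: add_nonneg_nonneg mult_nonneg_nonneg)
          from ennreal_plus[OF this, symmetric] show ?thesis by (simp add: algebra_simps)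
        qed
        finally show ?thesis by (intro mult_right_mono) auto
      qed simp
    qed
    also have "\<dots> = ennreal ((((\<pi> r)\<^sup>2 + e) * L + 2 * B) * L)"
      using L e B(1) by (simp add: nn_integral_cmult ennreal_mult)
    finally have EW2: "(\<integral>\<omega>. (W r 0 L \<omega>)\<^sup>2 \<partial>M) \<le> (((\<pi> r)\<^sup>2 + e) * L + 2 * B) * L"
      using L e B(1) by (subst (asm) ennreal_le_iff) auto
    have "occ_var r L = (\<integral>\<omega>. (W r 0 L \<omega>)\<^sup>2 - 2 * (\<pi> r * L) * W r 0 L \<omega> + (\<pi> r * L)\<^sup>2 \<partial>M)"
      by (intro Bochner_Integration.integral_cong) (auto simp: power2_eq_square algebra_simps)
    also have "\<dots> = (\<integral>\<omega>. (W r 0 L \<omega>)\<^sup>2 \<partial>M) - 2 * (\<pi> r * L) * (\<pi> r * L) + (\<pi> r * L)\<^sup>2"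
      using W2 W_integrable[of L "\<lambda>_. 0" r] L by (simp add: expectation_W0 prob_space)
    also have "\<dots> = (\<integral>\<omega>. (W r 0 L \<omega>)\<^sup>2 \<partial>M) - (\<pi> r * L)\<^sup>2" by (simp add: power2_eq_square algebra_simps)
    also have "\<dots> \<le> e * L\<^sup>2 + 2 * B * L" using EW2 by (simp add: power2_eq_square algebra_simps)
    finally show "occ_var r L \<le> e * L\<^sup>2 + 2 * B * L" .
  qed
qed

end

section \<open>Counting requests by environment state\<close>

lemma measurable_card_int:
  fixes S :: "'a \<Rightarrow> int set"
  assumes [measurable]: "\<And>i. Measurable.pred M (\<lambda>x. i \<in> S x)"
  shows "(\<lambda>x. card (S x)) \<in> measurable M (count_space UNIV)"
proof -
  have "card (S x) = card {m. int_decode m \<in> S x}" for x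
  proof (rule bij_betw_same_card[of int_encode])
    have "int_encode ` S x = {m. int_decode m \<in> S x}"
    proof (intro equalityI subsetI)
      fix m assume "m \<in> {m. int_decode m \<in> S x}"
      then show "m \<in> int_encode ` S x" by (intro image_eqI[of _ _ "int_decode m"]) auto
    qed auto
    then show "bij_betw int_encode (S x) {m. int_decode m \<in> S x}"
      using inj_int_encode by (simp add: bij_betw_def)
  qed
  then show ?thesis by (simp add: measurable_card)
qed

lemma Int_stable_vimage_sets: "Int_stable {X -` A \<inter> \<Omega> |A. A \<in> sets S}"
proof (rule Int_stableI)
  fix U V assume "U \<in> {X -` A \<inter> \<Omega> |A. A \<in> sets S}" "V \<in> {X -` A \<inter> \<Omega> |A. A \<in> sets S}"
  then obtain A B where "A \<in> sets S" "U = X -` A \<inter> \<Omega>" "B \<in> sets S" "V = X -` B \<inter> \<Omega>" by blast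
  then show "U \<inter> V \<in> {X -` A \<inter> \<Omega> |A. A \<in> sets S}" by (intro CollectI exI[of _ "A \<inter> B"]) auto
qed

locale poisson_sampling = stationary_markov_renewal M Ms J T Q P
  for M :: "'a measure" and Ms J T Q P +
  fixes \<tau> :: "int \<Rightarrow> 'a \<Rightarrow> real"
  assumes poisson: "unit_poisson M \<tau>" and indep: "indep_J_tau M J \<tau>"
begin

lemma tau_meas [measurable]: "\<tau> n \<in> borel_measurable M"
  using poisson by (auto simp: unit_poisson_def)

lemma tau_path: "AE \<omega> in M. (\<forall>m n. m < n \<longrightarrow> \<tau> m \<omega> < \<tau> n \<omega>) \<and> \<tau> 0 \<omega> \<le> 0 \<and> 0 < \<tau> 1 \<omega>"
proof -
  have "AE \<omega> in M. strict_mono (\<lambda>n. \<tau> n \<omega>) \<and> \<tau> 0 \<omega> \<le> 0 \<and> 0 < \<tau> 1 \<omega>"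
    using poisson by (simp add: unit_poisson_def)
  then show ?thesis by eventually_elim (auto simp: strict_mono_def)
qed

lemma prob_pcount: "a \<le> b \<Longrightarrow> measure M {\<omega> \<in> space M. pcount \<tau> \<omega> a b = k} = exp (-(b - a)) * (b - a) ^ k / fact k"
  using poisson by (simp add: unit_poisson_def)

lemma indep_increments:
  "strict_mono t \<Longrightarrow> indep_vars (\<lambda>_. count_space UNIV) (\<lambda>i \<omega>. pcount \<tau> \<omega> (t i) (t (Suc i))) {..<m::nat}"
  using poisson by (simp add: unit_poisson_def)

text \<open>The count as a functional of the point sequence, the form in which the independence of
  \<open>J\<close> and \<open>\<tau>\<close> applies.\<close>

definition cnt :: "real \<Rightarrow> real \<Rightarrow> (int \<Rightarrow> real) \<Rightarrow> nat" where "cnt a b g = card {n. a < g n \<and> g n \<le> b}"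

lemma cnt_measurable [measurable]: "cnt a b \<in> measurable tau_space (count_space UNIV)"
proof -
  have [measurable]: "(\<lambda>g. g i) \<in> borel_measurable tau_space" for i
    unfolding tau_space_def by (rule measurable_component_singleton) simp
  show ?thesis unfolding cnt_def by (rule measurable_card_int) measurable
qed

lemma tau_measurable [measurable]: "(\<lambda>\<omega> n. \<tau> n \<omega>) \<in> measurable M tau_space"
  unfolding tau_space_def by (rule measurable_abs_UNIV) measurable

lemma pcount_cnt: "pcount \<tau> \<omega> a b = cnt a b (\<lambda>n. \<tau> n \<omega>)"
  by (simp add: pcount_def cnt_def)

lemma pcount_measurable [measurable]: "(\<lambda>\<omega>. pcount \<tau> \<omega> a b) \<in> measurable M (count_space UNIV)"
  unfolding pcount_def by (rule measurable_card_int) measurable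

lemma indep_var_J_tau:
  fixes f :: "(real \<Rightarrow> nat) \<Rightarrow> real" and g :: "(int \<Rightarrow> real) \<Rightarrow> real"
  assumes [measurable]: "f \<in> borel_measurable path_space" "g \<in> borel_measurable tau_space"
  shows "indep_var borel (\<lambda>\<omega>. f (\<lambda>t. J t \<omega>)) borel (\<lambda>\<omega>. g (\<lambda>n. \<tau> n \<omega>))"
  unfolding indep_var_eq
proof (intro conjI indep_set_sigma_sets Int_stable_vimage_sets)
  let ?A = "{(\<lambda>\<omega>. f (\<lambda>t. J t \<omega>)) -` A \<inter> space M |A. A \<in> sets borel}"
  let ?B = "{(\<lambda>\<omega>. g (\<lambda>n. \<tau> n \<omega>)) -` A \<inter> space M |A. A \<in> sets borel}"
  let ?A' = "{(\<lambda>\<omega> t. J t \<omega>) -` A \<inter> space M | A. A \<in> sets path_space}"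
  let ?B' = "{(\<lambda>\<omega> n. \<tau> n \<omega>) -` B \<inter> space M | B. B \<in> sets tau_space}"
  have sp: "space path_space = UNIV" "space tau_space = UNIV"
    by (auto simp: path_space_def tau_space_def space_PiM)
  have A: "U \<in> ?A'" if U: "U \<in> ?A" for U
  proof -
    obtain C where C: "C \<in> sets borel" "U = (\<lambda>\<omega>. f (\<lambda>t. J t \<omega>)) -` C \<inter> space M" using U by blast
    have "f -` C \<in> sets path_space" using measurable_sets[OF assms(1) C(1)] by (simp add: sp)
    moreover have "U = (\<lambda>\<omega> t. J t \<omega>) -` (f -` C) \<inter> space M" using C(2) by auto
    ultimately show ?thesis by blast
  qed
  have B: "U \<in> ?B'" if U: "U \<in> ?B" for U
  proof -
    obtain C where C: "C \<in> sets borel" "U = (\<lambda>\<omega>. g (\<lambda>n. \<tau> n \<omega>)) -` C \<inter> space M" using U by blast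
    have "g -` C \<in> sets tau_space" using measurable_sets[OF assms(2) C(1)] by (simp add: sp)
    moreover have "U = (\<lambda>\<omega> n. \<tau> n \<omega>) -` (g -` C) \<inter> space M" using C(2) by auto
    ultimately show ?thesis by blast
  qed
  have ind: "indep_set ?A' ?B'" using indep by (simp only: indep_J_tau_def)
  show "indep_set ?A ?B"
  proof (rule indep_setI)
    show "?A \<subseteq> events" "?B \<subseteq> events" by auto
    fix U V assume "U \<in> ?A" "V \<in> ?B"
    from indep_setD[OF ind A[OF this(1)] B[OF this(2)]] show "prob (U \<inter> V) = prob U * prob V" .
  qed
qed measurable

lemma J_tau_product:
  fixes f :: "(real \<Rightarrow> nat) \<Rightarrow> real" and g :: "(int \<Rightarrow> real) \<Rightarrow> real"
  assumes "f \<in> borel_measurable path_space" "g \<in> borel_measurable tau_space"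
    and "integrable M (\<lambda>\<omega>. f (\<lambda>t. J t \<omega>))" "integrable M (\<lambda>\<omega>. g (\<lambda>n. \<tau> n \<omega>))"
  shows "(\<integral>\<omega>. f (\<lambda>t. J t \<omega>) * g (\<lambda>n. \<tau> n \<omega>) \<partial>M) = (\<integral>\<omega>. f (\<lambda>t. J t \<omega>) \<partial>M) * (\<integral>\<omega>. g (\<lambda>n. \<tau> n \<omega>) \<partial>M)"
    and "integrable M (\<lambda>\<omega>. f (\<lambda>t. J t \<omega>) * g (\<lambda>n. \<tau> n \<omega>))"
  by (intro indep_var_lebesgue_integral indep_var_integrable indep_var_J_tau assms)+

text \<open>\<open>pcount\<close> is 0 on infinite sets of points, so an accumulation of points before \<open>b\<close> forces \<open>pcount \<tau> \<omega> 0 K = 0\<close> for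
  every \<open>K \<ge> b\<close>, an event of probability at most \<open>exp (-K)\<close>.\<close>
lemma finite_points: "AE \<omega> in M. \<forall>a b. 0 \<le> a \<longrightarrow> finite {n. a < \<tau> n \<omega> \<and> \<tau> n \<omega> \<le> b}"
proof -
  have "AE \<omega> in M. finite {n. 0 < \<tau> n \<omega> \<and> \<tau> n \<omega> \<le> real m}" for m
  proof -
    let ?N = "{\<omega> \<in> space M. \<forall>K\<ge>m. pcount \<tau> \<omega> 0 (real K) = 0}"
    have [measurable]: "?N \<in> sets M" by measurable
    have "measure M ?N \<le> exp (- real K)" if "K \<ge> m" for K
    proof -
      have "measure M ?N \<le> measure M {\<omega> \<in> space M. pcount \<tau> \<omega> 0 (real K) = 0}"
        using that by (intro finite_measure_mono) auto
      also have "\<dots> = exp (- real K)" using prob_pcount[of 0 "real K" 0] by simp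
      finally show ?thesis .
    qed
    then have ev: "\<forall>\<^sub>F K in sequentially. measure M ?N \<le> exp (- real K)"
      unfolding eventually_sequentially by blast
    have lim: "(\<lambda>K. exp (- real K)) \<longlonglongrightarrow> 0"
      by (rule filterlim_compose[OF exp_at_bot], rule filterlim_compose[OF filterlim_uminus_at_bot_at_top filterlim_real_sequentially])
    have "measure M ?N \<le> 0" by (rule tendsto_lowerbound[OF lim ev]) simp
    then have "emeasure M ?N = 0" by (simp add: emeasure_eq_measure measure_le_0_iff)
    then have "AE \<omega> in M. \<omega> \<notin> ?N" by (intro AE_not_in) auto
    then show ?thesis
      using AE_space
    proof eventually_elim
      case (elim \<omega>)
      show ?case
      proof (rule ccontr)
        assume inf: "infinite {n. 0 < \<tau> n \<omega> \<and> \<tau> n \<omega> \<le> real m}"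
        have "pcount \<tau> \<omega> 0 (real K) = 0" if "K \<ge> m" for K
        proof -
          have "{n. 0 < \<tau> n \<omega> \<and> \<tau> n \<omega> \<le> real m} \<subseteq> {n. 0 < \<tau> n \<omega> \<and> \<tau> n \<omega> \<le> real K}" using that by auto
          with inf have "infinite {n. 0 < \<tau> n \<omega> \<and> \<tau> n \<omega> \<le> real K}" using finite_subset by blast
          then show ?thesis by (simp add: pcount_def)
        qed
        with elim show False by blast
      qed
    qed
  qed
  then have "AE \<omega> in M. \<forall>m. finite {n. 0 < \<tau> n \<omega> \<and> \<tau> n \<omega> \<le> real m}"
    by (simp add: AE_all_countable)
  then show ?thesis
  proof eventually_elim
    case (elim \<omega>)
    show ?case
    proof (intro allI impI)
      fix a b :: real assume "0 \<le> a"
      obtain m where "b \<le> real m" using real_arch_simple by blast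
      with \<open>0 \<le> a\<close> have "{n. a < \<tau> n \<omega> \<and> \<tau> n \<omega> \<le> b} \<subseteq> {n. 0 < \<tau> n \<omega> \<and> \<tau> n \<omega> \<le> real m}" by auto
      with elim show "finite {n. a < \<tau> n \<omega> \<and> \<tau> n \<omega> \<le> b}" using finite_subset by blast
    qed
  qed
qed

section \<open>First two moments of the Poisson counts\<close>

text \<open>\<open>S\<close> carries the factor \<open>exp (b - a)\<close> so that the premise is an
  identity for the exponential series; the normalisation of the Poisson masses cancels it.\<close>

lemma nn_pcount:
  fixes f :: "nat \<Rightarrow> real"
  assumes "a \<le> b" "\<And>k. 0 \<le> f k" and S: "(\<lambda>k. f k * (b - a) ^ k / fact k) sums (S * exp (b - a))"
  shows "(\<integral>\<^sup>+\<omega>. ennreal (f (pcount \<tau> \<omega> a b)) \<partial>M) = ennreal S"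
proof -
  have "(\<integral>\<^sup>+\<omega>. ennreal (f (pcount \<tau> \<omega> a b)) \<partial>M)
      = (\<integral>\<^sup>+\<omega>. (\<Sum>k. ennreal (f k) * indicator {\<omega> \<in> space M. pcount \<tau> \<omega> a b = k} \<omega>) \<partial>M)"
  proof (rule nn_integral_cong)
    fix \<omega> assume "\<omega> \<in> space M"
    then have *: "ennreal (f k) * indicator {\<omega> \<in> space M. pcount \<tau> \<omega> a b = k} \<omega> = (if k = pcount \<tau> \<omega> a b then ennreal (f k) else 0)" for k
      by auto
    show "ennreal (f (pcount \<tau> \<omega> a b)) = (\<Sum>k. ennreal (f k) * indicator {\<omega> \<in> space M. pcount \<tau> \<omega> a b = k} \<omega>)"
      unfolding * using suminf_finite[of "{pcount \<tau> \<omega> a b}" "\<lambda>k. if k = pcount \<tau> \<omega> a b then ennreal (f k) else 0"] by simp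
  qed
  also have "\<dots> = (\<Sum>k. ennreal (f k) * ennreal (exp (-(b - a)) * (b - a) ^ k / fact k))"
    by (subst nn_integral_suminf) (auto simp: nn_integral_cmult emeasure_eq_measure prob_pcount[OF assms(1)])
  also have "\<dots> = (\<Sum>k. ennreal (f k * (exp (-(b - a)) * (b - a) ^ k / fact k)))"
    by (intro suminf_cong ennreal_mult[symmetric]) (use assms in auto)
  also have "\<dots> = ennreal S"
  proof (rule suminf_ennreal_eq)
    show "0 \<le> f k * (exp (-(b - a)) * (b - a) ^ k / fact k)" for k using assms by simp
    from sums_mult[OF S, of "exp (-(b - a))"]
    show "(\<lambda>k. f k * (exp (-(b - a)) * (b - a) ^ k / fact k)) sums S"
      by (simp add: mult_ac exp_minus field_simps flip: exp_add)
  qed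
  finally show ?thesis .
qed

lemma exp_sums_first: "(\<lambda>k. real k * h ^ k / fact k) sums (h * exp (h::real))"
proof -
  have "(\<lambda>k. h * (h ^ k / fact k)) sums (h * exp h)"
    using exp_converges[of h] by (intro sums_mult) (simp add: divide_inverse mult.commute)
  moreover have "real (Suc k) * h ^ Suc k / fact (Suc k) = h * (h ^ k / fact k)" for k
    by (simp add: fact_Suc del: of_nat_Suc) 
  ultimately have "(\<lambda>k. real (Suc k) * h ^ Suc k / fact (Suc k)) sums (h * exp h)" by simp
  from sums_Suc[OF this] show ?thesis by simp
qed

lemma exp_sums_second: "(\<lambda>k. (real k)\<^sup>2 * h ^ k / fact k) sums ((h + h\<^sup>2) * exp (h::real))"
proof -
  have "(\<lambda>k. h * (real k * h ^ k / fact k) + h * (h ^ k / fact k)) sums (h * (h * exp h) + h * exp h)"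
    using exp_converges[of h] by (intro sums_add sums_mult exp_sums_first) (simp add: divide_inverse mult.commute)
  moreover have "(real (Suc k))\<^sup>2 * h ^ Suc k / fact (Suc k) = h * (real k * h ^ k / fact k) + h * (h ^ k / fact k)" for k
  proof -
    have "(real (Suc k))\<^sup>2 * h ^ Suc k / fact (Suc k) = real (Suc k) * (h * h ^ k) / fact k"
      by (simp add: fact_Suc power2_eq_square del: of_nat_Suc)
    then show ?thesis by (simp add: field_simps)
  qed
  ultimately have "(\<lambda>k. (real (Suc k))\<^sup>2 * h ^ Suc k / fact (Suc k)) sums (h * (h * exp h) + h * exp h)" by simp
  from sums_Suc[OF this] show ?thesis by (simp add: power2_eq_square algebra_simps)
qed

lemma nn_pcount_first: "a \<le> b \<Longrightarrow> (\<integral>\<^sup>+\<omega>. ennreal (real (pcount \<tau> \<omega> a b)) \<partial>M) = ennreal (b - a)"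
  by (rule nn_pcount) (auto simp: exp_sums_first)

lemma nn_pcount_second: "a \<le> b \<Longrightarrow> (\<integral>\<^sup>+\<omega>. ennreal ((real (pcount \<tau> \<omega> a b))\<^sup>2) \<partial>M) = ennreal ((b - a) + (b - a)\<^sup>2)"
  by (rule nn_pcount) (auto simp: exp_sums_second)

lemma pcount_integrable:
  assumes "a \<le> b"
  shows "integrable M (\<lambda>\<omega>. real (pcount \<tau> \<omega> a b))" "integrable M (\<lambda>\<omega>. (real (pcount \<tau> \<omega> a b))\<^sup>2)"
  by (rule integrableI_bounded; simp add: nn_pcount_first nn_pcount_second assms)+

lemma pcount_mean: "a \<le> b \<Longrightarrow> (\<integral>\<omega>. real (pcount \<tau> \<omega> a b) \<partial>M) = b - a"
  by (subst integral_eq_nn_integral) (auto simp: nn_pcount_first)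

lemma pcount_second_moment: "a \<le> b \<Longrightarrow> (\<integral>\<omega>. (real (pcount \<tau> \<omega> a b))\<^sup>2 \<partial>M) = (b - a) + (b - a)\<^sup>2"
  by (subst integral_eq_nn_integral) (auto simp: nn_pcount_second simp del: ennreal_plus)

section \<open>Discretised counts of the requests made in one state\<close>

definition mesh :: "real \<Rightarrow> real \<Rightarrow> nat \<Rightarrow> nat \<Rightarrow> real" where "mesh a L K j = a + L / real K * real j"

text \<open>On each cell the environment is sampled at one deterministic time, so every summand is a
  product of a function of \<open>J\<close> and a function of \<open>\<tau>\<close>. The right end
  point is taken because paths are right-continuous: as the mesh shrinks it approaches the points of
  its cell from the right.\<close>

definition disc_count :: "nat \<Rightarrow> real \<Rightarrow> real \<Rightarrow> nat \<Rightarrow> 'a \<Rightarrow> real" where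
  "disc_count r a L K \<omega> = (\<Sum>j<K. of_bool (J (mesh a L K (Suc j)) \<omega> = r) * real (pcount \<tau> \<omega> (mesh a L K j) (mesh a L K (Suc j))))"

text \<open>The conditional mean of \<open>disc_count\<close> given the environment, as a functional
  on the path space.\<close>

definition disc_occ :: "nat \<Rightarrow> real \<Rightarrow> real \<Rightarrow> nat \<Rightarrow> (real \<Rightarrow> nat) \<Rightarrow> real" where
  "disc_occ r a L K f = (\<Sum>j<K. of_bool (f (mesh a L K (Suc j)) = r) * (L / real K))"

lemma disc_occ_measurable [measurable]: "disc_occ r a L K \<in> borel_measurable path_space"
  unfolding disc_occ_def by measurable

lemma disc_count_measurable [measurable]: "disc_count r a L K \<in> borel_measurable M"
  unfolding disc_count_def by measurable

lemma disc_occ_bounds: "0 \<le> L \<Longrightarrow> 0 \<le> disc_occ r a L K f" "0 \<le> L \<Longrightarrow> disc_occ r a L K f \<le> L"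
proof -
  assume L: "0 \<le> L"
  then show "0 \<le> disc_occ r a L K f" unfolding disc_occ_def by (intro sum_nonneg) auto
  have "disc_occ r a L K f \<le> (\<Sum>j<K. L / real K)"
    unfolding disc_occ_def using L by (intro sum_mono) auto
  also have "\<dots> \<le> L" using L by simp
  finally show "disc_occ r a L K f \<le> L" .
qed

lemma disc_occ_stationary:
  "(\<integral>\<omega>. (disc_occ r a L K (\<lambda>t. J t \<omega>) - x)\<^sup>2 \<partial>M) = (\<integral>\<omega>. (disc_occ r 0 L K (\<lambda>t. J t \<omega>) - x)\<^sup>2 \<partial>M)"
  using stationary_integral[of "\<lambda>f. (disc_occ r 0 L K f - x)\<^sup>2" a]
  by (simp add: disc_occ_def mesh_def add.commute)

lemma path_bounded_integrable:
  fixes f :: "(real \<Rightarrow> nat) \<Rightarrow> real"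
  assumes [measurable]: "f \<in> borel_measurable path_space" and "\<And>x. \<bar>f x\<bar> \<le> C"
  shows "integrable M (\<lambda>\<omega>. f (\<lambda>t. J t \<omega>))"
  by (rule integrable_const_bound[of _ C]) (use assms in auto)

lemma J_D_product:
  fixes f :: "(real \<Rightarrow> nat) \<Rightarrow> real" and g :: "(int \<Rightarrow> real) \<Rightarrow> real"
  assumes "f \<in> borel_measurable path_space" "\<And>x. \<bar>f x\<bar> \<le> C" "g \<in> borel_measurable tau_space" "integrable M (\<lambda>\<omega>. g (\<lambda>n. \<tau> n \<omega>))"
  shows "(\<integral>\<omega>. f (\<lambda>t. J t \<omega>) * g (\<lambda>n. \<tau> n \<omega>) \<partial>M) = (\<integral>\<omega>. f (\<lambda>t. J t \<omega>) \<partial>M) * (\<integral>\<omega>. g (\<lambda>n. \<tau> n \<omega>) \<partial>M)"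
    and "integrable M (\<lambda>\<omega>. f (\<lambda>t. J t \<omega>) * g (\<lambda>n. \<tau> n \<omega>))"
  by (rule J_tau_product[OF assms(1,3) path_bounded_integrable[OF assms(1,2)] assms(4)])+

lemma mesh_strict_mono: "L > 0 \<Longrightarrow> K > 0 \<Longrightarrow> strict_mono (mesh a L K)"
  by (auto simp: strict_mono_Suc_iff mesh_def distrib_left)

lemma mesh_step: "mesh a L K (Suc j) - mesh a L K j = L / real K"
  by (simp add: mesh_def algebra_simps add_divide_distrib)

text \<open>Centred counts over different cells are independent, hence orthogonal; on the diagonal
  the Poisson variance is \<open>(h + h\<^sup>2) - 2 * h * h + h\<^sup>2 = h\<close>.\<close>

lemma centred_counts:
  assumes L: "L > 0" and K: "K > 0" and h_def: "h = L / real K"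
    and D_def: "\<And>j \<omega>. D j \<omega> = real (pcount \<tau> \<omega> (mesh a L K j) (mesh a L K (Suc j))) - h"
  shows "integrable M (D i)" "(\<integral>\<omega>. D i \<omega> \<partial>M) = 0" "integrable M (\<lambda>\<omega>. D i \<omega> * D j \<omega>)"
    "(\<integral>\<omega>. D i \<omega> * D j \<omega> \<partial>M) = (if i = j then h else 0)"
proof -
  have le: "mesh a L K j \<le> mesh a L K (Suc j)" for j
    using strict_monoD[OF mesh_strict_mono[OF L K], of j "Suc j"] by (simp add: less_imp_le)
  note pc = pcount_integrable[OF le]
  have step: "mesh a L K (Suc j) - mesh a L K j = h" for j by (simp add: mesh_step h_def)
  show 1: "integrable M (D i)" for i unfolding D_def[abs_def] by (intro Bochner_Integration.integrable_diff pc) simp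
  show 2: "(\<integral>\<omega>. D i \<omega> \<partial>M) = 0" for i
    unfolding D_def by (subst Bochner_Integration.integral_diff) (auto simp: pc pcount_mean[OF le] step prob_space)
  have sq: "D i \<omega> * D i \<omega> = (real (pcount \<tau> \<omega> (mesh a L K i) (mesh a L K (Suc i))))\<^sup>2 -
       2 * h * real (pcount \<tau> \<omega> (mesh a L K i) (mesh a L K (Suc i))) + h\<^sup>2" for i \<omega>
    by (simp add: D_def power2_eq_square algebra_simps)
  have int_sq: "integrable M (\<lambda>\<omega>. D i \<omega> * D i \<omega>)" and E_sq: "(\<integral>\<omega>. D i \<omega> * D i \<omega> \<partial>M) = h" for i
  proof -
    show "integrable M (\<lambda>\<omega>. D i \<omega> * D i \<omega>)"
      unfolding sq using pc[of i] by (intro Bochner_Integration.integrable_add Bochner_Integration.integrable_diff integrable_mult_right) auto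
    have "(\<integral>\<omega>. D i \<omega> * D i \<omega> \<partial>M) = (h + h\<^sup>2) - 2 * h * h + h\<^sup>2"
      unfolding sq using pc[of i] by (simp add: pcount_mean[OF le] pcount_second_moment[OF le] step prob_space)
    then show "(\<integral>\<omega>. D i \<omega> * D i \<omega> \<partial>M) = h" by (simp add: power2_eq_square)
  qed
  have cross: "integrable M (\<lambda>\<omega>. D i \<omega> * D j \<omega>) \<and> (\<integral>\<omega>. D i \<omega> * D j \<omega> \<partial>M) = 0" if "i \<noteq> j" for i j
  proof -
    have "indep_vars (\<lambda>_. count_space UNIV) (\<lambda>i \<omega>. pcount \<tau> \<omega> (mesh a L K i) (mesh a L K (Suc i))) {..<Suc (max i j)}"
      by (rule indep_increments[OF mesh_strict_mono[OF L K]])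
    then have "indep_vars (\<lambda>_. count_space UNIV) (\<lambda>i \<omega>. pcount \<tau> \<omega> (mesh a L K i) (mesh a L K (Suc i))) {i, j}"
      by (rule indep_vars_subset) auto
    from indep_vars_compose2[OF this, of "\<lambda>_ k. real k - h" "\<lambda>_. borel"]
    have ind: "indep_vars (\<lambda>_. borel) D {i, j}" by (simp add: D_def[abs_def])
    have "(\<integral>\<omega>. (\<Prod>k\<in>{i, j}. D k \<omega>) \<partial>M) = (\<Prod>k\<in>{i, j}. \<integral>\<omega>. D k \<omega> \<partial>M)"
      by (rule indep_vars_lebesgue_integral[OF _ ind]) (auto simp: 1)
    moreover have "integrable M (\<lambda>\<omega>. (\<Prod>k\<in>{i, j}. D k \<omega>))"
      by (rule indep_vars_integrable[OF _ ind]) (auto simp: 1)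
    ultimately show ?thesis using that by (simp add: 2)
  qed
  show "integrable M (\<lambda>\<omega>. D i \<omega> * D j \<omega>)" using int_sq cross by (cases "i = j") auto
  show "(\<integral>\<omega>. D i \<omega> * D j \<omega> \<partial>M) = (if i = j then h else 0)" using E_sq cross by (cases "i = j") auto
qed

text \<open>The deviation splits into the noise, a sum of terms \<open>X i * D i\<close>, and the
  deviation \<open>B\<close> of the sampled occupation time. Independence of \<open>J\<close> and
  \<open>\<tau>\<close> removes all mixed terms, and each cell contributes
  \<open>\<pi> r * h\<close> on the diagonal.\<close>

lemma disc_second_moment:
  assumes L: "L > 0" and K: "K > 0"
  shows "integrable M (\<lambda>\<omega>. (disc_count r a L K \<omega> - \<pi> r * L)\<^sup>2)" (is ?int)
    "(\<integral>\<omega>. (disc_count r a L K \<omega> - \<pi> r * L)\<^sup>2 \<partial>M) = \<pi> r * L + (\<integral>\<omega>. (disc_occ r 0 L K (\<lambda>t. J t \<omega>) - \<pi> r * L)\<^sup>2 \<partial>M)" (is ?eq)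
proof -
  define h where "h = L / real K"
  define D where "D j \<omega> = real (pcount \<tau> \<omega> (mesh a L K j) (mesh a L K (Suc j))) - h" for j \<omega>
  define D' where "D' j g = real (cnt (mesh a L K j) (mesh a L K (Suc j)) g) - h" for j g
  define X where "X j f = (of_bool (f (mesh a L K (Suc j)) = r) :: real)" for j and f :: "real \<Rightarrow> nat"
  define B where "B f = disc_occ r a L K f - \<pi> r * L" for f
  have D': "D j \<omega> = D' j (\<lambda>n. \<tau> n \<omega>)" for j \<omega> by (simp add: D_def D'_def pcount_cnt)
  have [measurable]: "D' j \<in> borel_measurable tau_space" "X j \<in> borel_measurable path_space" "B \<in> borel_measurable path_space" for j
    unfolding D'_def X_def B_def by measurable
  note cc = centred_counts[OF L K h_def, of D a, OF D_def]
  have XB: "\<bar>X i f * X j f\<bar> \<le> 1" "\<bar>X i f * B f\<bar> \<le> L + \<bar>\<pi> r * L\<bar>" "\<bar>(B f)\<^sup>2\<bar> \<le> (L + \<bar>\<pi> r * L\<bar>)\<^sup>2" for i j f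
  proof -
    have B: "\<bar>B f\<bar> \<le> L + \<bar>\<pi> r * L\<bar>"
      using disc_occ_bounds[of L r a K f] L unfolding B_def by linarith
    then show "\<bar>X i f * B f\<bar> \<le> L + \<bar>\<pi> r * L\<bar>" using L by (auto simp: X_def)
    show "\<bar>(B f)\<^sup>2\<bar> \<le> (L + \<bar>\<pi> r * L\<bar>)\<^sup>2" using power_mono[OF B, of 2] by simp
    show "\<bar>X i f * X j f\<bar> \<le> 1" by (auto simp: X_def)
  qed
  have 1: "integrable M (\<lambda>\<omega>. X i (\<lambda>t. J t \<omega>) * X j (\<lambda>t. J t \<omega>) * (D i \<omega> * D j \<omega>))"
     "(\<integral>\<omega>. X i (\<lambda>t. J t \<omega>) * X j (\<lambda>t. J t \<omega>) * (D i \<omega> * D j \<omega>) \<partial>M) = (if i = j then \<pi> r * h else 0)" for i j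
  proof -
    have i: "integrable M (\<lambda>\<omega>. D' i (\<lambda>n. \<tau> n \<omega>) * D' j (\<lambda>n. \<tau> n \<omega>))" using cc(3)[of i j] by (simp add: D')
    note J_D_product[of "\<lambda>f. X i f * X j f" 1 "\<lambda>g. D' i g * D' j g", OF _ XB(1) _ i]
    then have *: "integrable M (\<lambda>\<omega>. X i (\<lambda>t. J t \<omega>) * X j (\<lambda>t. J t \<omega>) * (D i \<omega> * D j \<omega>))"
      "(\<integral>\<omega>. X i (\<lambda>t. J t \<omega>) * X j (\<lambda>t. J t \<omega>) * (D i \<omega> * D j \<omega>) \<partial>M)
        = (\<integral>\<omega>. X i (\<lambda>t. J t \<omega>) * X j (\<lambda>t. J t \<omega>) \<partial>M) * (\<integral>\<omega>. D i \<omega> * D j \<omega> \<partial>M)" by (simp_all add: D')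
    show "integrable M (\<lambda>\<omega>. X i (\<lambda>t. J t \<omega>) * X j (\<lambda>t. J t \<omega>) * (D i \<omega> * D j \<omega>))" by (rule *(1))
    have "(\<integral>\<omega>. X i (\<lambda>t. J t \<omega>) * X i (\<lambda>t. J t \<omega>) \<partial>M) = (\<integral>\<omega>. indicator {\<omega> \<in> space M. J (mesh a L K (Suc i)) \<omega> = r} \<omega> \<partial>M)"
      by (intro Bochner_Integration.integral_cong) (auto simp: X_def)
    also have "\<dots> = \<pi> r" by (simp add: prob_J)
    finally show "(\<integral>\<omega>. X i (\<lambda>t. J t \<omega>) * X j (\<lambda>t. J t \<omega>) * (D i \<omega> * D j \<omega>) \<partial>M) = (if i = j then \<pi> r * h else 0)"
      unfolding *(2) cc(4) by auto
  qed
  have 2: "integrable M (\<lambda>\<omega>. X i (\<lambda>t. J t \<omega>) * B (\<lambda>t. J t \<omega>) * D i \<omega>)"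
     "(\<integral>\<omega>. X i (\<lambda>t. J t \<omega>) * B (\<lambda>t. J t \<omega>) * D i \<omega> \<partial>M) = 0" for i
  proof -
    have i: "integrable M (\<lambda>\<omega>. D' i (\<lambda>n. \<tau> n \<omega>))" using cc(1)[of i] by (simp add: D'[abs_def])
    from J_D_product[of "\<lambda>f. X i f * B f" _ "D' i", OF _ XB(2) _ i] cc(2)[of i]
    show "integrable M (\<lambda>\<omega>. X i (\<lambda>t. J t \<omega>) * B (\<lambda>t. J t \<omega>) * D i \<omega>)"
     "(\<integral>\<omega>. X i (\<lambda>t. J t \<omega>) * B (\<lambda>t. J t \<omega>) * D i \<omega> \<partial>M) = 0" by (simp_all add: D')
  qed
  have 3: "integrable M (\<lambda>\<omega>. (B (\<lambda>t. J t \<omega>))\<^sup>2)"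
    by (rule path_bounded_integrable[of "\<lambda>f. (B f)\<^sup>2", OF _ XB(3)]) measurable
  have expand: "(disc_count r a L K \<omega> - \<pi> r * L)\<^sup>2 = (\<Sum>i<K. \<Sum>j<K. X i (\<lambda>t. J t \<omega>) * X j (\<lambda>t. J t \<omega>) * (D i \<omega> * D j \<omega>))
      + 2 * (\<Sum>i<K. X i (\<lambda>t. J t \<omega>) * B (\<lambda>t. J t \<omega>) * D i \<omega>) + (B (\<lambda>t. J t \<omega>))\<^sup>2" for \<omega>
  proof -
    let ?f = "\<lambda>t. J t \<omega>"
    have "disc_count r a L K \<omega> = (\<Sum>i<K. X i ?f * D i \<omega>) + disc_occ r a L K ?f"
      unfolding disc_count_def disc_occ_def X_def D_def h_def sum.distrib[symmetric]
      by (intro sum.cong) (auto simp: algebra_simps)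
    then have "disc_count r a L K \<omega> - \<pi> r * L = (\<Sum>i<K. X i ?f * D i \<omega>) + B ?f" by (simp add: B_def)
    then have "(disc_count r a L K \<omega> - \<pi> r * L)\<^sup>2 = (\<Sum>i<K. X i ?f * D i \<omega>) * (\<Sum>i<K. X i ?f * D i \<omega>)
        + 2 * ((\<Sum>i<K. X i ?f * D i \<omega>) * B ?f) + (B ?f)\<^sup>2"
      by (simp add: power2_eq_square algebra_simps)
    also have "(\<Sum>i<K. X i ?f * D i \<omega>) * (\<Sum>i<K. X i ?f * D i \<omega>) = (\<Sum>i<K. \<Sum>j<K. X i ?f * X j ?f * (D i \<omega> * D j \<omega>))"
      unfolding sum_product by (intro sum.cong refl) (simp add: mult_ac)
    also have "(\<Sum>i<K. X i ?f * D i \<omega>) * B ?f = (\<Sum>i<K. X i ?f * B ?f * D i \<omega>)"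
      unfolding sum_distrib_right by (intro sum.cong refl) (simp add: mult_ac)
    finally show ?thesis .
  qed
  show ?int
    unfolding expand by (intro Bochner_Integration.integrable_add Bochner_Integration.integrable_sum integrable_mult_right 1 2 3)
  have "(\<integral>\<omega>. (disc_count r a L K \<omega> - \<pi> r * L)\<^sup>2 \<partial>M) = 
     (\<Sum>i<K. \<Sum>j<K. \<integral>\<omega>. X i (\<lambda>t. J t \<omega>) * X j (\<lambda>t. J t \<omega>) * (D i \<omega> * D j \<omega>) \<partial>M)
      + 2 * (\<Sum>i<K. \<integral>\<omega>. X i (\<lambda>t. J t \<omega>) * B (\<lambda>t. J t \<omega>) * D i \<omega> \<partial>M) + (\<integral>\<omega>. (B (\<lambda>t. J t \<omega>))\<^sup>2 \<partial>M)"
    unfolding expand using 1(1) 2(1) 3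
    by (simp add: Bochner_Integration.integral_add Bochner_Integration.integral_sum Bochner_Integration.integrable_sum)
  also have "\<dots> = (\<Sum>i<K. \<pi> r * h) + (\<integral>\<omega>. (B (\<lambda>t. J t \<omega>))\<^sup>2 \<partial>M)"
    unfolding 1(2) 2(2) by (simp add: sum.delta)
  also have "(\<Sum>i<K. \<pi> r * h) = \<pi> r * L" using K by (simp add: h_def)
  also have "(\<integral>\<omega>. (B (\<lambda>t. J t \<omega>))\<^sup>2 \<partial>M) = (\<integral>\<omega>. (disc_occ r 0 L K (\<lambda>t. J t \<omega>) - \<pi> r * L)\<^sup>2 \<partial>M)"
    unfolding B_def by (rule disc_occ_stationary)
  finally show ?eq .
qed

lemma disc_first_moment:
  assumes L: "L > 0" and K: "K > 0"
  shows "(\<integral>\<^sup>+\<omega>. ennreal (disc_count r a L K \<omega>) \<partial>M) = ennreal (\<pi> r * L)"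
proof -
  have le: "mesh a L K j \<le> mesh a L K (Suc j)" for j
    using strict_monoD[OF mesh_strict_mono[OF L K], of j "Suc j"] by (simp add: less_imp_le)
  have *: "integrable M (\<lambda>\<omega>. of_bool (J (mesh a L K (Suc j)) \<omega> = r) * real (pcount \<tau> \<omega> (mesh a L K j) (mesh a L K (Suc j))))"
    "(\<integral>\<omega>. of_bool (J (mesh a L K (Suc j)) \<omega> = r) * real (pcount \<tau> \<omega> (mesh a L K j) (mesh a L K (Suc j))) \<partial>M) = \<pi> r * (L / real K)" for j
  proof -
    have i: "integrable M (\<lambda>\<omega>. real (cnt (mesh a L K j) (mesh a L K (Suc j)) (\<lambda>n. \<tau> n \<omega>)))"
      using pcount_integrable(1)[OF le[of j]] by (simp add: pcount_cnt)
    have "(\<integral>\<omega>. of_bool (J (mesh a L K (Suc j)) \<omega> = r) \<partial>M) = (\<integral>\<omega>. indicator {\<omega> \<in> space M. J (mesh a L K (Suc j)) \<omega> = r} \<omega> \<partial>M)"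
      by (intro Bochner_Integration.integral_cong) auto
    also have "\<dots> = \<pi> r" by (simp add: prob_J)
    finally have p: "(\<integral>\<omega>. of_bool (J (mesh a L K (Suc j)) \<omega> = r) \<partial>M) = \<pi> r" .
    from J_D_product[of "\<lambda>f. of_bool (f (mesh a L K (Suc j)) = r)" 1 "\<lambda>g. real (cnt (mesh a L K j) (mesh a L K (Suc j)) g)", OF _ _ _ i] p
      pcount_mean[OF le[of j]]
    show "integrable M (\<lambda>\<omega>. of_bool (J (mesh a L K (Suc j)) \<omega> = r) * real (pcount \<tau> \<omega> (mesh a L K j) (mesh a L K (Suc j))))"
    "(\<integral>\<omega>. of_bool (J (mesh a L K (Suc j)) \<omega> = r) * real (pcount \<tau> \<omega> (mesh a L K j) (mesh a L K (Suc j))) \<partial>M) = \<pi> r * (L / real K)"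
      by (simp_all add: pcount_cnt mesh_step)
  qed
  have "(\<integral>\<^sup>+\<omega>. ennreal (disc_count r a L K \<omega>) \<partial>M) = ennreal (\<integral>\<omega>. disc_count r a L K \<omega> \<partial>M)"
    unfolding disc_count_def by (intro nn_integral_eq_integral Bochner_Integration.integrable_sum *) (auto intro!: sum_nonneg)
  also have "(\<integral>\<omega>. disc_count r a L K \<omega> \<partial>M) = \<pi> r * L"
    unfolding disc_count_def by (subst Bochner_Integration.integral_sum[OF *(1)]) (use K in \<open>simp add: *(2)\<close>)
  finally show ?thesis .
qed

section \<open>Passage from the mesh to the point process\<close>

lemma right_constant: "AE \<omega> in M. \<forall>t. \<exists>\<delta>>0. \<forall>t'. t \<le> t' \<and> t' < t + \<delta> \<longrightarrow> J t' \<omega> = J t \<omega>"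
  using path_cover path_const
proof eventually_elim
  case (elim \<omega>)
  show ?case
  proof
    fix t
    obtain n where n: "T n \<omega> \<le> t" "t < T (n + 1) \<omega>" using elim(1) by blast
    show "\<exists>\<delta>>0. \<forall>t'. t \<le> t' \<and> t' < t + \<delta> \<longrightarrow> J t' \<omega> = J t \<omega>"
    proof (intro exI[of _ "T (n + 1) \<omega> - t"] conjI allI impI)
      fix t' assume "t \<le> t' \<and> t' < t + (T (n + 1) \<omega> - t)"
      then have "T n \<omega> \<le> t' \<and> t' < T (n + 1) \<omega>" using n by linarith
      from elim(2)[rule_format, OF this] elim(2)[rule_format, OF conjI, OF n] show "J t' \<omega> = J t \<omega>" by simp
    qed (use n in simp)
  qed
qed

lemma mesh_cell:
  assumes L: "L > 0" and K: "K > 0" and t: "a < t" "t \<le> a + L"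
  obtains j where "j < K" "mesh a L K j < t" "t \<le> mesh a L K (Suc j)"
proof -
  let ?j = "LEAST j. t \<le> mesh a L K (Suc j)"
  have "t \<le> mesh a L K (Suc (K - 1))" using K t by (simp add: mesh_def)
  then have j: "t \<le> mesh a L K (Suc ?j)" "?j \<le> K - 1" by (rule LeastI, rule Least_le)
  have "mesh a L K ?j < t"
  proof (cases "?j")
    case 0
    then show ?thesis using t by (simp add: mesh_def)
  next
    case (Suc i)
    then have "i < ?j" by simp
    from not_less_Least[OF this] show ?thesis unfolding Suc by simp
  qed
  with j K that[of ?j] show ?thesis by linarith
qed

lemma mesh_cell_unique:
  assumes L: "L > 0" and K: "K > 0" and "mesh a L K j < t" "t \<le> mesh a L K (Suc j)" "mesh a L K i < t" "t \<le> mesh a L K (Suc i)"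
  shows "i = j"
proof -
  have mono: "mesh a L K i < mesh a L K j \<longleftrightarrow> i < j" for i j by (rule strict_mono_less[OF mesh_strict_mono[OF L K]])
  have "mesh a L K i < mesh a L K (Suc j)" "mesh a L K j < mesh a L K (Suc i)" using assms(3-6) by linarith+
  then show ?thesis by (simp add: mono)
qed

text \<open>Approximates the indicator of \<open>f t = r\<close> on \<open>(a, a + L]\<close>. It
  links the two discretisations: \<open>disc_count\<close> sums it over the points,
  \<open>disc_occ\<close> integrates it.\<close>

definition step :: "nat \<Rightarrow> real \<Rightarrow> real \<Rightarrow> (real \<Rightarrow> nat) \<Rightarrow> nat \<Rightarrow> real \<Rightarrow> real" where
  "step r a L f K t = (\<Sum>j<K. of_bool (f (mesh a L K (Suc j)) = r) * of_bool (mesh a L K j < t \<and> t \<le> mesh a L K (Suc j)))"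

lemma step_cell:
  assumes L: "L > 0" and K: "K > 0" and j: "j < K" "mesh a L K j < t" "t \<le> mesh a L K (Suc j)"
  shows "step r a L f K t = of_bool (f (mesh a L K (Suc j)) = r)"
proof -
  have "of_bool (f (mesh a L K (Suc i)) = r) * of_bool (mesh a L K i < t \<and> t \<le> mesh a L K (Suc i))
     = (if i = j then of_bool (f (mesh a L K (Suc j)) = r) else (0 :: real))" for i
  proof (cases "i = j")
    case False
    with mesh_cell_unique[OF L K j(2,3), of i] have "\<not> (mesh a L K i < t \<and> t \<le> mesh a L K (Suc i))" by blast
    with False show ?thesis by simp
  qed (use j in simp)
  then show ?thesis unfolding step_def using j by simp
qed

lemma step_outside:
  assumes L: "L > 0" and t: "\<not> (a < t \<and> t \<le> a + L)"
  shows "step r a L f K t = 0"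
  unfolding step_def
proof (rule sum.neutral, rule ballI)
  fix j assume "j \<in> {..<K}"
  then have "j < K" and K: "K > 0" by auto
  have "L / real K * real (Suc j) \<le> L / real K * real K" using \<open>j < K\<close> L by (intro mult_left_mono) auto
  then have "mesh a L K (Suc j) \<le> a + L" using K by (simp add: mesh_def)
  moreover have "a \<le> mesh a L K j" using L by (simp add: mesh_def)
  ultimately have "\<not> (mesh a L K j < t \<and> t \<le> mesh a L K (Suc j))" using t by linarith
  then show "of_bool (f (mesh a L K (Suc j)) = r) * of_bool (mesh a L K j < t \<and> t \<le> mesh a L K (Suc j)) = (0 :: real)" by simp
qed

lemma step_bounds:
  assumes L: "L > 0" and K: "K > 0"
  shows "0 \<le> step r a L f K t \<and> step r a L f K t \<le> of_bool (a < t \<and> t \<le> a + L)"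
proof (cases "a < t \<and> t \<le> a + L")
  case True
  obtain j where j: "j < K" "mesh a L K j < t" "t \<le> mesh a L K (Suc j)" by (rule mesh_cell[OF L K, of a t]) (use True in auto)
  show ?thesis unfolding step_cell[OF L K j] using True by simp
qed (simp add: step_outside[OF L])

text \<open>Once the cells are shorter than \<open>\<delta>\<close>, the right end of the cell of
  \<open>t\<close> lies in \<open>[t, t + \<delta>)\<close>, where \<open>f\<close> takes the value
  \<open>f t\<close>.\<close>

lemma step_limit:
  assumes L: "L > 0" and \<delta>: "\<delta> > 0" "\<forall>t'. t \<le> t' \<and> t' < t + \<delta> \<longrightarrow> f t' = f t"
  shows "(\<lambda>K. step r a L f K t) \<longlonglongrightarrow> of_bool (a < t \<and> t \<le> a + L \<and> f t = r)"
proof (cases "a < t \<and> t \<le> a + L")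
  case False
  then show ?thesis by (auto simp: step_outside[OF L])
next
  case True
  obtain K0 where K0: "L / \<delta> < real K0" using reals_Archimedean2 by blast
  have "step r a L f K t = of_bool (a < t \<and> t \<le> a + L \<and> f t = r)" if "K \<ge> K0" for K
  proof -
    have "L / \<delta> < real K" using K0 that by linarith
    moreover have "0 < L / \<delta>" using L \<delta> by simp
    ultimately have K: "K > 0" by simp
    obtain j where j: "j < K" "mesh a L K j < t" "t \<le> mesh a L K (Suc j)" by (rule mesh_cell[OF L K, of a t]) (use True in auto)
    have "L / real K < \<delta>" using \<open>L / \<delta> < real K\<close> \<delta> K by (simp add: field_simps)
    then have "mesh a L K (Suc j) < t + \<delta>" using mesh_step[of a L K j] j(2) by linarith
    with \<delta>(2) j(3) have "f (mesh a L K (Suc j)) = f t" by blast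
    then show ?thesis unfolding step_cell[OF L K j] using True by simp
  qed
  then have "\<forall>\<^sub>F K in sequentially. step r a L f K t = of_bool (a < t \<and> t \<le> a + L \<and> f t = r)"
    unfolding eventually_sequentially by blast
  then show ?thesis by (rule tendsto_eventually)
qed

lemma disc_count_step:
  assumes L: "L > 0" and fin: "finite {n. a < \<tau> n \<omega> \<and> \<tau> n \<omega> \<le> a + L}"
  shows "disc_count r a L K \<omega> = (\<Sum>n\<in>{n. a < \<tau> n \<omega> \<and> \<tau> n \<omega> \<le> a + L}. step r a L (\<lambda>t. J t \<omega>) K (\<tau> n \<omega>))"
proof -
  let ?P = "{n. a < \<tau> n \<omega> \<and> \<tau> n \<omega> \<le> a + L}"
  have "real (pcount \<tau> \<omega> (mesh a L K j) (mesh a L K (Suc j))) = (\<Sum>n\<in>?P. of_bool (mesh a L K j < \<tau> n \<omega> \<and> \<tau> n \<omega> \<le> mesh a L K (Suc j)))"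
    if j: "j < K" for j
  proof -
    have K: "K > 0" using j by simp
    have "L / real K * real (Suc j) \<le> L / real K * real K" using j L by (intro mult_left_mono) auto
    then have 1: "mesh a L K (Suc j) \<le> a + L" using K by (simp add: mesh_def)
    have 2: "a \<le> mesh a L K j" using L by (simp add: mesh_def)
    have "{n. mesh a L K j < \<tau> n \<omega> \<and> \<tau> n \<omega> \<le> mesh a L K (Suc j)} = ?P \<inter> {n. mesh a L K j < \<tau> n \<omega> \<and> \<tau> n \<omega> \<le> mesh a L K (Suc j)}"
      using 1 2 by auto
    then show ?thesis unfolding pcount_def using fin by (simp add: sum_of_bool_eq del: of_bool_conj)
  qed
  then have "disc_count r a L K \<omega> = (\<Sum>j<K. \<Sum>n\<in>?P. of_bool (J (mesh a L K (Suc j)) \<omega> = r) * of_bool (mesh a L K j < \<tau> n \<omega> \<and> \<tau> n \<omega> \<le> mesh a L K (Suc j)))"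
    unfolding disc_count_def by (intro sum.cong) (auto simp: sum_distrib_left simp del: of_bool_conj)
  also have "\<dots> = (\<Sum>n\<in>?P. step r a L (\<lambda>t. J t \<omega>) K (\<tau> n \<omega>))" unfolding step_def by (rule sum.swap)
  finally show ?thesis .
qed

definition Nr :: "nat \<Rightarrow> real \<Rightarrow> real \<Rightarrow> 'a \<Rightarrow> nat" where
  "Nr r a L \<omega> = card {n. a < \<tau> n \<omega> \<and> \<tau> n \<omega> \<le> a + L \<and> J (\<tau> n \<omega>) \<omega> = r}"

lemma Nr_measurable [measurable]: "Nr r a L \<in> measurable M (count_space UNIV)"
  unfolding Nr_def by (rule measurable_card_int) measurable

lemma disc_count_limit:
  assumes L: "L > 0" and a: "a \<ge> 0"
  shows "AE \<omega> in M. (\<lambda>K. disc_count r a L K \<omega>) \<longlonglongrightarrow> real (Nr r a L \<omega>)"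
  using right_constant finite_points
proof eventually_elim
  case (elim \<omega>)
  let ?P = "{n. a < \<tau> n \<omega> \<and> \<tau> n \<omega> \<le> a + L}"
  have fin: "finite ?P" using elim(2)[rule_format, OF a] .
  have "(\<lambda>K. disc_count r a L K \<omega>) \<longlonglongrightarrow> (\<Sum>n\<in>?P. of_bool (a < \<tau> n \<omega> \<and> \<tau> n \<omega> \<le> a + L \<and> J (\<tau> n \<omega>) \<omega> = r))"
    unfolding disc_count_step[OF L fin]
  proof (intro tendsto_sum)
    fix n
    obtain \<delta> where "\<delta> > 0" "\<forall>t'. \<tau> n \<omega> \<le> t' \<and> t' < \<tau> n \<omega> + \<delta> \<longrightarrow> J t' \<omega> = J (\<tau> n \<omega>) \<omega>" using elim(1) by blast
    from step_limit[OF L this]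
    show "(\<lambda>K. step r a L (\<lambda>t. J t \<omega>) K (\<tau> n \<omega>)) \<longlonglongrightarrow> of_bool (a < \<tau> n \<omega> \<and> \<tau> n \<omega> \<le> a + L \<and> J (\<tau> n \<omega>) \<omega> = r)" .
  qed
  also have "(\<Sum>n\<in>?P. of_bool (a < \<tau> n \<omega> \<and> \<tau> n \<omega> \<le> a + L \<and> J (\<tau> n \<omega>) \<omega> = r)) = real (card (?P \<inter> {n. a < \<tau> n \<omega> \<and> \<tau> n \<omega> \<le> a + L \<and> J (\<tau> n \<omega>) \<omega> = r}))"
    by (subst sum_of_bool_eq) (simp_all add: fin)
  also have "?P \<inter> {n. a < \<tau> n \<omega> \<and> \<tau> n \<omega> \<le> a + L \<and> J (\<tau> n \<omega>) \<omega> = r} = {n. a < \<tau> n \<omega> \<and> \<tau> n \<omega> \<le> a + L \<and> J (\<tau> n \<omega>) \<omega> = r}" by auto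
  finally show ?case by (simp add: Nr_def)
qed

lemma disc_occ_limit:
  assumes L: "L > 0"
  shows "AE \<omega> in M. (\<lambda>K. disc_occ r 0 L K (\<lambda>t. J t \<omega>)) \<longlonglongrightarrow> W r 0 L \<omega>"
  using right_constant AE_space
proof eventually_elim
  case (elim \<omega>)
  let ?f = "\<lambda>t. J t \<omega>"
  have [measurable]: "Measurable.pred borel (\<lambda>t. J t \<omega> = r)"
    by (rule J_eq_measurable) (use elim in auto)
  have [measurable]: "step r 0 L ?f K \<in> borel_measurable borel" for K
    unfolding step_def by measurable
  have occ: "disc_occ r 0 L K ?f = (\<integral>t. step r 0 L ?f K t \<partial>lborel)" for K
  proof -
    have *: "has_bochner_integral lborel (\<lambda>t. of_bool (mesh 0 L K j < t \<and> t \<le> mesh 0 L K (Suc j)) :: real) (L / real K)" for j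
    proof -
      have "(\<lambda>t. of_bool (mesh 0 L K j < t \<and> t \<le> mesh 0 L K (Suc j)) :: real) = indicator {mesh 0 L K j<..mesh 0 L K (Suc j)}"
        by (auto simp: indicator_def)
      moreover have "mesh 0 L K j \<le> mesh 0 L K (Suc j)"
        using mesh_step[of 0 L K j] divide_nonneg_nonneg[of L "real K"] L by linarith
      ultimately show ?thesis using has_bochner_integral_real_indicator[of "{mesh 0 L K j<..mesh 0 L K (Suc j)}" lborel]
        by (simp add: mesh_step)
    qed
    show ?thesis
      unfolding step_def disc_occ_def
      by (rule has_bochner_integral_integral_eq[symmetric], intro has_bochner_integral_sum has_bochner_integral_mult_right *)
  qed
  \<comment> \<open>The shift to \<open>Suc K\<close> avoids the empty mesh, about which
    \<open>step_bounds\<close> says nothing.\<close>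
  have lim: "(\<lambda>K. \<integral>t. step r 0 L ?f (Suc K) t \<partial>lborel) \<longlonglongrightarrow> (\<integral>t. of_bool (0 < t \<and> t \<le> 0 + L \<and> J t \<omega> = r) \<partial>lborel)"
  proof (rule integral_dominated_convergence[where w = "indicator {0..L}"])
    show "AE t in lborel. (\<lambda>K. step r 0 L ?f (Suc K) t) \<longlonglongrightarrow> of_bool (0 < t \<and> t \<le> 0 + L \<and> J t \<omega> = r)"
    proof (rule AE_I2)
      fix t
      obtain \<delta> where "\<delta> > 0" "\<forall>t'. t \<le> t' \<and> t' < t + \<delta> \<longrightarrow> J t' \<omega> = J t \<omega>" using elim(1) by blast
      from step_limit[OF L this, of r 0]
      show "(\<lambda>K. step r 0 L ?f (Suc K) t) \<longlonglongrightarrow> of_bool (0 < t \<and> t \<le> 0 + L \<and> J t \<omega> = r)"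
        by (rule LIMSEQ_Suc)
    qed
    show "AE t in lborel. norm (step r 0 L ?f (Suc K) t) \<le> indicator {0..L} t" for K
    proof (rule AE_I2)
      fix t
      have "norm (step r 0 L ?f (Suc K) t) \<le> of_bool (0 < t \<and> t \<le> 0 + L)"
        using step_bounds[OF L, of "Suc K" r 0 ?f t] by simp
      also have "\<dots> \<le> indicator {0..L} t" by (simp add: indicator_def)
      finally show "norm (step r 0 L ?f (Suc K) t) \<le> indicator {0..L} t" .
    qed
    show "integrable lborel (indicator {0..L} :: real \<Rightarrow> real)"
      by (rule integrable_real_indicator) (use L in auto)
  qed auto
  have "(\<integral>t. of_bool (0 < t \<and> t \<le> 0 + L \<and> J t \<omega> = r) \<partial>lborel) = enn2real (\<integral>\<^sup>+t. ennreal (of_bool (0 < t \<and> t \<le> 0 + L \<and> J t \<omega> = r)) \<partial>lborel)"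
    by (rule integral_eq_nn_integral) auto
  also have "(\<integral>\<^sup>+t. ennreal (of_bool (0 < t \<and> t \<le> 0 + L \<and> J t \<omega> = r)) \<partial>lborel) = occ r 0 L \<omega>"
    unfolding occ_def
  proof (rule nn_integral_cong_AE)
    \<comment> \<open>\<open>step\<close> lives on \<open>(0, L]\<close> but \<open>occ\<close> on
      \<open>[0, L)\<close>; the end points form a null set.\<close>
    have "AE t in lborel. t \<noteq> (0::real)" "AE t in lborel. t \<noteq> L" by (rule AE_lborel_singleton)+
    then show "AE t in lborel. ennreal (of_bool (0 < t \<and> t \<le> 0 + L \<and> J t \<omega> = r)) = of_bool (0 \<le> t \<and> t < 0 + L \<and> J t \<omega> = r)"
    proof eventually_elim
      case (elim t)
      then have "(0 < t \<and> t \<le> 0 + L \<and> J t \<omega> = r) = (0 \<le> t \<and> t < 0 + L \<and> J t \<omega> = r)" by auto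
      then show ?case by (simp only: of_bool_def) simp
    qed
  qed
  finally have "(\<lambda>K. disc_occ r 0 L (Suc K) ?f) \<longlonglongrightarrow> W r 0 L \<omega>"
    using lim unfolding occ W_def by simp
  then show ?case by (rule LIMSEQ_imp_Suc)
qed

text \<open>Fatou's lemma along the meshes. An inequality suffices, since the first moment serves
  only to bound the faults of a constant content from above.\<close>

lemma count_first_moment:
  assumes L: "L > 0" and a: "a \<ge> 0"
  shows "(\<integral>\<^sup>+\<omega>. of_nat (Nr r a L \<omega>) \<partial>M) \<le> ennreal (\<pi> r * L)"
proof -
  have "(\<integral>\<^sup>+\<omega>. of_nat (Nr r a L \<omega>) \<partial>M) = (\<integral>\<^sup>+\<omega>. liminf (\<lambda>K. ennreal (disc_count r a L (Suc K) \<omega>)) \<partial>M)"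
  proof (rule nn_integral_cong_AE)
    show "AE \<omega> in M. of_nat (Nr r a L \<omega>) = liminf (\<lambda>K. ennreal (disc_count r a L (Suc K) \<omega>))"
      using disc_count_limit[OF L a, of r]
    proof eventually_elim
      case (elim \<omega>)
      have "(\<lambda>K. ennreal (disc_count r a L (Suc K) \<omega>)) \<longlonglongrightarrow> ennreal (real (Nr r a L \<omega>))"
        by (intro tendsto_ennrealI LIMSEQ_Suc elim)
      from lim_imp_Liminf[OF _ this] show ?case by (simp add: ennreal_of_nat_eq_real_of_nat)
    qed
  qed
  also have "\<dots> \<le> liminf (\<lambda>K. \<integral>\<^sup>+\<omega>. ennreal (disc_count r a L (Suc K) \<omega>) \<partial>M)"
    by (rule nn_integral_liminf) measurable
  also have "\<dots> = ennreal (\<pi> r * L)"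
    by (simp add: disc_first_moment[OF L] Liminf_const)
  finally show ?thesis .
qed

text \<open>Fatou again. The two terms on the right are the Poisson noise and the fluctuation of the
  occupation time; by \<open>occupation_variance\<close> their sum is
  \<open>o(L\<^sup>2)\<close>.\<close>

lemma count_second_moment:
  assumes L: "L > 0" and a: "a \<ge> 0"
  shows "(\<integral>\<^sup>+\<omega>. ennreal ((real (Nr r a L \<omega>) - \<pi> r * L)\<^sup>2) \<partial>M) \<le> ennreal (\<pi> r * L + occ_var r L)"
proof -
  have "(\<integral>\<^sup>+\<omega>. ennreal ((real (Nr r a L \<omega>) - \<pi> r * L)\<^sup>2) \<partial>M) = (\<integral>\<^sup>+\<omega>. liminf (\<lambda>K. ennreal ((disc_count r a L (Suc K) \<omega> - \<pi> r * L)\<^sup>2)) \<partial>M)"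
  proof (rule nn_integral_cong_AE)
    show "AE \<omega> in M. ennreal ((real (Nr r a L \<omega>) - \<pi> r * L)\<^sup>2) = liminf (\<lambda>K. ennreal ((disc_count r a L (Suc K) \<omega> - \<pi> r * L)\<^sup>2))"
      using disc_count_limit[OF L a, of r]
    proof eventually_elim
      case (elim \<omega>)
      have "(\<lambda>K. ennreal ((disc_count r a L (Suc K) \<omega> - \<pi> r * L)\<^sup>2)) \<longlonglongrightarrow> ennreal ((real (Nr r a L \<omega>) - \<pi> r * L)\<^sup>2)"
        by (intro tendsto_ennrealI tendsto_power tendsto_diff tendsto_const LIMSEQ_Suc elim)
      from lim_imp_Liminf[OF _ this] show ?case by simp
    qed
  qed
  also have "\<dots> \<le> liminf (\<lambda>K. \<integral>\<^sup>+\<omega>. ennreal ((disc_count r a L (Suc K) \<omega> - \<pi> r * L)\<^sup>2) \<partial>M)"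
    by (rule nn_integral_liminf) measurable
  also have "\<dots> = liminf (\<lambda>K. ennreal (\<pi> r * L + (\<integral>\<omega>. (disc_occ r 0 L (Suc K) (\<lambda>t. J t \<omega>) - \<pi> r * L)\<^sup>2 \<partial>M)))"
    by (subst nn_integral_eq_integral[OF disc_second_moment(1)[OF L]]) (auto simp: disc_second_moment(2)[OF L])
  also have "\<dots> = ennreal (\<pi> r * L + occ_var r L)"
  proof (rule lim_imp_Liminf)
    have "(\<lambda>K. \<integral>\<omega>. (disc_occ r 0 L (Suc K) (\<lambda>t. J t \<omega>) - \<pi> r * L)\<^sup>2 \<partial>M) \<longlonglongrightarrow> occ_var r L"
    proof (rule integral_dominated_convergence[where w = "\<lambda>_. (L + \<bar>\<pi> r * L\<bar>)\<^sup>2"])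
      show "AE \<omega> in M. (\<lambda>K. (disc_occ r 0 L (Suc K) (\<lambda>t. J t \<omega>) - \<pi> r * L)\<^sup>2) \<longlonglongrightarrow> (W r 0 L \<omega> - \<pi> r * L)\<^sup>2"
        using disc_occ_limit[OF L, of r] by eventually_elim (intro tendsto_power tendsto_diff tendsto_const LIMSEQ_Suc)
      show "AE \<omega> in M. norm ((disc_occ r 0 L (Suc K) (\<lambda>t. J t \<omega>) - \<pi> r * L)\<^sup>2) \<le> (L + \<bar>\<pi> r * L\<bar>)\<^sup>2" for K
      proof (rule AE_I2)
        fix \<omega>
        have "\<bar>disc_occ r 0 L (Suc K) (\<lambda>t. J t \<omega>) - \<pi> r * L\<bar> \<le> L + \<bar>\<pi> r * L\<bar>"
          using disc_occ_bounds[of L r 0 "Suc K" "\<lambda>t. J t \<omega>"] L by linarith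
        from power_mono[OF this, of 2] show "norm ((disc_occ r 0 L (Suc K) (\<lambda>t. J t \<omega>) - \<pi> r * L)\<^sup>2) \<le> (L + \<bar>\<pi> r * L\<bar>)\<^sup>2" by simp
      qed
    qed auto
    then show "(\<lambda>K. ennreal (\<pi> r * L + (\<integral>\<omega>. (disc_occ r 0 L (Suc K) (\<lambda>t. J t \<omega>) - \<pi> r * L)\<^sup>2 \<partial>M)))
       \<longlonglongrightarrow> ennreal (\<pi> r * L + occ_var r L)"
      by (intro tendsto_ennrealI tendsto_add tendsto_const)
  qed simp
  finally show ?thesis .
qed

end

section \<open>Request sequences and cache contents\<close>

text \<open>The conditional law of the requested documents given the states at the request times:
  independent draws, one for each entry of the list.\<close>

primrec seq_pmf :: "('s \<Rightarrow> 'b pmf) \<Rightarrow> 's list \<Rightarrow> 'b list pmf" where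
  "seq_pmf p [] = return_pmf []"
| "seq_pmf p (j # js) = map_pmf (\<lambda>(i, is). i # is) (pair_pmf (p j) (seq_pmf p js))"

lemma pmf_seq_pmf:
  "length is = length js \<Longrightarrow> pmf (seq_pmf p js) is = (\<Prod>k<length js. pmf (p (js ! k)) (is ! k))"
proof (induction "is" js rule: list_induct2)
  case (Cons i "is" j js)
  have "inj (\<lambda>(i :: 'a, is). i # is)" by (auto simp: inj_def)
  from pmf_map_inj'[OF this, of "pair_pmf (p j) (seq_pmf p js)" "(i, is)"] Cons.IH
  show ?case by (simp add: pmf_pair prod.lessThan_Suc_shift del: prod.lessThan_Suc)
qed simp

lemma length_seq_pmf: "is \<in> set_pmf (seq_pmf p js) \<Longrightarrow> length is = length js"
  by (induction js arbitrary: "is") auto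

lemma seq_pmf_append:
  "seq_pmf p (js @ js') = bind_pmf (seq_pmf p js) (\<lambda>is. map_pmf (\<lambda>is'. is @ is') (seq_pmf p js'))"
proof (induction js)
  case Nil
  show ?case by (simp add: bind_return_pmf) (simp add: map_pmf_def bind_return_pmf')
next
  case (Cons j js)
  show ?case
    by (simp add: Cons pair_pmf_def map_bind_pmf bind_assoc_pmf bind_map_pmf bind_return_pmf map_pmf_comp map_pmf_def[symmetric])
       (simp add: map_pmf_def bind_assoc_pmf bind_return_pmf)
qed

lemma measure_seq_pmf_all: "measure (seq_pmf p js) {is. \<forall>i\<in>set is. i \<in> C} = (\<Prod>j\<leftarrow>js. measure (p j) C)"
proof (induction js)
  case (Cons j js)
  let ?B = "{is. \<forall>i\<in>set is. i \<in> C}"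
  have "measure (seq_pmf p (j # js)) ?B = measure (pair_pmf (p j) (seq_pmf p js)) ((\<lambda>(i, is). i # is) -` ?B)"
    by simp
  also have "(\<lambda>(i, is). i # is) -` ?B = C \<times> ?B" by auto
  also have "measure (pair_pmf (p j) (seq_pmf p js)) (C \<times> ?B) = measure (p j) C * measure (seq_pmf p js) ?B"
  proof -
    have "emeasure (pair_pmf (p j) (seq_pmf p js)) (C \<times> ?B)
       = (\<integral>\<^sup>+i. \<integral>\<^sup>+is. indicator C i * indicator ?B is \<partial>seq_pmf p js \<partial>p j)"
      by (subst nn_integral_indicator[symmetric], simp, subst nn_integral_pair_pmf')
         (auto simp: indicator_def intro!: nn_integral_cong)
    also have "\<dots> = emeasure (p j) C * emeasure (seq_pmf p js) ?B"
      by (simp add: nn_integral_cmult nn_integral_multc)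
    finally show ?thesis by (simp add: measure_pmf.emeasure_eq_measure ennreal_mult[symmetric])
  qed
  finally show ?case by (simp add: Cons)
qed simp

text \<open>\<open>js1\<close>, \<open>js2\<close> and \<open>js3\<close> are the states before, in
  and after the block. Once the draws before the block are fixed, the content is a fixed set, which
  the independent draws of the block all hit with the product probability. A bound valid for every
  content survives averaging over the past.\<close>

lemma seq_pmf_block:
  fixes p :: "'s \<Rightarrow> 'b pmf" and Cont :: "'b list \<Rightarrow> 'b set"
  assumes bound: "\<And>C. C \<in> range Cont \<Longrightarrow> b \<le> 1 - (\<Prod>j\<leftarrow>js2. measure (p j) C)"
  shows "ennreal b \<le> emeasure (seq_pmf p (js1 @ js2 @ js3))
    {is. \<exists>l. length js1 \<le> l \<and> l < length js1 + length js2 \<and> is ! l \<notin> Cont (take (length js1) is)}"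
    (is "_ \<le> emeasure _ ?A")
proof -
  have inner: "ennreal b \<le> emeasure (map_pmf (\<lambda>is'. is @ is') (seq_pmf p (js2 @ js3))) ?A" if len: "length is = length js1" for "is"
  proof -
    let ?C = "Cont is"
    let ?B = "{is'. \<exists>l<length js2. is' ! l \<notin> ?C}"
    have "emeasure (map_pmf (\<lambda>is'. is @ is') (seq_pmf p (js2 @ js3))) ?A = emeasure (seq_pmf p (js2 @ js3)) ?B"
    proof -
      have "(\<lambda>is'. is @ is') -` ?A = ?B"
      proof (intro set_eqI iffI)
        fix is' assume "is' \<in> (\<lambda>is'. is @ is') -` ?A"
        then obtain l where l: "length js1 \<le> l" "l < length js1 + length js2" "(is @ is') ! l \<notin> ?C"
          using len by auto
        then have "is' ! (l - length js1) \<notin> ?C" using len by (simp add: nth_append)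
        with l show "is' \<in> ?B" by (intro CollectI exI[of _ "l - length js1"]) auto
      next
        fix is' assume "is' \<in> ?B"
        then obtain l where "l < length js2" "is' ! l \<notin> ?C" by auto
        then show "is' \<in> (\<lambda>is'. is @ is') -` ?A"
          using len by (intro vimageI2 CollectI exI[of _ "length js1 + l"]) (simp add: nth_append)
      qed
      then show ?thesis by simp
    qed
    also have "\<dots> = (\<integral>\<^sup>+a. emeasure (map_pmf (\<lambda>is'. a @ is') (seq_pmf p js3)) ?B \<partial>seq_pmf p js2)"
      by (simp only: seq_pmf_append emeasure_bind_pmf)
    also have "\<dots> \<ge> (\<integral>\<^sup>+a. indicator (- {is. \<forall>i\<in>set is. i \<in> ?C}) a \<partial>seq_pmf p js2)"
    proof (intro nn_integral_mono_AE AE_pmfI)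
      fix a assume "a \<in> set_pmf (seq_pmf p js2)"
      then have la: "length a = length js2" by (rule length_seq_pmf)
      show "indicator (- {is. \<forall>i\<in>set is. i \<in> ?C}) a \<le> emeasure (map_pmf (\<lambda>is'. a @ is') (seq_pmf p js3)) ?B"
      proof (cases "\<forall>i\<in>set a. i \<in> ?C")
        case False
        then obtain l where "l < length a" "a ! l \<notin> ?C" by (auto simp: in_set_conv_nth)
        then have "(\<lambda>is'. a @ is') -` ?B = UNIV" using la by (auto simp: nth_append intro!: exI[of _ l])
        then show ?thesis by (simp add: indicator_def)
      qed simp
    qed
    also have "(\<integral>\<^sup>+a. indicator (- {is. \<forall>i\<in>set is. i \<in> ?C}) a \<partial>seq_pmf p js2)
        = ennreal (measure (seq_pmf p js2) (- {is. \<forall>i\<in>set is. i \<in> ?C}))"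
      by (simp add: measure_pmf.emeasure_eq_measure)
    also have "measure (seq_pmf p js2) (- {is. \<forall>i\<in>set is. i \<in> ?C}) = 1 - (\<Prod>j\<leftarrow>js2. measure (p j) ?C)"
      using measure_pmf.prob_compl[of "{is. \<forall>i\<in>set is. i \<in> ?C}" "seq_pmf p js2"] 
      by (simp add: measure_seq_pmf_all Compl_eq_Diff_UNIV)
    finally have "ennreal (1 - (\<Prod>j\<leftarrow>js2. measure (p j) ?C)) \<le> emeasure (map_pmf (\<lambda>is'. is @ is') (seq_pmf p (js2 @ js3))) ?A" .
    with bound[of ?C] show ?thesis by (meson ennreal_leI order_trans rangeI)
  qed
  have "ennreal b = (\<integral>\<^sup>+is. ennreal b \<partial>seq_pmf p js1)" by (simp add: measure_pmf.emeasure_space_1[simplified])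
  also have "\<dots> \<le> (\<integral>\<^sup>+is. emeasure (map_pmf (\<lambda>is'. is @ is') (seq_pmf p (js2 @ js3))) ?A \<partial>seq_pmf p js1)"
    by (intro nn_integral_mono_AE AE_pmfI inner length_seq_pmf)
  also have "\<dots> = emeasure (seq_pmf p (js1 @ js2 @ js3)) ?A" by (simp only: seq_pmf_append emeasure_bind_pmf)
  finally show ?thesis .
qed

lemma emeasure_seq_pmf_last:
  fixes p :: "'s \<Rightarrow> 'b pmf"
  shows "emeasure (seq_pmf p (js @ [j])) {is. last is \<in> C} = emeasure (p j) C"
proof -
  have "emeasure (seq_pmf p (js @ [j])) {is. last is \<in> C} = (\<integral>\<^sup>+a. emeasure (p j) C \<partial>seq_pmf p js)"
  proof -
    have "(\<lambda>x. a @ [x]) -` {is. last is \<in> C} = C" for a :: "'b list" by auto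
    moreover have "map_pmf (\<lambda>is'. a @ is') (seq_pmf p [j]) = map_pmf (\<lambda>x. a @ [x]) (p j)" for a
      by (simp add: pair_return_pmf2 map_pmf_comp)
    ultimately show ?thesis by (simp only: seq_pmf_append emeasure_bind_pmf emeasure_map_pmf)
  qed
  also have "\<dots> = emeasure (p j) C" by (simp add: measure_pmf.emeasure_space_1[simplified])
  finally show ?thesis .
qed

section \<open>Quantitative bounds on the probability that a block has no miss\<close>

text \<open>A Bonferroni-type bound with a crude quadratic remainder, whose growth in each step
  dominates the mixed terms. Nonnegativity of product and sum is carried along for the
  induction.\<close>

lemma prod_one_minus_le:
  fixes x :: "'b \<Rightarrow> real"
  assumes "\<And>j. j \<in> set js \<Longrightarrow> 0 \<le> x j \<and> x j \<le> 1"
  shows "0 \<le> (\<Prod>j\<leftarrow>js. 1 - x j) \<and> (\<Prod>j\<leftarrow>js. 1 - x j) \<le> 1 - (\<Sum>j\<leftarrow>js. x j) + (\<Sum>j\<leftarrow>js. x j)\<^sup>2 \<and> 0 \<le> (\<Sum>j\<leftarrow>js. x j)"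
  using assms
proof (induction js)
  case (Cons j js)
  let ?S = "\<Sum>j\<leftarrow>js. x j" and ?P = "\<Prod>j\<leftarrow>js. 1 - x j"
  have IH: "0 \<le> ?P" "?P \<le> 1 - ?S + ?S\<^sup>2" "0 \<le> ?S" and x: "0 \<le> x j" "x j \<le> 1" using Cons by auto
  have "(1 - x j) * ?P \<le> (1 - x j) * (1 - ?S + ?S\<^sup>2)" using IH x by (intro mult_left_mono) auto
  also have "\<dots> = 1 - (x j + ?S) + (x j + ?S)\<^sup>2 - (x j * ?S + x j * ?S\<^sup>2 + (x j)\<^sup>2)"
    by (simp add: power2_eq_square algebra_simps)
  also have "\<dots> \<le> 1 - (x j + ?S) + (x j + ?S)\<^sup>2"
  proof -
    have "0 \<le> x j * ?S + x j * ?S\<^sup>2 + (x j)\<^sup>2" using IH x by (intro add_nonneg_nonneg mult_nonneg_nonneg) auto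
    then show ?thesis by linarith
  qed
  finally show ?case using IH x by simp
qed simp

text \<open>If \<open>g\<close> is large, scaling it down by \<open>\<theta> = \<delta> / (\<Sum>r. w r * g r)\<close> keeps the second-order error of order \<open>\<delta>\<^sup>2\<close>.\<close>
lemma miss_bound:
  fixes g w :: "nat \<Rightarrow> real"
  assumes S: "finite S" "set js \<subseteq> S" and g: "\<And>r. r \<in> S \<Longrightarrow> 0 \<le> g r \<and> g r \<le> 1" and w: "\<And>r. r \<in> S \<Longrightarrow> p \<le> w r" and p: "p > 0"
    and \<delta>: "\<delta> > 0" "\<delta> \<le> (\<Sum>r\<in>S. w r * g r)" and c: "c > 0" and L: "L > 0"
  shows "L * \<delta> - (\<delta> / p) * (\<Sum>r\<in>S. c + (real (count_list js r) - w r * L)\<^sup>2 / c) - (\<delta> / p)\<^sup>2 * (real (length js))\<^sup>2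
     \<le> 1 - (\<Prod>j\<leftarrow>js. 1 - g j)"
proof -
  define \<theta> where "\<theta> = \<delta> / (\<Sum>r\<in>S. w r * g r)"
  have pos: "(\<Sum>r\<in>S. w r * g r) > 0" using \<delta> by linarith
  have \<theta>: "0 < \<theta>" "\<theta> \<le> 1" using \<delta> pos by (auto simp: \<theta>_def)
  have \<theta>g: "0 \<le> \<theta> * g r" "\<theta> * g r \<le> 1" "\<theta> * g r \<le> \<delta> / p" if r: "r \<in> S" for r
  proof -
    show "0 \<le> \<theta> * g r" using \<theta> g[OF r] by simp
    show "\<theta> * g r \<le> 1" using \<theta> g[OF r] by (simp add: mult_le_one)
    \<comment> \<open>Every weight is at least \<open>p\<close>, so the weighted mean controls each
      single miss probability.\<close>
    have "p * g r \<le> w r * g r" using w[OF r] g[OF r] by (intro mult_right_mono) auto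
    also have "\<dots> \<le> (\<Sum>r\<in>S. w r * g r)"
    proof (rule member_le_sum[OF r _ S(1)])
      fix x assume "x \<in> S - {r}"
      then show "0 \<le> w x * g x" using w[of x] g[of x] p by auto
    qed
    finally have "g r \<le> (\<Sum>r\<in>S. w r * g r) / p" using p by (simp add: field_simps)
    then have "\<theta> * g r \<le> \<theta> * ((\<Sum>r\<in>S. w r * g r) / p)" using \<theta> by (intro mult_left_mono) auto
    also have "\<dots> = \<delta> / p" using pos by (simp add: \<theta>_def)
    finally show "\<theta> * g r \<le> \<delta> / p" .
  qed
  define s where "s = (\<Sum>j\<leftarrow>js. \<theta> * g j)"
  \<comment> \<open>Shrinking the miss probabilities only raises the probability of no miss, so a
    lower bound for the scaled ones transfers back.\<close>
  have prod: "(\<Prod>j\<leftarrow>js. 1 - g j) \<le> (\<Prod>j\<leftarrow>js. 1 - \<theta> * g j) \<and> 0 \<le> (\<Prod>j\<leftarrow>js. 1 - g j)"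
    using S(2)
  proof (induction js)
    case (Cons j js)
    then have j: "j \<in> S" by simp
    have "\<theta> * g j \<le> g j" using \<theta> g[OF j] by (intro mult_left_le_one_le) auto
    with Cons g[OF j] \<theta>g[OF j] show ?case by (auto intro!: mult_mono)
  qed simp
  have "(\<Prod>j\<leftarrow>js. 1 - \<theta> * g j) \<le> 1 - s + s\<^sup>2" and s0: "0 \<le> s"
    using prod_one_minus_le[of js "\<lambda>j. \<theta> * g j"] \<theta>g S(2) unfolding s_def by blast+
  with prod have 1: "s - s\<^sup>2 \<le> 1 - (\<Prod>j\<leftarrow>js. 1 - g j)" by linarith
  have "s \<le> real (length js) * (\<delta> / p)"
    unfolding s_def using S(2)
  proof (induction js)
    case (Cons j js)
    then have "\<theta> * g j + (\<Sum>j\<leftarrow>js. \<theta> * g j) \<le> \<delta> / p + real (length js) * (\<delta> / p)"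
      using \<theta>g(3)[of j] by (intro add_mono) auto
    then show ?case by (simp add: distrib_right add_divide_distrib)
  qed simp
  from power_mono[OF this s0, of 2] have 2: "s\<^sup>2 \<le> (\<delta> / p)\<^sup>2 * (real (length js))\<^sup>2" by (simp only: power_mult_distrib mult.commute)
  have sum: "(\<Sum>j\<leftarrow>js. h j) = (\<Sum>r\<in>S. real (count_list js r) * h r)" for h :: "nat \<Rightarrow> real"
    using S
  proof (induction js)
    case (Cons j js)
    have "(\<Sum>r\<in>S. real (count_list (j # js) r) * h r) = (\<Sum>r\<in>S. (if r = j then h r else 0) + real (count_list js r) * h r)"
      by (intro sum.cong) (auto simp: distrib_right)
    also have "\<dots> = h j + (\<Sum>r\<in>S. real (count_list js r) * h r)" using Cons.prems by (simp add: sum.distrib)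
    finally show ?case using Cons by simp
  qed simp
  \<comment> \<open>By the choice of \<open>\<theta>\<close> the exact frequencies
    \<open>w r * L\<close> would give the sum \<open>L * \<delta>\<close>; what remains is the
    deviation of the counts from these frequencies.\<close>
  have "L * \<delta> - s = (\<Sum>r\<in>S. w r * L * (\<theta> * g r)) - (\<Sum>r\<in>S. real (count_list js r) * (\<theta> * g r))"
  proof -
    have "(\<Sum>r\<in>S. w r * L * (\<theta> * g r)) = L * (\<theta> * (\<Sum>r\<in>S. w r * g r))"
      by (simp add: sum_distrib_left mult_ac)
    also have "\<theta> * (\<Sum>r\<in>S. w r * g r) = \<delta>" using pos by (simp add: \<theta>_def)
    finally show ?thesis by (simp add: s_def sum)
  qed
  also have "\<dots> = (\<Sum>r\<in>S. (w r * L - real (count_list js r)) * (\<theta> * g r))"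
    by (simp add: sum_subtractf left_diff_distrib)
  also have "\<dots> \<le> (\<Sum>r\<in>S. (c + (real (count_list js r) - w r * L)\<^sup>2 / c) * (\<delta> / p))"
  proof (rule sum_mono)
    fix r assume r: "r \<in> S"
    define y where "y = w r * L - real (count_list js r)"
    \<comment> \<open>\<open>y \<le> c + y\<^sup>2 / c\<close> trades a deviation for its square,
      whose mean is under control; \<open>c\<close> is left free to be balanced later.\<close>
    have "2 * y * c \<le> y\<^sup>2 + c\<^sup>2" by (rule sum_squares_bound)
    moreover have "0 \<le> y\<^sup>2" "0 \<le> c\<^sup>2" by simp_all
    ultimately have "y * c \<le> y\<^sup>2 + c\<^sup>2" by linarith
    then have "y \<le> (y\<^sup>2 + c\<^sup>2) / c" using c by (simp add: pos_le_divide_eq)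
    also have "\<dots> = c + y\<^sup>2 / c" using c by (simp add: add_divide_distrib power2_eq_square)
    also have "y\<^sup>2 = (real (count_list js r) - w r * L)\<^sup>2" unfolding y_def by (rule power2_commute)
    finally have "w r * L - real (count_list js r) \<le> c + (real (count_list js r) - w r * L)\<^sup>2 / c" unfolding y_def .
    then have "(w r * L - real (count_list js r)) * (\<theta> * g r) \<le> (c + (real (count_list js r) - w r * L)\<^sup>2 / c) * (\<theta> * g r)"
      using \<theta>g(1)[OF r] by (rule mult_right_mono)
    also have "\<dots> \<le> (c + (real (count_list js r) - w r * L)\<^sup>2 / c) * (\<delta> / p)"
      using \<theta>g(3)[OF r] c by (intro mult_left_mono) auto
    finally show "(w r * L - real (count_list js r)) * (\<theta> * g r) \<le> (c + (real (count_list js r) - w r * L)\<^sup>2 / c) * (\<delta> / p)" .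
  qed
  also have "\<dots> = (\<delta> / p) * (\<Sum>r\<in>S. c + (real (count_list js r) - w r * L)\<^sup>2 / c)"
    by (simp add: sum_distrib_left mult.commute)
  finally show ?thesis using 1 2 by linarith
qed

section \<open>Cache contents along a request sequence\<close>

lemma cache_hist_cong: "(\<And>l. 1 \<le> l \<Longrightarrow> l < n \<Longrightarrow> r l = r' l) \<Longrightarrow> cache_hist C0 f r n = cache_hist C0 f r' n"
proof (induction C0 f r n rule: cache_hist.induct)
  case (3 C0 f r n)
  have "cache_hist C0 f r (Suc n) = cache_hist C0 f r' (Suc n)" using 3 by simp
  moreover have "map r [1..<Suc (Suc n)] = map r' [1..<Suc (Suc n)]" using 3(2) by (intro map_cong) auto
  moreover have "r (Suc n) = r' (Suc n)" using 3(2) by simp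
  ultimately show ?case by (simp only: cache_hist.simps Let_def)
qed simp_all

lemma content_cong: "(\<And>l. 1 \<le> l \<Longrightarrow> l < n \<Longrightarrow> r l = r' l) \<Longrightarrow> content C0 f r n = content C0 f r' n"
  unfolding content_def using cache_hist_cong by metis

lemma content_hit: "r (Suc n) \<in> content C0 f r (Suc n) \<Longrightarrow> content C0 f r (Suc (Suc n)) = content C0 f r (Suc n)"
  by (simp add: content_def Let_def)

lemma content_1 [simp]: "content C0 f r 0 = C0" "content C0 f r (Suc 0) = C0"
  by (simp_all add: content_def)

lemma content_ok:
  assumes "(C0, f) \<in> policies s x"
  shows "cache_ok s x (content C0 f r n)"
proof (induction n)
  case (Suc n)
  then show ?case using assms by (cases n) (auto simp: content_def policies_def Let_def)
qed (use assms in \<open>auto simp: policies_def\<close>)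

lemma content_constant: 
  assumes "\<And>rs cs. f rs cs = C0" shows "content C0 f r n = C0"
proof (induction n)
  case (Suc n)
  then show ?case using assms by (cases n) (auto simp: content_def Let_def)
qed simp

lemma content_last: "content C0 (\<lambda>rs cs. last cs) r n = C0"
proof (induction n)
  case (Suc n)
  then show ?case by (cases n) (auto simp: content_def Let_def)
qed simp

text \<open>The content does not change before the first fault, so the first miss of the initial content is a fault.\<close>
lemma first_miss_is_fault:
  assumes "k < l" "r l \<notin> content C0 f r (Suc k)"
  shows "\<exists>n. k < n \<and> n \<le> l \<and> r n \<notin> content C0 f r n"
proof (rule ccontr)
  assume no: "\<not> ?thesis"
  have "content C0 f r (Suc (k + i)) = content C0 f r (Suc k)" if "k + i < l" for i
    using that
  proof (induction i)
    case (Suc i)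
    have "r (Suc (k + i)) \<in> content C0 f r (Suc (k + i))" using no Suc.prems by auto
    from content_hit[OF this] Suc show ?case by simp
  qed simp
  from this[of "l - Suc k"] assms no show False by auto
qed

section \<open>Conditional law of the requests given the environment\<close>

locale request_sampling = poisson_sampling M Ms J T Q P \<tau>
  for M :: "'a measure" and Ms J T Q P \<tau> +
  fixes R :: "nat \<Rightarrow> 'a \<Rightarrow> nat" and q :: "nat \<Rightarrow> nat \<Rightarrow> real"
  assumes R_meas [measurable]: "\<And>n. R n \<in> measurable M (count_space UNIV)"
    and q_nonneg: "\<And>r i. r \<in> {1..Ms} \<Longrightarrow> 0 \<le> q r i"
    and q_sums: "\<And>r. r \<in> {1..Ms} \<Longrightarrow> (\<lambda>i. q r (Suc i)) sums 1"
    and request_law: "\<And>n i. n \<ge> 1 \<Longrightarrow> (\<And>l. l \<in> {1..n} \<Longrightarrow> 1 \<le> i l) \<Longrightarrow>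
        (AE \<omega> in M. real_cond_exp M (req_filt M J \<tau> n)
            (indicator {\<omega> \<in> space M. \<forall>l \<in> {1..n}. R l \<omega> = i l}) \<omega>
          = (\<Prod>l = 1..n. q (J (\<tau> (int l) \<omega>) \<omega>) (i l)))"
begin

abbreviation "H \<equiv> req_filt M J \<tau>"

lemma gen_H: "({\<tau> (int l) -` B \<inter> space M | l B. 1 \<le> l \<and> l \<le> n \<and> B \<in> sets borel} \<union>
      {(\<lambda>\<omega>. J (min t (\<tau> (int n) \<omega>)) \<omega>) -` A \<inter> space M | t A. 0 \<le> t}) \<subseteq> sets M"
proof -
  have "(\<lambda>\<omega>. J (min t (\<tau> (int n) \<omega>)) \<omega>) \<in> measurable M (count_space UNIV)" for t by measurable
  from measurable_sets[OF this] show ?thesis using measurable_sets[OF tau_meas] by auto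
qed

lemma sets_H: "sets (H n) = sigma_sets (space M) ({\<tau> (int l) -` B \<inter> space M | l B. 1 \<le> l \<and> l \<le> n \<and> B \<in> sets borel} \<union>
      {(\<lambda>\<omega>. J (min t (\<tau> (int n) \<omega>)) \<omega>) -` A \<inter> space M | t A. 0 \<le> t})"
  unfolding req_filt_def by (rule sets_measure_of) (use gen_H sets.space_closed in blast)

lemma space_H [simp]: "space (H n) = space M"
  unfolding req_filt_def by (rule space_measure_of) (use gen_H sets.space_closed in blast)

lemma subalg_H: "subalgebra M (H n)"
  unfolding subalgebra_def sets_H using gen_H by (auto intro!: sets.sigma_sets_subset)

lemma H_in_M: "G \<in> sets (H n) \<Longrightarrow> G \<in> sets M"
  using subalg_H by (auto simp: subalgebra_def)

sublocale Hsub: finite_measure_subalgebra M "H n" for n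
  by unfold_locales (rule subalg_H)

lemma tau_H: "1 \<le> l \<Longrightarrow> l \<le> n \<Longrightarrow> \<tau> (int l) \<in> borel_measurable (H n)"
  by (rule measurableI) (auto simp: sets_H intro!: sigma_sets.Basic)

text \<open>Documents start at 1 and the sums to 1 leave out \<open>q r 0\<close>, so the mass at 0
  is set to 0. The law outside the state space is arbitrary and makes the function total.\<close>

definition doc_pmf :: "nat \<Rightarrow> nat pmf" where
  "doc_pmf r = (if r \<in> {1..Ms} then embed_pmf (\<lambda>i. if i = 0 then 0 else q r i) else return_pmf 1)"

lemma pmf_doc_pmf: 
  assumes r: "r \<in> {1..Ms}"
  shows "pmf (doc_pmf r) i = (if i = 0 then 0 else q r i)"
proof -
  let ?f = "\<lambda>i. if i = 0 then 0 else q r i"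
  have nn: "0 \<le> ?f i" for i using q_nonneg[OF r] by simp
  have "(\<lambda>i. ?f (Suc i)) sums 1" using q_sums[OF r] by simp
  from sums_Suc[OF this] have s: "?f sums 1" by simp
  have "(\<integral>\<^sup>+i. ennreal (?f i) \<partial>count_space UNIV) = (\<Sum>i. ennreal (?f i))" by (rule nn_integral_count_space_nat)
  also have "\<dots> = ennreal 1" by (rule suminf_ennreal_eq[OF nn s])
  finally have "(\<integral>\<^sup>+i. ennreal (?f i) \<partial>count_space UNIV) = 1" by simp
  from pmf_embed_pmf[OF nn this] show ?thesis using r by (simp add: doc_pmf_def)
qed

definition states :: "nat \<Rightarrow> 'a \<Rightarrow> nat list" where "states n \<omega> = map (\<lambda>l. J (\<tau> (int l) \<omega>) \<omega>) [1..<Suc n]"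
definition reqs :: "nat \<Rightarrow> 'a \<Rightarrow> nat list" where "reqs n \<omega> = map (\<lambda>l. R l \<omega>) [1..<Suc n]"

lemma length_states [simp]: "length (states n \<omega>) = n" and length_reqs [simp]: "length (reqs n \<omega>) = n"
  by (simp_all add: states_def reqs_def)

lemma nth_states: "k < n \<Longrightarrow> states n \<omega> ! k = J (\<tau> (int (Suc k)) \<omega>) \<omega>"
  and nth_reqs: "k < n \<Longrightarrow> reqs n \<omega> ! k = R (Suc k) \<omega>"
  by (simp_all add: states_def reqs_def nth_append del: upt_Suc)

lemma measurable_list_count_space:
  assumes len: "\<And>\<omega>. length (xs \<omega>) = n" and nth: "\<And>k. k < n \<Longrightarrow> (\<lambda>\<omega>. xs \<omega> ! k) \<in> measurable N (count_space (UNIV :: nat set))"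
  shows "xs \<in> measurable N (count_space UNIV)"
  unfolding measurable_count_space_eq2_countable
proof (intro conjI ballI)
  fix ys :: "nat list"
  have "xs -` {ys} \<inter> space N = (if length ys = n then {\<omega> \<in> space N. \<forall>k\<in>{..<n}. xs \<omega> ! k = ys ! k} else {})"
    using len by (auto simp: list_eq_iff_nth_eq)
  moreover have "{\<omega> \<in> space N. \<forall>k\<in>{..<n}. xs \<omega> ! k = ys ! k} \<in> sets N"
  proof (rule sets.sets_Collect_finite_All)
    fix k assume "k \<in> {..<n}"
    then have "(\<lambda>\<omega>. xs \<omega> ! k) -` {ys ! k} \<inter> space N \<in> sets N" using nth by (intro measurable_sets[of _ _ "count_space UNIV"]) auto
    then show "{\<omega> \<in> space N. xs \<omega> ! k = ys ! k} \<in> sets N" by (simp add: vimage_def Int_def conj_commute)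
  qed auto
  ultimately show "xs -` {ys} \<inter> space N \<in> sets N" by simp
qed auto

lemma states_measurable [measurable]: "states n \<in> measurable M (count_space UNIV)"
  by (rule measurable_list_count_space[of _ n]) (simp_all add: nth_states)

lemma reqs_measurable [measurable]: "reqs n \<in> measurable M (count_space UNIV)"
  by (rule measurable_list_count_space[of _ n]) (simp_all add: nth_reqs)

lemma J_range: "AE \<omega> in M. \<forall>t. J t \<omega> \<in> {1..Ms}"
  using path by eventually_elim (elim conjE)

text \<open>For lists of length \<open>n\<close> with entries at least 1 the request law gives the
  conditional probability exactly. For all other lists the left side vanishes, because
  \<open>seq_pmf\<close> gives them no mass.\<close>

lemma request_law_list:
  assumes n: "n \<ge> 1" and G: "G \<in> sets (H n)"
  shows "(\<integral>\<^sup>+\<omega>. indicator G \<omega> * ennreal (pmf (seq_pmf doc_pmf (states n \<omega>)) ys) \<partial>M) \<le> emeasure M (G \<inter> {\<omega> \<in> space M. reqs n \<omega> = ys})"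
proof (cases "length ys = n \<and> (\<forall>i\<in>set ys. 1 \<le> i)")
  case False
  have "AE \<omega> in M. ennreal (pmf (seq_pmf doc_pmf (states n \<omega>)) ys) = 0"
    using J_range
  proof eventually_elim
    case (elim \<omega>)
    show ?case
    proof (cases "length ys = n")
      case True
      with False obtain k where k: "k < n" "ys ! k = 0" by (auto simp: in_set_conv_nth)
      have "pmf (doc_pmf (states n \<omega> ! k)) (ys ! k) = 0" using k elim by (subst pmf_doc_pmf) (simp_all add: nth_states)
      with k have "\<exists>k\<in>{..<n}. pmf (doc_pmf (states n \<omega> ! k)) (ys ! k) = 0" by blast
      then have "(\<Prod>k<n. pmf (doc_pmf (states n \<omega> ! k)) (ys ! k)) = 0" by (rule prod_zero[OF finite_lessThan])
      moreover have "pmf (seq_pmf doc_pmf (states n \<omega>)) ys = (\<Prod>k<n. pmf (doc_pmf (states n \<omega> ! k)) (ys ! k))"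
        using True by (simp add: pmf_seq_pmf)
      ultimately show ?thesis by (simp only: ennreal_0)
    next
      case False
      then have "ys \<notin> set_pmf (seq_pmf doc_pmf (states n \<omega>))" using length_seq_pmf[of ys doc_pmf "states n \<omega>"] by auto
      then show ?thesis by (simp add: set_pmf_iff)
    qed
  qed
  then have "(\<integral>\<^sup>+\<omega>. indicator G \<omega> * ennreal (pmf (seq_pmf doc_pmf (states n \<omega>)) ys) \<partial>M) = (\<integral>\<^sup>+\<omega>. 0 \<partial>M)"
    by (intro nn_integral_cong_AE) (auto elim!: eventually_mono)
  then show ?thesis by simp
next
  case True
  have [measurable]: "G \<in> sets M" using G H_in_M by auto
  define i where "i l = ys ! (l - 1)" for l
  have i: "1 \<le> i l" if "l \<in> {1..n}" for l using True that by (auto simp: i_def)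
  let ?E = "{\<omega> \<in> space M. \<forall>l \<in> {1..n}. R l \<omega> = i l}"
  have E: "?E = {\<omega> \<in> space M. reqs n \<omega> = ys}"
  proof -
    have "(\<forall>l \<in> {1..n}. R l \<omega> = i l) \<longleftrightarrow> reqs n \<omega> = ys" for \<omega>
    proof
      assume *: "\<forall>l \<in> {1..n}. R l \<omega> = i l"
      show "reqs n \<omega> = ys" by (rule nth_equalityI) (use True * in \<open>auto simp: nth_reqs i_def\<close>)
    next
      assume *: "reqs n \<omega> = ys"
      show "\<forall>l \<in> {1..n}. R l \<omega> = i l"
      proof
        fix l assume "l \<in> {1..n}"
        then show "R l \<omega> = i l" unfolding i_def *[symmetric] by (subst nth_reqs) auto
      qed
    qed
    then show ?thesis by auto
  qed
  have [measurable]: "?E \<in> sets M" unfolding E by measurable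
  have law: "AE \<omega> in M. real_cond_exp M (H n) (indicator ?E) \<omega> = (\<Prod>l = 1..n. q (J (\<tau> (int l) \<omega>) \<omega>) (i l))"
    by (rule request_law[OF n i])
  have pmf: "AE \<omega> in M. pmf (seq_pmf doc_pmf (states n \<omega>)) ys = real_cond_exp M (H n) (indicator ?E) \<omega>"
    using J_range law
  proof eventually_elim
    case (elim \<omega>)
    have "pmf (seq_pmf doc_pmf (states n \<omega>)) ys = (\<Prod>k<n. pmf (doc_pmf (states n \<omega> ! k)) (ys ! k))"
      using True by (simp add: pmf_seq_pmf)
    also have "\<dots> = (\<Prod>k<n. q (J (\<tau> (int (Suc k)) \<omega>) \<omega>) (i (Suc k)))"
    proof (intro prod.cong refl)
      fix k assume k: "k \<in> {..<n}"
      with True have "ys ! k \<in> set ys" by simp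
      with True have "ys ! k \<noteq> 0" by fastforce
      with k elim(1) show "pmf (doc_pmf (states n \<omega> ! k)) (ys ! k) = q (J (\<tau> (int (Suc k)) \<omega>) \<omega>) (i (Suc k))"
        by (subst pmf_doc_pmf) (auto simp: nth_states i_def)
    qed
    also have "\<dots> = (\<Prod>l = 1..n. q (J (\<tau> (int l) \<omega>) \<omega>) (i l))"
      by (rule prod.reindex_bij_witness[of _ "\<lambda>l. l - 1" Suc]) auto
    finally show ?case using elim(2) by simp
  qed
  have "(\<integral>\<omega>. indicator G \<omega> * real_cond_exp M (H n) (indicator ?E) \<omega> \<partial>M) = (\<integral>\<omega>. indicator G \<omega> * indicator ?E \<omega> \<partial>M)"
    and int: "integrable M (\<lambda>\<omega>. indicator G \<omega> * real_cond_exp M (H n) (indicator ?E) \<omega>)"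
    by (rule Hsub.real_cond_exp_intg; use G in \<open>auto simp flip: indicator_inter_arith intro!: integrable_real_indicator simp: less_top[symmetric]\<close>)+
  then have eq: "(\<integral>\<omega>. indicator G \<omega> * real_cond_exp M (H n) (indicator ?E) \<omega> \<partial>M) = measure M (G \<inter> ?E)"
    by (simp flip: indicator_inter_arith)
  have "(\<integral>\<^sup>+\<omega>. indicator G \<omega> * ennreal (pmf (seq_pmf doc_pmf (states n \<omega>)) ys) \<partial>M)
     = (\<integral>\<^sup>+\<omega>. ennreal (indicator G \<omega> * real_cond_exp M (H n) (indicator ?E) \<omega>) \<partial>M)"
    using pmf by (intro nn_integral_cong_AE, eventually_elim) (auto simp: indicator_def)
  also have "\<dots> = ennreal (measure M (G \<inter> ?E))"
    unfolding eq[symmetric]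
  proof (rule nn_integral_eq_integral[OF int])
    show "AE \<omega> in M. 0 \<le> indicator G \<omega> * real_cond_exp M (H n) (indicator ?E) \<omega>"
      using pmf by eventually_elim (metis indicator_pos_le mult_nonneg_nonneg pmf_nonneg)
  qed
  finally show ?thesis unfolding E by (simp add: emeasure_eq_measure)
qed

text \<open>Only this inequality is needed: applied to complements it also bounds probabilities from above.\<close>
lemma request_law_set:
  assumes n: "n \<ge> 1" and G: "G \<in> sets (H n)"
  shows "(\<integral>\<^sup>+\<omega>. indicator G \<omega> * emeasure (seq_pmf doc_pmf (states n \<omega>)) A \<partial>M) \<le> emeasure M (G \<inter> {\<omega> \<in> space M. reqs n \<omega> \<in> A})"
proof -
  have [measurable]: "G \<in> sets M" using G H_in_M by auto
  have em: "emeasure (seq_pmf doc_pmf js) A = (\<integral>\<^sup>+ys. ennreal (pmf (seq_pmf doc_pmf js) ys) * indicator A ys \<partial>count_space UNIV)" for js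
    using nn_integral_measure_pmf[of "seq_pmf doc_pmf js" "indicator A"] by simp
  have "(\<integral>\<^sup>+\<omega>. indicator G \<omega> * emeasure (seq_pmf doc_pmf (states n \<omega>)) A \<partial>M)
     = (\<integral>\<^sup>+\<omega>. \<integral>\<^sup>+ys. indicator G \<omega> * ennreal (pmf (seq_pmf doc_pmf (states n \<omega>)) ys) * indicator A ys \<partial>count_space UNIV \<partial>M)"
    unfolding em by (intro nn_integral_cong) (simp add: nn_integral_cmult[symmetric] mult.assoc)
  also have "\<dots> = (\<integral>\<^sup>+ys. \<integral>\<^sup>+\<omega>. indicator G \<omega> * ennreal (pmf (seq_pmf doc_pmf (states n \<omega>)) ys) * indicator A ys \<partial>M \<partial>count_space UNIV)"
    by (rule nn_integral_count_space_nn_integral) auto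
  also have "\<dots> = (\<integral>\<^sup>+ys. (\<integral>\<^sup>+\<omega>. indicator G \<omega> * ennreal (pmf (seq_pmf doc_pmf (states n \<omega>)) ys) \<partial>M) * indicator A ys \<partial>count_space UNIV)"
    by (intro nn_integral_cong nn_integral_multc) measurable
  also have "\<dots> \<le> (\<integral>\<^sup>+ys. emeasure M (G \<inter> {\<omega> \<in> space M. reqs n \<omega> = ys}) * indicator A ys \<partial>count_space UNIV)"
    by (intro nn_integral_mono mult_right_mono request_law_list n G) simp
  also have "\<dots> = (\<integral>\<^sup>+ys. \<integral>\<^sup>+\<omega>. indicator (G \<inter> {\<omega> \<in> space M. reqs n \<omega> = ys}) \<omega> * indicator A ys \<partial>M \<partial>count_space UNIV)"
    by (intro nn_integral_cong) (simp add: nn_integral_multc)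
  also have "\<dots> = (\<integral>\<^sup>+\<omega>. \<integral>\<^sup>+ys. indicator (G \<inter> {\<omega> \<in> space M. reqs n \<omega> = ys}) \<omega> * indicator A ys \<partial>count_space UNIV \<partial>M)"
    by (rule nn_integral_count_space_nn_integral[symmetric]) auto
  also have "\<dots> = (\<integral>\<^sup>+\<omega>. indicator (G \<inter> {\<omega> \<in> space M. reqs n \<omega> \<in> A}) \<omega> \<partial>M)"
  proof (intro nn_integral_cong)
    fix \<omega> assume \<omega>: "\<omega> \<in> space M"
    have "(\<integral>\<^sup>+ys. indicator (G \<inter> {\<omega> \<in> space M. reqs n \<omega> = ys}) \<omega> * indicator A ys \<partial>count_space UNIV)
      = (\<integral>\<^sup>+ys. (indicator G \<omega> * indicator A (reqs n \<omega>)) * indicator {reqs n \<omega>} ys \<partial>count_space UNIV)"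
      using \<omega> by (intro nn_integral_cong) (auto simp: indicator_def)
    also have "\<dots> = indicator G \<omega> * indicator A (reqs n \<omega>)"
      by (subst nn_integral_cmult) (auto simp: emeasure_count_space_finite)
    also have "\<dots> = indicator (G \<inter> {\<omega> \<in> space M. reqs n \<omega> \<in> A}) \<omega>" using \<omega> by (auto simp: indicator_def)
    finally show "(\<integral>\<^sup>+ys. indicator (G \<inter> {\<omega> \<in> space M. reqs n \<omega> = ys}) \<omega> * indicator A ys \<partial>count_space UNIV)
      = indicator (G \<inter> {\<omega> \<in> space M. reqs n \<omega> \<in> A}) \<omega>" .
  qed
  also have "\<dots> = emeasure M (G \<inter> {\<omega> \<in> space M. reqs n \<omega> \<in> A})" by simp
  finally show ?thesis .
qed

end

section \<open>Faults in a time block\<close>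

lemma count_list_map_upt: "m \<le> n \<Longrightarrow> count_list (map f [m..<n]) r = card {l. m \<le> l \<and> l < n \<and> f l = r}"
proof (induction n rule: dec_induct)
  case (step n)
  have "{l. m \<le> l \<and> l < Suc n \<and> f l = r} = (if f n = r then insert n {l. m \<le> l \<and> l < n \<and> f l = r} else {l. m \<le> l \<and> l < n \<and> f l = r})"
    using step(1) by (auto simp: less_Suc_eq)
  moreover have "finite {l. m \<le> l \<and> l < n \<and> f l = r}" by (rule finite_subset[of _ "{..<n}"]) auto
  ultimately show ?case using step by simp
qed (auto intro!: card_0_eq[THEN iffD2, symmetric])

context request_sampling begin

definition Kc :: "real \<Rightarrow> 'a \<Rightarrow> nat" where "Kc b \<omega> = card {n::nat. 1 \<le> n \<and> \<tau> (int n) \<omega> \<le> b}"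

text \<open>Request times increase strictly and do not accumulate, so the indices of the requests in
  \<open>(0, b]\<close> form an initial segment, of length \<open>Kc b\<close>.\<close>

lemma request_enumeration: "AE \<omega> in M. \<forall>b\<ge>0. \<forall>n\<ge>1. \<tau> (int n) \<omega> \<le> b \<longleftrightarrow> n \<le> Kc b \<omega>"
  using tau_path finite_points
proof eventually_elim
  case (elim \<omega>)
  have mono: "\<And>m n. m < n \<Longrightarrow> \<tau> m \<omega> < \<tau> n \<omega>" and pos: "0 < \<tau> 1 \<omega>" using elim(1) by blast+
  show ?case
  proof (intro allI impI)
    fix b :: real and n :: nat assume b: "0 \<le> b" and n: "1 \<le> n"
    let ?S = "{n::nat. 1 \<le> n \<and> \<tau> (int n) \<omega> \<le> b}"
    have "int ` ?S \<subseteq> {n. 0 < \<tau> n \<omega> \<and> \<tau> n \<omega> \<le> b}"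
    proof
      fix i assume "i \<in> int ` ?S"
      then obtain m where m: "i = int m" "1 \<le> m" "\<tau> (int m) \<omega> \<le> b" by blast
      have "0 < \<tau> i \<omega>" using mono[of 1 i] pos m by (cases "m = 1") auto
      with m show "i \<in> {n. 0 < \<tau> n \<omega> \<and> \<tau> n \<omega> \<le> b}" by simp
    qed
    then have "finite (int ` ?S)" using elim(2)[rule_format, of 0 b] finite_subset by blast
    then have fin: "finite ?S" by (rule finite_imageD) simp
    have down: "m \<in> ?S" if "m' \<in> ?S" "1 \<le> m" "m \<le> m'" for m m'
      using that mono[of "int m" "int m'"] by (cases "m = m'") auto
    obtain k where k: "?S = {1..k}"
    proof (cases "?S = {}")
      case True
      then have "?S = {1..0}" by simp
      then show ?thesis by (rule that)
    next
      case False
      have "?S = {1..Max ?S}"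
      proof (intro equalityI subsetI)
        fix m assume "m \<in> ?S"
        then show "m \<in> {1..Max ?S}" using Max_ge[OF fin, of m] by simp
      next
        fix m assume "m \<in> {1..Max ?S}"
        then show "m \<in> ?S" using down[OF Max_in[OF fin False], of m] by simp
      qed
      then show ?thesis by (rule that)
    qed
    then have "Kc b \<omega> = k" by (simp add: Kc_def)
    moreover have "n \<in> ?S \<longleftrightarrow> n \<in> {1..k}" unfolding k ..
    ultimately show "\<tau> (int n) \<omega> \<le> b \<longleftrightarrow> n \<le> Kc b \<omega>" using n by simp
  qed
qed

text \<open>Transfers points with integer index to requests with natural index. The predicate
  \<open>A\<close> is arbitrary so that one statement serves both the points met in a given state
  and all points.\<close>

lemma points_in_block: "AE \<omega> in M. \<forall>a L. 0 \<le> a \<longrightarrow> 0 \<le> L \<longrightarrow> Kc a \<omega> \<le> Kc (a + L) \<omega> \<and>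
    (\<forall>A. {n. a < \<tau> n \<omega> \<and> \<tau> n \<omega> \<le> a + L \<and> A n} = int ` {l. Suc (Kc a \<omega>) \<le> l \<and> l < Suc (Kc (a + L) \<omega>) \<and> A (int l)})"
  using request_enumeration tau_path
proof eventually_elim
  case (elim \<omega>)
  have mono: "\<And>m n. m < n \<Longrightarrow> \<tau> m \<omega> < \<tau> n \<omega>" and t0: "\<tau> 0 \<omega> \<le> 0" using elim(2) by blast+
  show ?case
  proof (intro allI impI conjI)
    fix a L :: real assume a: "0 \<le> a" and L: "0 \<le> L"
    have b: "0 \<le> a + L" using a L by simp
    note ea = elim(1)[rule_format, OF a] and eb = elim(1)[rule_format, OF b]
    show "Kc a \<omega> \<le> Kc (a + L) \<omega>"
    proof (cases "Kc a \<omega> = 0")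
      case False
      then have "1 \<le> Kc a \<omega>" by simp
      from ea[OF this] eb[OF this] L show ?thesis by simp
    qed simp
    fix A
    show "{n. a < \<tau> n \<omega> \<and> \<tau> n \<omega> \<le> a + L \<and> A n} = int ` {l. Suc (Kc a \<omega>) \<le> l \<and> l < Suc (Kc (a + L) \<omega>) \<and> A (int l)}"
    proof (intro equalityI subsetI)
      fix n assume "n \<in> {n. a < \<tau> n \<omega> \<and> \<tau> n \<omega> \<le> a + L \<and> A n}"
      then have n: "a < \<tau> n \<omega>" "\<tau> n \<omega> \<le> a + L" "A n" by auto
      have "n \<ge> 1"
      proof (rule ccontr)
        assume "\<not> n \<ge> 1"
        then have "\<tau> n \<omega> \<le> \<tau> 0 \<omega>" using mono[of n 0] by (cases "n = 0") auto
        with t0 a n show False by linarith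
      qed
      then obtain l where l: "n = int l" "1 \<le> l" by (metis nonneg_int_cases of_nat_1 of_nat_le_iff order_trans zero_le_one)
      have "\<not> l \<le> Kc a \<omega>" "l \<le> Kc (a + L) \<omega>" using ea[OF l(2)] eb[OF l(2)] n l by auto
      with l n show "n \<in> int ` {l. Suc (Kc a \<omega>) \<le> l \<and> l < Suc (Kc (a + L) \<omega>) \<and> A (int l)}" by auto
    next
      fix n assume "n \<in> int ` {l. Suc (Kc a \<omega>) \<le> l \<and> l < Suc (Kc (a + L) \<omega>) \<and> A (int l)}"
      then obtain l where l: "n = int l" "Suc (Kc a \<omega>) \<le> l" "l < Suc (Kc (a + L) \<omega>)" "A (int l)" by blast
      then have "1 \<le> l" by simp
      from ea[OF this] eb[OF this] l show "n \<in> {n. a < \<tau> n \<omega> \<and> \<tau> n \<omega> \<le> a + L \<and> A n}" by auto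
    qed
  qed
qed

text \<open>The piece on which \<open>k\<close> requests occur in \<open>(0, a]\<close> and \<open>k'\<close> in \<open>(0, b]\<close>. The premises \<open>1 \<le> k\<close> and \<open>1 \<le> k'\<close> are there
  because \<open>\<tau> 0\<close> is not measurable with respect to the request filtration.\<close>
definition Gs :: "real \<Rightarrow> real \<Rightarrow> nat \<times> nat \<Rightarrow> 'a set" where
  "Gs a b p = (case p of (k, k') \<Rightarrow> {\<omega> \<in> space M. k \<le> k' \<and> (1 \<le> k \<longrightarrow> \<tau> (int k) \<omega> \<le> a) \<and> a < \<tau> (int (Suc k)) \<omega> \<and>
     (1 \<le> k' \<longrightarrow> \<tau> (int k') \<omega> \<le> b) \<and> b < \<tau> (int (Suc k')) \<omega>})"

text \<open>Membership involves \<open>b < \<tau> (int (Suc k'))\<close>, so the first request after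
  time \<open>b\<close> must be observed as well; hence the index \<open>Suc k'\<close>.\<close>

lemma Gs_H: "Gs a b (k, k') \<in> sets (H (Suc k'))"
proof (cases "k \<le> k'")
  case True
  have 1: "Measurable.pred (H (Suc k')) (\<lambda>\<omega>. \<tau> (int l) \<omega> \<le> x)" "Measurable.pred (H (Suc k')) (\<lambda>\<omega>. x < \<tau> (int l) \<omega>)"
    if "1 \<le> l" "l \<le> Suc k'" for l x
  proof -
    note [measurable] = tau_H[OF that]
    show "Measurable.pred (H (Suc k')) (\<lambda>\<omega>. \<tau> (int l) \<omega> \<le> x)" "Measurable.pred (H (Suc k')) (\<lambda>\<omega>. x < \<tau> (int l) \<omega>)"
      by measurable
  qed
  have 2: "Measurable.pred (H (Suc k')) (\<lambda>\<omega>. 1 \<le> l \<longrightarrow> \<tau> (int l) \<omega> \<le> x)" if "l \<le> Suc k'" for l x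
  proof (cases "1 \<le> l")
    case True
    from 1(1)[OF True that] True show ?thesis by simp
  next
    case False
    then show ?thesis by simp
  qed
  have "Measurable.pred (H (Suc k')) (\<lambda>\<omega>. (1 \<le> k \<longrightarrow> \<tau> (int k) \<omega> \<le> a) \<and> a < \<tau> (int (Suc k)) \<omega> \<and>
     (1 \<le> k' \<longrightarrow> \<tau> (int k') \<omega> \<le> b) \<and> b < \<tau> (int (Suc k')) \<omega>)"
  proof -
    have m1: "Measurable.pred (H (Suc k')) (\<lambda>\<omega>. a < \<tau> (int (Suc k)) \<omega>)" by (rule 1(2)) (use True in auto)
    have m2: "Measurable.pred (H (Suc k')) (\<lambda>\<omega>. b < \<tau> (int (Suc k')) \<omega>)" by (rule 1(2)) auto
    have m3: "Measurable.pred (H (Suc k')) (\<lambda>\<omega>. 1 \<le> k \<longrightarrow> \<tau> (int k) \<omega> \<le> a)" by (rule 2) (use True in auto)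
    have m4: "Measurable.pred (H (Suc k')) (\<lambda>\<omega>. 1 \<le> k' \<longrightarrow> \<tau> (int k') \<omega> \<le> b)" by (rule 2) auto
    show ?thesis by (rule pred_intros_logic(3)[OF m3 pred_intros_logic(3)[OF m1 pred_intros_logic(3)[OF m4 m2]]])
  qed
  then have "{\<omega> \<in> space (H (Suc k')). (1 \<le> k \<longrightarrow> \<tau> (int k) \<omega> \<le> a) \<and> a < \<tau> (int (Suc k)) \<omega> \<and>
     (1 \<le> k' \<longrightarrow> \<tau> (int k') \<omega> \<le> b) \<and> b < \<tau> (int (Suc k')) \<omega>} \<in> sets (H (Suc k'))"
    by (rule predE)
  also have "{\<omega> \<in> space (H (Suc k')). (1 \<le> k \<longrightarrow> \<tau> (int k) \<omega> \<le> a) \<and> a < \<tau> (int (Suc k)) \<omega> \<and>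
     (1 \<le> k' \<longrightarrow> \<tau> (int k') \<omega> \<le> b) \<and> b < \<tau> (int (Suc k')) \<omega>} = Gs a b (k, k')"
    unfolding Gs_def space_H prod.case using True by simp
  finally show ?thesis .
next
  case False
  then have "Gs a b (k, k') = {}" by (auto simp: Gs_def)
  then show ?thesis by simp
qed

lemma Gs_M [measurable]: "Gs a b p \<in> sets M"
  using H_in_M[OF Gs_H] by (cases p) auto

text \<open>Up to a null set the pieces partition the space, which replaces a random index range by
  deterministic ones.\<close>

lemma Gs_iff:
  assumes "0 \<le> a" "0 \<le> L"
  shows "AE \<omega> in M. \<forall>p. \<omega> \<in> Gs a (a + L) p \<longleftrightarrow> p = (Kc a \<omega>, Kc (a + L) \<omega>)"
  using request_enumeration points_in_block AE_space
proof eventually_elim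
  case (elim \<omega>)
  have b: "0 \<le> a + L" using assms by simp
  note ea = elim(1)[rule_format, OF assms(1)] and eb = elim(1)[rule_format, OF b]
  have le: "Kc a \<omega> \<le> Kc (a + L) \<omega>" using elim(2)[rule_format, OF assms] by (rule conjunct1)
  have 1: "(1 \<le> k \<longrightarrow> \<tau> (int k) \<omega> \<le> x) \<and> x < \<tau> (int (Suc k)) \<omega> \<longleftrightarrow> k = Kc x \<omega>"
    if x: "\<And>n. 1 \<le> n \<Longrightarrow> \<tau> (int n) \<omega> \<le> x \<longleftrightarrow> n \<le> Kc x \<omega>" for x k
  proof -
    have "x < \<tau> (int (Suc k)) \<omega> \<longleftrightarrow> \<not> Suc k \<le> Kc x \<omega>" using x[of "Suc k"] by (simp add: not_le[symmetric])
    moreover have "(1 \<le> k \<longrightarrow> \<tau> (int k) \<omega> \<le> x) \<longleftrightarrow> (1 \<le> k \<longrightarrow> k \<le> Kc x \<omega>)" using x[of k] by blast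
    ultimately show ?thesis by linarith
  qed
  show ?case
  proof
    fix p :: "nat \<times> nat"
    obtain k k' where p: "p = (k, k')" by force
    have "\<omega> \<in> Gs a (a + L) p \<longleftrightarrow> k \<le> k' \<and> k = Kc a \<omega> \<and> k' = Kc (a + L) \<omega>"
    proof -
      have "\<omega> \<in> Gs a (a + L) p \<longleftrightarrow> k \<le> k' \<and> ((1 \<le> k \<longrightarrow> \<tau> (int k) \<omega> \<le> a) \<and> a < \<tau> (int (Suc k)) \<omega>) \<and>
        ((1 \<le> k' \<longrightarrow> \<tau> (int k') \<omega> \<le> a + L) \<and> a + L < \<tau> (int (Suc k')) \<omega>)"
        unfolding Gs_def p using elim(3) by simp
      moreover have "((1 \<le> k \<longrightarrow> \<tau> (int k) \<omega> \<le> a) \<and> a < \<tau> (int (Suc k)) \<omega>) \<longleftrightarrow> k = Kc a \<omega>" by (rule 1[OF ea])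
      moreover have "((1 \<le> k' \<longrightarrow> \<tau> (int k') \<omega> \<le> a + L) \<and> a + L < \<tau> (int (Suc k')) \<omega>) \<longleftrightarrow> k' = Kc (a + L) \<omega>" by (rule 1[OF eb])
      ultimately show ?thesis by (simp only:)
    qed
    then show "\<omega> \<in> Gs a (a + L) p \<longleftrightarrow> p = (Kc a \<omega>, Kc (a + L) \<omega>)" using le p by auto
  qed
qed

definition block_fault :: "nat set \<Rightarrow> (nat list \<Rightarrow> nat set list \<Rightarrow> nat set) \<Rightarrow> real \<Rightarrow> real \<Rightarrow> 'a set" where
  "block_fault C0 f a b = {\<omega> \<in> space M. \<exists>n\<ge>1. a < \<tau> (int n) \<omega> \<and> \<tau> (int n) \<omega> \<le> b \<and> R n \<omega> \<notin> content C0 f (\<lambda>k. R k \<omega>) n}"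

text \<open>The content as a function of a finite list of requests; \<open>l - 1\<close> converts
  the index of a request into a list position.\<close>

definition cont_of :: "nat set \<Rightarrow> (nat list \<Rightarrow> nat set list \<Rightarrow> nat set) \<Rightarrow> nat \<Rightarrow> nat list \<Rightarrow> nat set" where
  "cont_of C0 f n ys = content C0 f (\<lambda>l. ys ! (l - 1)) n"

lemma cont_of_reqs: "n \<le> Suc m \<Longrightarrow> content C0 f (\<lambda>k. R k \<omega>) n = cont_of C0 f n (reqs m \<omega>)"
  unfolding cont_of_def by (rule content_cong) (simp add: nth_reqs)

lemma fault_measurable [measurable]: "Measurable.pred M (\<lambda>\<omega>. R n \<omega> \<notin> content C0 f (\<lambda>k. R k \<omega>) n)"
proof -
  have "(\<lambda>\<omega>. (R n \<omega>, reqs n \<omega>)) \<in> measurable M (count_space UNIV)"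
  proof -
    have "(\<lambda>\<omega>. (R n \<omega>, reqs n \<omega>)) \<in> measurable M (count_space UNIV \<Otimes>\<^sub>M count_space UNIV)" by measurable
    then show ?thesis by (simp add: pair_measure_countable)
  qed
  from measurable_compose[OF this, of "\<lambda>(i, ys). i \<notin> cont_of C0 f n ys" "count_space UNIV"]
  show ?thesis by (simp add: cont_of_reqs[of n n])
qed

lemma block_fault_measurable [measurable]: "block_fault C0 f a b \<in> sets M"
  unfolding block_fault_def by measurable

text \<open>The error terms of \<open>miss_bound\<close>, written with counts that do not refer to a
  particular piece, so that they can be integrated over the whole space.\<close>

definition err :: "real \<Rightarrow> real \<Rightarrow> real \<Rightarrow> real \<Rightarrow> real \<Rightarrow> 'a \<Rightarrow> real" where
  "err p \<delta> c a L \<omega> = (\<delta> / p) * (\<Sum>r\<in>{1..Ms}. c + (real (Nr r a L \<omega>) - \<pi> r * L)\<^sup>2 / c) + (\<delta> / p)\<^sup>2 * (real (pcount \<tau> \<omega> a (a + L)))\<^sup>2"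

lemma err_measurable [measurable]: "err p \<delta> c a L \<in> borel_measurable M"
  unfolding err_def by measurable

text \<open>Cuts the list as in \<open>seq_pmf_block\<close>. The single last entry belongs to the
  first request after the block, which the filtration of the piece includes.\<close>

lemma states_split:
  assumes "k \<le> k'"
  defines "st \<equiv> \<lambda>\<omega> l. J (\<tau> (int l) \<omega>) \<omega>"
  shows "states (Suc k') \<omega> = map (st \<omega>) [1..<Suc k] @ map (st \<omega>) [Suc k..<Suc k'] @ [st \<omega> (Suc k')]"
proof -
  have "[1..<Suc (Suc k')] = [1..<Suc k] @ [Suc k..<Suc k'] @ [Suc k']"
    using assms(1) upt_add_eq_append[of 1 "Suc k" "k' - k"] by simp
  then show ?thesis unfolding states_def st_def by (simp only: map_append list.map)
qed

lemma block_counts: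
  assumes "0 \<le> a" "0 \<le> L"
  shows "AE \<omega> in M. \<forall>k k'. \<omega> \<in> Gs a (a + L) (k, k') \<longrightarrow>
     (\<forall>r. Nr r a L \<omega> = count_list (map (\<lambda>l. J (\<tau> (int l) \<omega>) \<omega>) [Suc k..<Suc k']) r) \<and> pcount \<tau> \<omega> a (a + L) = k' - k"
  using Gs_iff[OF assms] points_in_block
proof eventually_elim
  case (elim \<omega>)
  show ?case
  proof (intro allI impI)
    fix k k' assume "\<omega> \<in> Gs a (a + L) (k, k')"
    then have k: "k = Kc a \<omega>" "k' = Kc (a + L) \<omega>" using elim(1) by auto
    note pts = elim(2)[rule_format, OF assms, folded k]
    have le: "k \<le> k'" using pts by (rule conjunct1)
    note img = pts[THEN conjunct2, rule_format]
    have "Nr r a L \<omega> = count_list (map (\<lambda>l. J (\<tau> (int l) \<omega>) \<omega>) [Suc k..<Suc k']) r" for r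
    proof -
      have "Nr r a L \<omega> = card (int ` {l. Suc k \<le> l \<and> l < Suc k' \<and> J (\<tau> (int l) \<omega>) \<omega> = r})"
        unfolding Nr_def using img[of "\<lambda>n. J (\<tau> n \<omega>) \<omega> = r"] by simp
      also have "\<dots> = card {l. Suc k \<le> l \<and> l < Suc k' \<and> J (\<tau> (int l) \<omega>) \<omega> = r}" by (rule card_image) simp
      also have "\<dots> = count_list (map (\<lambda>l. J (\<tau> (int l) \<omega>) \<omega>) [Suc k..<Suc k']) r"
        using le by (intro count_list_map_upt[symmetric]) simp
      finally show ?thesis .
    qed
    moreover have "pcount \<tau> \<omega> a (a + L) = k' - k"
    proof -
      have "pcount \<tau> \<omega> a (a + L) = card (int ` {l. Suc k \<le> l \<and> l < Suc k'})"
        unfolding pcount_def using img[of "\<lambda>_. True"] by simp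
      also have "\<dots> = card {l. Suc k \<le> l \<and> l < Suc k'}" by (rule card_image) simp
      also have "{l. Suc k \<le> l \<and> l < Suc k'} = {Suc k..<Suc k'}" by auto
      finally show ?thesis by simp
    qed
    ultimately show "(\<forall>r. Nr r a L \<omega> = count_list (map (\<lambda>l. J (\<tau> (int l) \<omega>) \<omega>) [Suc k..<Suc k']) r) \<and> pcount \<tau> \<omega> a (a + L) = k' - k"
      by blast
  qed
qed

text \<open>List positions \<open>k\<close> to \<open>k' - 1\<close> hold the requests
  \<open>k + 1\<close> to \<open>k'\<close> of the block, and the content at request
  \<open>k + 1\<close> depends on the first \<open>k\<close> entries.\<close>

definition miss_lists :: "nat set \<Rightarrow> (nat list \<Rightarrow> nat set list \<Rightarrow> nat set) \<Rightarrow> nat \<Rightarrow> nat \<Rightarrow> nat list set" where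
  "miss_lists C0 f k k' = {ys. \<exists>l. k \<le> l \<and> l < k' \<and> ys ! l \<notin> cont_of C0 f (Suc k) (take k ys)}"

text \<open>A request that misses the content held at the start of the block need not itself be a
  fault, because the content may have changed by then. In that case
  \<open>first_miss_is_fault\<close> supplies an earlier fault in the same block.\<close>

lemma miss_is_block_fault:
  assumes "0 \<le> a" "0 \<le> L"
  shows "AE \<omega> in M. \<forall>k k'. \<omega> \<in> Gs a (a + L) (k, k') \<longrightarrow> reqs (Suc k') \<omega> \<in> miss_lists C0 f k k' \<longrightarrow> \<omega> \<in> block_fault C0 f a (a + L)"
  using Gs_iff[OF assms] request_enumeration AE_space
proof eventually_elim
  case (elim \<omega>)
  have b: "0 \<le> a + L" using assms by simp
  note ea = elim(2)[rule_format, OF assms(1)] and eb = elim(2)[rule_format, OF b]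
  show ?case
  proof (intro allI impI)
    fix k k' assume "\<omega> \<in> Gs a (a + L) (k, k')" and A: "reqs (Suc k') \<omega> \<in> miss_lists C0 f k k'"
    then have k: "k = Kc a \<omega>" "k' = Kc (a + L) \<omega>" using elim(1) by auto
    from A obtain l where l: "k \<le> l" "l < k'" "reqs (Suc k') \<omega> ! l \<notin> cont_of C0 f (Suc k) (take k (reqs (Suc k') \<omega>))"
      unfolding miss_lists_def by blast
    have "reqs (Suc k') \<omega> ! l = R (Suc l) \<omega>" using l by (simp add: nth_reqs)
    moreover have "take k (reqs (Suc k') \<omega>) = reqs k \<omega>"
      by (rule nth_equalityI) (use l in \<open>auto simp: nth_reqs\<close>)
    ultimately have miss: "R (Suc l) \<omega> \<notin> content C0 f (\<lambda>k. R k \<omega>) (Suc k)"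
      using l(3) cont_of_reqs[of "Suc k" k C0 f \<omega>] by simp
    have "k < Suc l" using l by simp
    from first_miss_is_fault[of k "Suc l" "\<lambda>k. R k \<omega>", OF this miss]
    obtain n where n: "k < n" "n \<le> Suc l" "R n \<omega> \<notin> content C0 f (\<lambda>k. R k \<omega>) n" by blast
    then have n1: "1 \<le> n" "n \<le> k'" using l by auto
    have "a < \<tau> (int n) \<omega>" using ea[OF n1(1)] n(1) k(1) by (simp add: not_le[symmetric])
    moreover have "\<tau> (int n) \<omega> \<le> a + L" using eb[OF n1(1)] n1(2) k(2) by simp
    ultimately show "\<omega> \<in> block_fault C0 f a (a + L)" unfolding block_fault_def using n(3) n1(1) elim(3) by blast
  qed
qed

text \<open>On a piece the request law reduces the claim to \<open>seq_pmf_block\<close>, and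
  \<open>miss_bound\<close> treats every admissible content. The error stays a random variable,
  because the counts are controlled only in the mean over all pieces.\<close>

lemma piece_bound:
  assumes a: "0 \<le> a" and L: "0 < L" and c: "0 < c" and p: "0 < p" "\<And>r. r \<in> {1..Ms} \<Longrightarrow> p \<le> \<pi> r" and \<delta>: "0 < \<delta>"
    and pol: "(C0, f) \<in> policies s x"
    and knap: "\<And>C. cache_ok s x C \<Longrightarrow> \<delta> \<le> (\<Sum>r\<in>{1..Ms}. \<pi> r * (1 - measure (doc_pmf r) C))"
  shows "(\<integral>\<^sup>+\<omega>. indicator (Gs a (a + L) (k, k')) \<omega> * ennreal (L * \<delta>) \<partial>M)
    \<le> emeasure M (Gs a (a + L) (k, k') \<inter> block_fault C0 f a (a + L)) + (\<integral>\<^sup>+\<omega>. indicator (Gs a (a + L) (k, k')) \<omega> * ennreal (err p \<delta> c a L \<omega>) \<partial>M)"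
proof -
  let ?G = "Gs a (a + L) (k, k')" and ?A = "miss_lists C0 f k k'"
  have L0: "0 \<le> L" using L by simp
  have err0: "0 \<le> err p \<delta> c a L \<omega>" for \<omega>
    unfolding err_def using p(1) \<delta> c by (intro add_nonneg_nonneg mult_nonneg_nonneg sum_nonneg) auto
  have "AE \<omega> in M. indicator ?G \<omega> * ennreal (L * \<delta> - err p \<delta> c a L \<omega>) \<le> indicator ?G \<omega> * emeasure (seq_pmf doc_pmf (states (Suc k') \<omega>)) ?A"
    using block_counts[OF a L0] J_range
  proof eventually_elim
    case (elim \<omega>)
    show ?case
    proof (cases "\<omega> \<in> ?G")
      case True
      then have le: "k \<le> k'" by (simp add: Gs_def)
      define st where "st l = J (\<tau> (int l) \<omega>) \<omega>" for l
      let ?js = "map st [Suc k..<Suc k']"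
      from elim(1) True have cnt: "\<And>r. Nr r a L \<omega> = count_list ?js r" "pcount \<tau> \<omega> a (a + L) = k' - k"
        unfolding st_def by blast+
      have js: "set ?js \<subseteq> {1..Ms}" using elim(2) unfolding st_def by (simp only: set_map) blast
      have "ennreal (L * \<delta> - err p \<delta> c a L \<omega>) \<le> emeasure (seq_pmf doc_pmf (map st [1..<Suc k] @ ?js @ [st (Suc k')]))
        {ys. \<exists>l. length (map st [1..<Suc k]) \<le> l \<and> l < length (map st [1..<Suc k]) + length ?js \<and>
            ys ! l \<notin> cont_of C0 f (Suc k) (take (length (map st [1..<Suc k])) ys)}"
      proof (rule seq_pmf_block)
        fix C assume "C \<in> range (cont_of C0 f (Suc k))"
        then have ok: "cache_ok s x C" unfolding cont_of_def using content_ok[OF pol] by blast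
        let ?g = "\<lambda>r. 1 - measure (doc_pmf r) C"
        have "L * \<delta> - (\<delta> / p) * (\<Sum>r\<in>{1..Ms}. c + (real (count_list ?js r) - \<pi> r * L)\<^sup>2 / c) - (\<delta> / p)\<^sup>2 * (real (length ?js))\<^sup>2
            \<le> 1 - (\<Prod>j\<leftarrow>?js. 1 - ?g j)"
          by (rule miss_bound[where w = \<pi>]) (use js p \<delta> knap[OF ok] c L in auto)
        then show "L * \<delta> - err p \<delta> c a L \<omega> \<le> 1 - (\<Prod>j\<leftarrow>?js. measure (doc_pmf j) C)"
          unfolding err_def cnt by (simp del: map_map upt_Suc)
      qed
      also have "map st [1..<Suc k] @ ?js @ [st (Suc k')] = states (Suc k') \<omega>"
        unfolding states_split[OF le] st_def ..
      also have "{ys. \<exists>l. length (map st [1..<Suc k]) \<le> l \<and> l < length (map st [1..<Suc k]) + length ?js \<and>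
            ys ! l \<notin> cont_of C0 f (Suc k) (take (length (map st [1..<Suc k])) ys)} = ?A"
        using le unfolding miss_lists_def by (simp del: upt_Suc)
      finally show ?thesis by (rule mult_left_mono) simp
    qed simp
  qed
  then have "(\<integral>\<^sup>+\<omega>. indicator ?G \<omega> * ennreal (L * \<delta> - err p \<delta> c a L \<omega>) \<partial>M) \<le> (\<integral>\<^sup>+\<omega>. indicator ?G \<omega> * emeasure (seq_pmf doc_pmf (states (Suc k') \<omega>)) ?A \<partial>M)"
    by (rule nn_integral_mono_AE)
  also have "\<dots> \<le> emeasure M (?G \<inter> {\<omega> \<in> space M. reqs (Suc k') \<omega> \<in> ?A})"
    by (rule request_law_set[OF _ Gs_H]) simp
  also have "\<dots> \<le> emeasure M (?G \<inter> block_fault C0 f a (a + L))"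
  proof (rule emeasure_mono_AE)
    show "AE \<omega> in M. \<omega> \<in> ?G \<inter> {\<omega> \<in> space M. reqs (Suc k') \<omega> \<in> ?A} \<longrightarrow> \<omega> \<in> ?G \<inter> block_fault C0 f a (a + L)"
      using miss_is_block_fault[OF a L0, of C0 f] by eventually_elim blast
  qed measurable
  finally have 1: "(\<integral>\<^sup>+\<omega>. indicator ?G \<omega> * ennreal (L * \<delta> - err p \<delta> c a L \<omega>) \<partial>M) \<le> emeasure M (?G \<inter> block_fault C0 f a (a + L))" .
  have "(\<integral>\<^sup>+\<omega>. indicator ?G \<omega> * ennreal (L * \<delta>) \<partial>M)
     \<le> (\<integral>\<^sup>+\<omega>. indicator ?G \<omega> * ennreal (L * \<delta> - err p \<delta> c a L \<omega>) + indicator ?G \<omega> * ennreal (err p \<delta> c a L \<omega>) \<partial>M)"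
  proof (rule nn_integral_mono)
    fix \<omega>
    \<comment> \<open>The difference may be negative, where \<open>ennreal\<close> gives 0; the
      maximum keeps the splitting valid.\<close>
    have "ennreal (L * \<delta>) \<le> ennreal (max 0 (L * \<delta> - err p \<delta> c a L \<omega>) + err p \<delta> c a L \<omega>)" by (rule ennreal_leI) simp
    also have "\<dots> = ennreal (L * \<delta> - err p \<delta> c a L \<omega>) + ennreal (err p \<delta> c a L \<omega>)"
      using err0 by (subst ennreal_plus) (auto simp: max_def ennreal_neg)
    finally show "indicator ?G \<omega> * ennreal (L * \<delta>) \<le> indicator ?G \<omega> * ennreal (L * \<delta> - err p \<delta> c a L \<omega>) + indicator ?G \<omega> * ennreal (err p \<delta> c a L \<omega>)"
      by (auto simp: indicator_def)
  qed
  also have "\<dots> = (\<integral>\<^sup>+\<omega>. indicator ?G \<omega> * ennreal (L * \<delta> - err p \<delta> c a L \<omega>) \<partial>M) + (\<integral>\<^sup>+\<omega>. indicator ?G \<omega> * ennreal (err p \<delta> c a L \<omega>) \<partial>M)"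
    by (rule nn_integral_add) measurable
  finally show ?thesis using add_mono[OF 1 order_refl] by (rule order_trans)
qed

lemma block_bound:
  assumes a: "0 \<le> a" and L: "0 < L" and c: "0 < c" and p: "0 < p" "\<And>r. r \<in> {1..Ms} \<Longrightarrow> p \<le> \<pi> r" and \<delta>: "0 < \<delta>"
    and pol: "(C0, f) \<in> policies s x"
    and knap: "\<And>C. cache_ok s x C \<Longrightarrow> \<delta> \<le> (\<Sum>r\<in>{1..Ms}. \<pi> r * (1 - measure (doc_pmf r) C))"
  shows "ennreal (L * \<delta>) \<le> emeasure M (block_fault C0 f a (a + L)) + (\<integral>\<^sup>+\<omega>. ennreal (err p \<delta> c a L \<omega>) \<partial>M)"
proof -
  let ?G = "Gs a (a + L)" and ?B = "block_fault C0 f a (a + L)"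
  have L0: "0 \<le> L" using L by simp
  \<comment> \<open>Integrals split along the partition. This is applied to the constant, to the
    error and to the indicator of a fault.\<close>
  have part: "(\<integral>\<^sup>+\<omega>. h \<omega> \<partial>M) = (\<integral>\<^sup>+z. \<integral>\<^sup>+\<omega>. indicator (?G z) \<omega> * h \<omega> \<partial>M \<partial>count_space UNIV)"
    if [measurable]: "h \<in> borel_measurable M" for h :: "'a \<Rightarrow> ennreal"
  proof -
    have "(\<integral>\<^sup>+\<omega>. h \<omega> \<partial>M) = (\<integral>\<^sup>+\<omega>. \<integral>\<^sup>+z. indicator (?G z) \<omega> * h \<omega> \<partial>count_space UNIV \<partial>M)"
    proof (rule nn_integral_cong_AE)
      show "AE \<omega> in M. h \<omega> = (\<integral>\<^sup>+z. indicator (?G z) \<omega> * h \<omega> \<partial>count_space UNIV)"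
        using Gs_iff[OF a L0]
      proof eventually_elim
        case (elim \<omega>)
        have "(\<integral>\<^sup>+z. indicator (?G z) \<omega> * h \<omega> \<partial>count_space UNIV) = (\<integral>\<^sup>+z. h \<omega> * indicator {(Kc a \<omega>, Kc (a + L) \<omega>)} z \<partial>count_space UNIV)"
        proof (rule nn_integral_cong)
          fix z show "indicator (?G z) \<omega> * h \<omega> = h \<omega> * indicator {(Kc a \<omega>, Kc (a + L) \<omega>)} z"
            using elim[rule_format, of z] by (simp add: indicator_def)
        qed
        also have "\<dots> = h \<omega>" by (subst nn_integral_cmult) (auto simp: emeasure_count_space_finite)
        finally show ?case by simp
      qed
    qed
    also have "\<dots> = (\<integral>\<^sup>+z. \<integral>\<^sup>+\<omega>. indicator (?G z) \<omega> * h \<omega> \<partial>M \<partial>count_space UNIV)"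
      by (rule nn_integral_count_space_nn_integral) auto
    finally show ?thesis .
  qed
  have "ennreal (L * \<delta>) = (\<integral>\<^sup>+\<omega>. ennreal (L * \<delta>) \<partial>M)" by (simp add: emeasure_space_1)
  also have "\<dots> = (\<integral>\<^sup>+z. \<integral>\<^sup>+\<omega>. indicator (?G z) \<omega> * ennreal (L * \<delta>) \<partial>M \<partial>count_space UNIV)" by (rule part) simp
  also have "\<dots> \<le> (\<integral>\<^sup>+z. emeasure M (?G z \<inter> ?B) + (\<integral>\<^sup>+\<omega>. indicator (?G z) \<omega> * ennreal (err p \<delta> c a L \<omega>) \<partial>M) \<partial>count_space UNIV)"
  proof (rule nn_integral_mono)
    fix z :: "nat \<times> nat"
    obtain k k' where z: "z = (k, k')" by force
    show "(\<integral>\<^sup>+\<omega>. indicator (?G z) \<omega> * ennreal (L * \<delta>) \<partial>M) \<le> emeasure M (?G z \<inter> ?B) + (\<integral>\<^sup>+\<omega>. indicator (?G z) \<omega> * ennreal (err p \<delta> c a L \<omega>) \<partial>M)"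
      unfolding z by (rule piece_bound[OF a L c p \<delta> pol knap])
  qed
  also have "\<dots> = (\<integral>\<^sup>+z. emeasure M (?G z \<inter> ?B) \<partial>count_space UNIV) + (\<integral>\<^sup>+z. \<integral>\<^sup>+\<omega>. indicator (?G z) \<omega> * ennreal (err p \<delta> c a L \<omega>) \<partial>M \<partial>count_space UNIV)"
    by (rule nn_integral_add) auto
  also have "(\<integral>\<^sup>+z. \<integral>\<^sup>+\<omega>. indicator (?G z) \<omega> * ennreal (err p \<delta> c a L \<omega>) \<partial>M \<partial>count_space UNIV) = (\<integral>\<^sup>+\<omega>. ennreal (err p \<delta> c a L \<omega>) \<partial>M)"
    by (rule part[symmetric]) measurable
  also have "(\<integral>\<^sup>+z. emeasure M (?G z \<inter> ?B) \<partial>count_space UNIV) = (\<integral>\<^sup>+z. \<integral>\<^sup>+\<omega>. indicator (?G z) \<omega> * indicator ?B \<omega> \<partial>M \<partial>count_space UNIV)"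
    by (intro nn_integral_cong) (simp flip: indicator_inter_arith)
  also have "\<dots> = (\<integral>\<^sup>+\<omega>. indicator ?B \<omega> \<partial>M)" by (rule part[symmetric]) measurable
  finally show ?thesis by simp
qed

text \<open>By linearity only second moments enter; the resulting bound does not depend on the
  position \<open>a\<close> of the block.\<close>

lemma err_expectation:
  assumes a: "0 \<le> a" and L: "0 < L" and c: "0 < c" and p: "0 < p" and \<delta>: "0 < \<delta>"
  shows "(\<integral>\<^sup>+\<omega>. ennreal (err p \<delta> c a L \<omega>) \<partial>M) \<le> ennreal ((\<delta> / p) * (\<Sum>r\<in>{1..Ms}. c + (\<pi> r * L + occ_var r L) / c)
      + (\<delta> / p)\<^sup>2 * (L + L\<^sup>2))"
proof -
  have \<pi>0: "0 \<le> \<pi> r" for r by (simp add: \<pi>_def stat_dist_def)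
  have V0: "0 \<le> occ_var r L" for r by simp
  have "(\<integral>\<^sup>+\<omega>. ennreal (err p \<delta> c a L \<omega>) \<partial>M)
     = (\<integral>\<^sup>+\<omega>. ennreal (\<delta> / p) * (\<Sum>r\<in>{1..Ms}. ennreal c + ennreal (1 / c) * ennreal ((real (Nr r a L \<omega>) - \<pi> r * L)\<^sup>2)) + ennreal ((\<delta> / p)\<^sup>2) * ennreal ((real (pcount \<tau> \<omega> a (a + L)))\<^sup>2) \<partial>M)"
  proof (rule nn_integral_cong)
    fix \<omega>
    have "ennreal c + ennreal (1 / c) * ennreal ((real (Nr r a L \<omega>) - \<pi> r * L)\<^sup>2) = ennreal (c + (real (Nr r a L \<omega>) - \<pi> r * L)\<^sup>2 / c)" for r
      using c by (simp add: ennreal_mult[symmetric] ennreal_plus[symmetric] del: ennreal_plus)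
    then show "ennreal (err p \<delta> c a L \<omega>) = ennreal (\<delta> / p) * (\<Sum>r\<in>{1..Ms}. ennreal c + ennreal (1 / c) * ennreal ((real (Nr r a L \<omega>) - \<pi> r * L)\<^sup>2)) + ennreal ((\<delta> / p)\<^sup>2) * ennreal ((real (pcount \<tau> \<omega> a (a + L)))\<^sup>2)"
      unfolding err_def using c p \<delta>
      by (simp add: sum_ennreal ennreal_mult[symmetric] ennreal_plus[symmetric] sum_nonneg del: ennreal_plus)
  qed
  also have "\<dots> = ennreal (\<delta> / p) * (\<Sum>r\<in>{1..Ms}. ennreal c + ennreal (1 / c) * (\<integral>\<^sup>+\<omega>. ennreal ((real (Nr r a L \<omega>) - \<pi> r * L)\<^sup>2) \<partial>M))
      + ennreal ((\<delta> / p)\<^sup>2) * (\<integral>\<^sup>+\<omega>. ennreal ((real (pcount \<tau> \<omega> a (a + L)))\<^sup>2) \<partial>M)"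
    by (simp add: nn_integral_add nn_integral_cmult nn_integral_sum emeasure_space_1)
  also have "\<dots> \<le> ennreal (\<delta> / p) * (\<Sum>r\<in>{1..Ms}. ennreal c + ennreal (1 / c) * ennreal (\<pi> r * L + occ_var r L))
      + ennreal ((\<delta> / p)\<^sup>2) * ennreal (L + L\<^sup>2)"
    using nn_pcount_second[of a "a + L"] L
    by (intro add_mono mult_left_mono sum_mono count_second_moment L a) auto
  also have "\<dots> = ennreal ((\<delta> / p) * (\<Sum>r\<in>{1..Ms}. c + (\<pi> r * L + occ_var r L) / c) + (\<delta> / p)\<^sup>2 * (L + L\<^sup>2))"
  proof -
    have "ennreal c + ennreal (1 / c) * ennreal v = ennreal (c + v / c)" if "0 \<le> v" for v
      using c that by (simp add: ennreal_mult[symmetric] ennreal_plus[symmetric] del: ennreal_plus)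
    moreover have "0 \<le> \<pi> r * L + occ_var r L" for r
      using \<pi>0[of r] L V0[of r] by (intro add_nonneg_nonneg mult_nonneg_nonneg) auto
    ultimately show ?thesis
      using c p \<delta> L
      by (simp add: sum_ennreal ennreal_mult[symmetric] ennreal_plus[symmetric] sum_nonneg del: ennreal_plus)
  qed
  finally show ?thesis .
qed

end

section \<open>Long-run fault probabilities\<close>

context request_sampling begin

text \<open>\<open>L\<close> and \<open>D\<close> depend on \<open>\<epsilon>\<close> and the model
  only, so one block length serves all policies, cache sizes and starting times. The linear error is
  at most \<open>\<epsilon> * \<delta> * L\<close> after taking \<open>c = \<eta> * L\<close> with
  \<open>\<eta>\<close> small and then \<open>L\<close> large; the quadratic error is kept as
  \<open>D\<close>.\<close>

lemma uniform_block_bound: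
  assumes pos: "\<And>r. r \<in> {1..Ms} \<Longrightarrow> 0 < \<pi> r" and \<epsilon>: "0 < \<epsilon>"
  obtains L D where "0 < L" "0 \<le> D"
    "\<And>a C0 f s x \<delta>. 0 \<le> a \<Longrightarrow> 0 < \<delta> \<Longrightarrow> (C0, f) \<in> policies s x \<Longrightarrow>
      (\<And>C. cache_ok s x C \<Longrightarrow> \<delta> \<le> (\<Sum>r\<in>{1..Ms}. \<pi> r * (1 - measure (doc_pmf r) C))) \<Longrightarrow>
      L * (\<delta> * (1 - \<epsilon>) - D * \<delta>\<^sup>2) \<le> measure M (block_fault C0 f a (a + L))"
proof -
  have ne: "{1..Ms} \<noteq> {}" using Ms_pos by auto
  define p where "p = Min (\<pi> ` {1..Ms})"
  have p: "0 < p" "\<And>r. r \<in> {1..Ms} \<Longrightarrow> p \<le> \<pi> r"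
    using pos ne by (auto simp: p_def Min_gr_iff)
  have Ms: "0 < real Ms" using Ms_pos by simp
  \<comment> \<open>With \<open>c = \<eta> * L\<close> and variance at most
    \<open>\<eta>\<^sup>2 * L\<^sup>2 + B r * L\<close>, a state contributes
    \<open>2 * \<eta> * L + (\<pi> r + B r) / \<eta>\<close>. Over all states the first terms use
    two thirds of the budget \<open>\<epsilon> * p * L\<close>.\<close>
  define \<eta> where "\<eta> = \<epsilon> * p / (3 * real Ms)"
  have \<eta>: "0 < \<eta>" using \<epsilon> p Ms by (simp add: \<eta>_def)
  have "\<forall>r. \<exists>B\<ge>0. \<forall>L\<ge>0. occ_var r L \<le> \<eta>\<^sup>2 * L\<^sup>2 + B * L"
  proof
    fix r
    obtain B where "B \<ge> 0" "\<And>L. L \<ge> 0 \<Longrightarrow> occ_var r L \<le> \<eta>\<^sup>2 * L\<^sup>2 + B * L"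
      by (rule occupation_variance[of "\<eta>\<^sup>2" r]) (use \<eta> in auto)
    then show "\<exists>B\<ge>0. \<forall>L\<ge>0. occ_var r L \<le> \<eta>\<^sup>2 * L\<^sup>2 + B * L" by blast
  qed
  from choice[OF this] obtain B where B0: "\<And>r. 0 \<le> B r"
    and B: "\<And>r L. 0 \<le> L \<Longrightarrow> occ_var r L \<le> \<eta>\<^sup>2 * L\<^sup>2 + B r * L" by blast
  define b where "b = (\<Sum>r\<in>{1..Ms}. \<pi> r + B r)"
  have b: "0 \<le> b" unfolding b_def using pos B0 by (intro sum_nonneg add_nonneg_nonneg) (auto simp: less_imp_le)
  \<comment> \<open>Chosen so that \<open>b / \<eta>\<close> fits into the remaining third of the
    budget; the added 1 makes \<open>L\<close> positive even if \<open>b\<close> is 0.\<close>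
  define L where "L = 3 * b / (\<eta> * \<epsilon> * p) + 1"
  have L: "0 < L" unfolding L_def using b \<eta> \<epsilon> p by (intro add_nonneg_pos divide_nonneg_nonneg) auto
  \<comment> \<open>Solves \<open>(L + L\<^sup>2) / p\<^sup>2 = L * D\<close>, the coefficient of
    the quadratic error.\<close>
  define D where "D = (1 + L) / p\<^sup>2"
  have D: "0 \<le> D" using L by (simp add: D_def)
  have main: "(1 / p) * (\<Sum>r\<in>{1..Ms}. \<eta> * L + (\<pi> r * L + occ_var r L) / (\<eta> * L)) \<le> \<epsilon> * L"
  proof -
    have "(\<Sum>r\<in>{1..Ms}. \<eta> * L + (\<pi> r * L + occ_var r L) / (\<eta> * L))
       \<le> (\<Sum>r\<in>{1..Ms}. 2 * \<eta> * L + (\<pi> r + B r) / \<eta>)"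
    proof (rule sum_mono)
      fix r
      have "(\<pi> r * L + occ_var r L) / (\<eta> * L) \<le> (\<pi> r * L + (\<eta>\<^sup>2 * L\<^sup>2 + B r * L)) / (\<eta> * L)"
        using B[of L r] L \<eta> by (intro divide_right_mono) auto
      also have "\<dots> = \<eta> * L + (\<pi> r + B r) / \<eta>"
        using L \<eta> by (simp add: field_simps power2_eq_square)
      finally show "\<eta> * L + (\<pi> r * L + occ_var r L) / (\<eta> * L) \<le> 2 * \<eta> * L + (\<pi> r + B r) / \<eta>" by linarith
    qed
    also have "\<dots> = 2 * (real Ms * \<eta>) * L + b / \<eta>"
      unfolding b_def by (simp add: sum.distrib flip: sum_divide_distrib)
    also have "real Ms * \<eta> = \<epsilon> * p / 3" using Ms by (simp add: \<eta>_def)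
    also have "b / \<eta> \<le> \<epsilon> * p / 3 * L"
    proof -
      have "\<epsilon> * p / 3 * L = b / \<eta> + \<epsilon> * p / 3" unfolding L_def using \<eta> \<epsilon> p by (simp add: field_simps)
      then show ?thesis using \<epsilon> p by simp
    qed
    finally have "(\<Sum>r\<in>{1..Ms}. \<eta> * L + (\<pi> r * L + occ_var r L) / (\<eta> * L)) \<le> p * (\<epsilon> * L)" by (simp add: mult_ac)
    then show ?thesis using p by (simp add: field_simps)
  qed
  show ?thesis
  proof (rule that[OF L D])
    fix a C0 f s x \<delta>
    assume a: "(0::real) \<le> a" and \<delta>: "(0::real) < \<delta>" and pol: "(C0, f) \<in> policies s x"
      and knap: "\<And>C. cache_ok s x C \<Longrightarrow> \<delta> \<le> (\<Sum>r\<in>{1..Ms}. \<pi> r * (1 - measure (doc_pmf r) C))"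
    have c: "0 < \<eta> * L" using \<eta> L by simp
    let ?V = "\<Sum>r\<in>{1..Ms}. \<eta> * L + (\<pi> r * L + occ_var r L) / (\<eta> * L)"
    let ?E = "(\<delta> / p) * ?V + (\<delta> / p)\<^sup>2 * (L + L\<^sup>2)"
    have V0: "0 \<le> ?V"
    proof (rule sum_nonneg)
      fix r assume "r \<in> {1..Ms}"
      then have "0 \<le> \<pi> r" using pos by (simp add: less_imp_le)
      then show "0 \<le> \<eta> * L + (\<pi> r * L + occ_var r L) / (\<eta> * L)"
        using \<eta> L by (intro add_nonneg_nonneg divide_nonneg_nonneg mult_nonneg_nonneg) auto
    qed
    have E0: "0 \<le> ?E" using V0 \<delta> p L by (intro add_nonneg_nonneg mult_nonneg_nonneg) auto
    have "ennreal (L * \<delta>) \<le> emeasure M (block_fault C0 f a (a + L)) + (\<integral>\<^sup>+\<omega>. ennreal (err p \<delta> (\<eta> * L) a L \<omega>) \<partial>M)"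
      by (rule block_bound[OF a L c p \<delta> pol knap])
    also have "\<dots> \<le> emeasure M (block_fault C0 f a (a + L)) + ennreal ?E"
      by (intro add_left_mono err_expectation a L c p \<delta>)
    also have "\<dots> = ennreal (measure M (block_fault C0 f a (a + L)) + ?E)"
      using E0 by (simp add: emeasure_eq_measure)
    finally have 1: "L * \<delta> \<le> measure M (block_fault C0 f a (a + L)) + ?E" using E0 by (subst (asm) ennreal_le_iff) auto
    have "(\<delta> / p) * ?V = \<delta> * ((1 / p) * ?V)" by simp
    also have "\<dots> \<le> \<delta> * (\<epsilon> * L)" using main \<delta> by (intro mult_left_mono) auto
    finally have 2: "(\<delta> / p) * ?V \<le> \<delta> * (\<epsilon> * L)" .
    have 3: "(\<delta> / p)\<^sup>2 * (L + L\<^sup>2) = L * (D * \<delta>\<^sup>2)" using p by (simp add: D_def field_simps power2_eq_square)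
    have "L * (\<delta> * (1 - \<epsilon>) - D * \<delta>\<^sup>2) = L * \<delta> - \<delta> * (\<epsilon> * L) - L * (D * \<delta>\<^sup>2)" by (simp add: algebra_simps)
    with 1 2 3 show "L * (\<delta> * (1 - \<epsilon>) - D * \<delta>\<^sup>2) \<le> measure M (block_fault C0 f a (a + L))" by linarith
  qed
qed

definition faults :: "nat set \<times> (nat list \<Rightarrow> nat set list \<Rightarrow> nat set) \<Rightarrow> real \<Rightarrow> 'a \<Rightarrow> nat set" where
  "faults pol t \<omega> = {n::nat. 1 \<le> n \<and> 0 \<le> \<tau> (int n) \<omega> \<and> \<tau> (int n) \<omega> \<le> t \<and>
                         R n \<omega> \<notin> content (fst pol) (snd pol) (\<lambda>k. R k \<omega>) n}"

lemma fault_prob_faults: "fault_prob M \<tau> R pol = Limsup at_top (\<lambda>t::real. enn2ereal (\<integral>\<^sup>+ \<omega>. of_nat (card (faults pol t \<omega>)) \<partial>M) / ereal t)"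
  by (simp add: fault_prob_def faults_def)

lemma finite_faults: "AE \<omega> in M. \<forall>t\<ge>0. finite (faults pol t \<omega>)"
  using request_enumeration
proof eventually_elim
  case (elim \<omega>)
  show ?case
  proof (intro allI impI)
    fix t :: real assume t: "0 \<le> t"
    have "faults pol t \<omega> \<subseteq> {..Kc t \<omega>}"
    proof
      fix n assume "n \<in> faults pol t \<omega>"
      then have "1 \<le> n" "\<tau> (int n) \<omega> \<le> t" by (auto simp: faults_def)
      with elim[rule_format, OF t \<open>1 \<le> n\<close>] show "n \<in> {..Kc t \<omega>}" by simp
    qed
    then show "finite (faults pol t \<omega>)" by (rule finite_subset) simp
  qed
qed

text \<open>The blocks are disjoint half-open intervals, so choosing one fault from each faulty
  block is injective.\<close>

lemma faults_ge_blocks: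
  assumes L: "0 < L" and t: "real m * L \<le> t"
  shows "AE \<omega> in M. (\<Sum>j<m. indicator (block_fault C0 f (real j * L) (real j * L + L)) \<omega>) \<le> (of_nat (card (faults (C0, f) t \<omega>)) :: ennreal)"
  using finite_faults[of "(C0, f)"]
proof eventually_elim
  case (elim \<omega>)
  have "0 \<le> real m * L" using L by simp
  then have t0: "0 \<le> t" using t by linarith
  have fin: "finite (faults (C0, f) t \<omega>)" using elim t0 by blast
  let ?S = "{j. j < m \<and> \<omega> \<in> block_fault C0 f (real j * L) (real j * L + L)}"
  have "\<forall>j\<in>?S. \<exists>n. 1 \<le> n \<and> real j * L < \<tau> (int n) \<omega> \<and> \<tau> (int n) \<omega> \<le> real j * L + L \<and> R n \<omega> \<notin> content C0 f (\<lambda>k. R k \<omega>) n"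
    by (auto simp: block_fault_def)
  from bchoice[OF this] obtain N where N: "\<And>j. j \<in> ?S \<Longrightarrow> 1 \<le> N j \<and> real j * L < \<tau> (int (N j)) \<omega> \<and> \<tau> (int (N j)) \<omega> \<le> real j * L + L \<and> R (N j) \<omega> \<notin> content C0 f (\<lambda>k. R k \<omega>) (N j)"
    by blast
  have step: "real i * L + L \<le> real j * L" if "i < j" for i j :: nat
  proof -
    have "real (Suc i) * L \<le> real j * L" using that L by (intro mult_right_mono) auto
    then show ?thesis by (simp add: distrib_right)
  qed
  have "inj_on N ?S"
  proof (rule linorder_inj_onI')
    fix i j assume "i \<in> ?S" "j \<in> ?S" "i < j"
    then have "\<tau> (int (N i)) \<omega> < \<tau> (int (N j)) \<omega>" using N[of i] N[of j] step[of i j] by linarith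
    then show "N i \<noteq> N j" by auto
  qed
  moreover have "N ` ?S \<subseteq> faults (C0, f) t \<omega>"
  proof
    fix n assume "n \<in> N ` ?S"
    then obtain j where j: "j \<in> ?S" "n = N j" by blast
    have "real j * L + L \<le> real m * L" using step[of j m] j(1) by simp
    moreover have "0 \<le> real j * L" using L by simp
    ultimately have "0 \<le> \<tau> (int (N j)) \<omega>" "\<tau> (int (N j)) \<omega> \<le> t" using N[OF j(1)] t by linarith+
    then show "n \<in> faults (C0, f) t \<omega>" using N[OF j(1)] unfolding faults_def j(2) by simp
  qed
  ultimately have "card ?S \<le> card (faults (C0, f) t \<omega>)" using fin by (rule card_inj_on_le)
  moreover have "(\<Sum>j<m. indicator (block_fault C0 f (real j * L) (real j * L + L)) \<omega>) = (of_nat (card ?S) :: ennreal)"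
  proof -
    have "(\<Sum>j<m. indicator (block_fault C0 f (real j * L) (real j * L + L)) \<omega>) = (\<Sum>j\<in>{..<m}. of_bool (\<omega> \<in> block_fault C0 f (real j * L) (real j * L + L)) :: ennreal)"
      by (intro sum.cong) (auto simp: indicator_def)
    also have "\<dots> = of_nat (card ({..<m} \<inter> {j. \<omega> \<in> block_fault C0 f (real j * L) (real j * L + L)}))"
      by (subst sum_of_bool_eq) auto
    also have "{..<m} \<inter> {j. \<omega> \<in> block_fault C0 f (real j * L) (real j * L + L)} = ?S" by auto
    finally show ?thesis .
  qed
  ultimately show ?case by (simp add: of_nat_mono)
qed

lemma fault_prob_nonneg: "0 \<le> fault_prob M \<tau> R pol"
proof -
  have "0 = Limsup (at_top :: real filter) (\<lambda>_. 0 :: ereal)" by (simp add: Limsup_const)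
  also have "\<dots> \<le> fault_prob M \<tau> R pol"
    unfolding fault_prob_faults
    by (rule Limsup_mono, rule eventually_mono[OF eventually_gt_at_top[of 0]]) simp
  finally show ?thesis .
qed

text \<open>Summing over the complete blocks in \<open>[0, t]\<close> loses at most one incomplete
  block, a term \<open>L * \<beta> / t\<close> that vanishes in the limit.\<close>

lemma fault_prob_ge:
  assumes L: "0 < L" and block: "\<And>a. 0 \<le> a \<Longrightarrow> L * \<beta> \<le> measure M (block_fault C0 f a (a + L))"
  shows "ereal \<beta> \<le> fault_prob M \<tau> R (C0, f)"
proof (cases "0 \<le> \<beta>")
  case False
  then show ?thesis using fault_prob_nonneg[of "(C0, f)"] by (intro order_trans[OF _ fault_prob_nonneg]) auto
next
  case True
  have lim: "((\<lambda>t. ereal (\<beta> - L * \<beta> / t)) \<longlongrightarrow> ereal \<beta>) at_top"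
  proof -
    have "((\<lambda>t. \<beta> - L * \<beta> / t) \<longlongrightarrow> \<beta> - 0) at_top"
      by (intro tendsto_diff tendsto_const tendsto_divide_0[OF tendsto_const] filterlim_at_top_imp_at_infinity filterlim_ident)
    then show ?thesis by simp
  qed
  have "\<forall>\<^sub>F t in at_top. ereal (\<beta> - L * \<beta> / t) \<le> enn2ereal (\<integral>\<^sup>+ \<omega>. of_nat (card (faults (C0, f) t \<omega>)) \<partial>M) / ereal t"
    using eventually_gt_at_top[of "0::real"]
  proof eventually_elim
    case (elim t)
    define m where "m = nat \<lfloor>t / L\<rfloor>"
    have "real m = of_int \<lfloor>t / L\<rfloor>" unfolding m_def using elim L by simp
    then have m: "real m \<le> t / L" "t / L - 1 \<le> real m" using floor_correct[of "t / L"] by linarith+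
    have mt: "real m * L \<le> t" using m(1) L by (simp add: field_simps)
    have "t * \<beta> - L * \<beta> = (t / L - 1) * (L * \<beta>)" using L by (simp add: field_simps)
    also have "\<dots> \<le> real m * (L * \<beta>)" using m(2) L True by (intro mult_right_mono) auto
    finally have 1: "t * \<beta> - L * \<beta> \<le> real m * (L * \<beta>)" .
    have "ennreal (real m * (L * \<beta>)) = (\<Sum>j<m. ennreal (L * \<beta>))" using L True by (simp add: ennreal_mult ennreal_of_nat_eq_real_of_nat)
    also have "\<dots> \<le> (\<Sum>j<m. emeasure M (block_fault C0 f (real j * L) (real j * L + L)))"
      using block L by (intro sum_mono) (simp add: emeasure_eq_measure ennreal_leI)
    also have "\<dots> = (\<integral>\<^sup>+\<omega>. (\<Sum>j<m. indicator (block_fault C0 f (real j * L) (real j * L + L)) \<omega>) \<partial>M)"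
      by (subst nn_integral_sum) auto
    also have "\<dots> \<le> (\<integral>\<^sup>+ \<omega>. of_nat (card (faults (C0, f) t \<omega>)) \<partial>M)"
      by (intro nn_integral_mono_AE faults_ge_blocks L mt)
    finally have 2: "ennreal (real m * (L * \<beta>)) \<le> (\<integral>\<^sup>+ \<omega>. of_nat (card (faults (C0, f) t \<omega>)) \<partial>M)" .
    have "ereal (t * \<beta> - L * \<beta>) \<le> ereal (real m * (L * \<beta>))" using 1 by simp
    also have "\<dots> = enn2ereal (ennreal (real m * (L * \<beta>)))" using L True by (simp add: enn2ereal_ennreal)
    also have "\<dots> \<le> enn2ereal (\<integral>\<^sup>+ \<omega>. of_nat (card (faults (C0, f) t \<omega>)) \<partial>M)" using 2 by (simp add: less_eq_ennreal.rep_eq)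
    finally have "ereal (t * \<beta> - L * \<beta>) / ereal t \<le> enn2ereal (\<integral>\<^sup>+ \<omega>. of_nat (card (faults (C0, f) t \<omega>)) \<partial>M) / ereal t"
      using elim by (intro ereal_divide_right_mono) auto
    moreover have "ereal (t * \<beta> - L * \<beta>) / ereal t = ereal (\<beta> - L * \<beta> / t)" using elim by (simp add: diff_divide_distrib)
    ultimately show ?case by simp
  qed
  from Limsup_mono[OF this] show ?thesis
    unfolding fault_prob_faults using lim_imp_Limsup[OF _ lim] by simp
qed

section \<open>Upper bound for policies with constant content\<close>

text \<open>\<open>request_law_set\<close> bounds the hits on \<open>G\<close> from below; hits and
  misses add up to the finite mass of \<open>G\<close>, so the misses are bounded from
  above.\<close>

lemma request_outside:
  assumes n: "1 \<le> n" and G: "G \<in> sets (H n)"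
  shows "emeasure M (G \<inter> {\<omega> \<in> space M. R n \<omega> \<notin> C}) \<le> (\<integral>\<^sup>+\<omega>. indicator G \<omega> * ennreal (1 - measure (doc_pmf (J (\<tau> (int n) \<omega>) \<omega>)) C) \<partial>M)"
proof -
  have [measurable]: "G \<in> sets M" using G H_in_M by auto
  let ?A = "{ys. last ys \<in> C}"
  have m [measurable]: "(\<lambda>\<omega>. ennreal (measure (doc_pmf (J (\<tau> (int n) \<omega>) \<omega>)) C)) \<in> borel_measurable M"
    "(\<lambda>\<omega>. ennreal (1 - measure (doc_pmf (J (\<tau> (int n) \<omega>) \<omega>)) C)) \<in> borel_measurable M"
  proof -
    have J: "(\<lambda>\<omega>. J (\<tau> (int n) \<omega>) \<omega>) \<in> measurable M (count_space UNIV)" by measurable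
    show "(\<lambda>\<omega>. ennreal (measure (doc_pmf (J (\<tau> (int n) \<omega>) \<omega>)) C)) \<in> borel_measurable M"
      by (rule measurable_compose[OF J, of "\<lambda>r. ennreal (measure (doc_pmf r) C)"]) simp
    show "(\<lambda>\<omega>. ennreal (1 - measure (doc_pmf (J (\<tau> (int n) \<omega>) \<omega>)) C)) \<in> borel_measurable M"
      by (rule measurable_compose[OF J, of "\<lambda>r. ennreal (1 - measure (doc_pmf r) C)"]) simp
  qed
  have last: "reqs n \<omega> \<in> ?A \<longleftrightarrow> R n \<omega> \<in> C" for \<omega> using n by (simp add: reqs_def)
  have st: "emeasure (seq_pmf doc_pmf (states n \<omega>)) ?A = ennreal (measure (doc_pmf (J (\<tau> (int n) \<omega>) \<omega>)) C)" for \<omega>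
  proof -
    have "states n \<omega> = map (\<lambda>l. J (\<tau> (int l) \<omega>) \<omega>) [1..<n] @ [J (\<tau> (int n) \<omega>) \<omega>]" using n by (simp add: states_def)
    then have "emeasure (seq_pmf doc_pmf (states n \<omega>)) ?A = emeasure (doc_pmf (J (\<tau> (int n) \<omega>) \<omega>)) C"
      by (simp only: emeasure_seq_pmf_last)
    also have "\<dots> = ennreal (measure (doc_pmf (J (\<tau> (int n) \<omega>) \<omega>)) C)" by (rule measure_pmf.emeasure_eq_measure)
    finally show ?thesis .
  qed
  have in_C: "(\<integral>\<^sup>+\<omega>. indicator G \<omega> * ennreal (measure (doc_pmf (J (\<tau> (int n) \<omega>) \<omega>)) C) \<partial>M) \<le> emeasure M (G \<inter> {\<omega> \<in> space M. R n \<omega> \<in> C})"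
    using request_law_set[OF n G, of ?A] unfolding last st .
  have "emeasure M (G \<inter> {\<omega> \<in> space M. R n \<omega> \<in> C}) + emeasure M (G \<inter> {\<omega> \<in> space M. R n \<omega> \<notin> C}) = emeasure M G"
    by (subst plus_emeasure) (auto intro!: arg_cong[of _ _ "emeasure M"] dest: sets.sets_into_space[OF \<open>G \<in> sets M\<close>, THEN subsetD])
  also have "\<dots> = (\<integral>\<^sup>+\<omega>. indicator G \<omega> * ennreal (measure (doc_pmf (J (\<tau> (int n) \<omega>) \<omega>)) C) + indicator G \<omega> * ennreal (1 - measure (doc_pmf (J (\<tau> (int n) \<omega>) \<omega>)) C) \<partial>M)"
    by (subst nn_integral_indicator[symmetric], simp, intro nn_integral_cong)
       (simp add: distrib_left[symmetric] ennreal_plus[symmetric] del: ennreal_plus)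
  also have "\<dots> = (\<integral>\<^sup>+\<omega>. indicator G \<omega> * ennreal (measure (doc_pmf (J (\<tau> (int n) \<omega>) \<omega>)) C) \<partial>M) + (\<integral>\<^sup>+\<omega>. indicator G \<omega> * ennreal (1 - measure (doc_pmf (J (\<tau> (int n) \<omega>) \<omega>)) C) \<partial>M)"
    by (rule nn_integral_add) auto
  also have "\<dots> \<le> emeasure M (G \<inter> {\<omega> \<in> space M. R n \<omega> \<in> C}) + (\<integral>\<^sup>+\<omega>. indicator G \<omega> * ennreal (1 - measure (doc_pmf (J (\<tau> (int n) \<omega>) \<omega>)) C) \<partial>M)"
    by (intro add_right_mono in_C)
  finally show ?thesis by (simp add: emeasure_eq_measure ennreal_add_left_cancel_le)
qed

text \<open>Faults are summed over request indices. That request \<open>n\<close> occurs by time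
  \<open>t\<close> is an event of \<open>H n\<close>, so \<open>request_outside\<close> applies to
  each index; regrouping by state yields the counts \<open>Nr r 0 t\<close>, with means at most
  \<open>\<pi> r * t\<close>.\<close>

lemma constant_content_faults:
  assumes t: "0 < t" and const: "\<And>r n. content (fst pol) (snd pol) r n = C"
  shows "(\<integral>\<^sup>+ \<omega>. of_nat (card (faults pol t \<omega>)) \<partial>M) \<le> ennreal ((\<Sum>r\<in>{1..Ms}. \<pi> r * (1 - measure (doc_pmf r) C)) * t)"
proof -
  let ?g = "\<lambda>r. 1 - measure (doc_pmf r) C"
  let ?G = "\<lambda>n::nat. {\<omega> \<in> space M. 1 \<le> n \<and> \<tau> (int n) \<omega> \<le> t}"
  have G: "?G n \<in> sets (H n)" if "1 \<le> n" for n
    using measurable_sets[OF tau_H[OF that order_refl], of "{..t}"] that by (simp add: vimage_def Int_def conj_commute)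
  have [measurable]: "(\<lambda>\<omega>. ennreal (?g (J (\<tau> (int n) \<omega>) \<omega>))) \<in> borel_measurable M" for n
  proof -
    have J: "(\<lambda>\<omega>. J (\<tau> (int n) \<omega>) \<omega>) \<in> measurable M (count_space UNIV)" by measurable
    show ?thesis by (rule measurable_compose[OF J, of "\<lambda>r. ennreal (?g r)"]) simp
  qed
  have "(\<integral>\<^sup>+ \<omega>. of_nat (card (faults pol t \<omega>)) \<partial>M) = (\<integral>\<^sup>+\<omega>. \<integral>\<^sup>+n. indicator (?G n \<inter> {\<omega> \<in> space M. R n \<omega> \<notin> C}) \<omega> \<partial>count_space UNIV \<partial>M)"
  proof (rule nn_integral_cong_AE)
    show "AE \<omega> in M. of_nat (card (faults pol t \<omega>)) = (\<integral>\<^sup>+n. indicator (?G n \<inter> {\<omega> \<in> space M. R n \<omega> \<notin> C}) \<omega> \<partial>count_space UNIV)"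
      using finite_faults[of pol] tau_path AE_space
    proof eventually_elim
      case (elim \<omega>)
      have nn: "0 \<le> \<tau> (int n) \<omega>" if "1 \<le> n" for n
      proof -
        have "\<tau> 1 \<omega> \<le> \<tau> (int n) \<omega>" using elim(2)[THEN conjunct1, rule_format, of 1 "int n"] that by (cases "n = 1") auto
        moreover have "0 < \<tau> 1 \<omega>" using elim(2) by blast
        ultimately show ?thesis by linarith
      qed
      have fin: "finite (faults pol t \<omega>)" using elim(1) t by simp
      have "(\<integral>\<^sup>+n. indicator (?G n \<inter> {\<omega> \<in> space M. R n \<omega> \<notin> C}) \<omega> \<partial>count_space UNIV) = (\<integral>\<^sup>+n. indicator (faults pol t \<omega>) n \<partial>count_space UNIV)"
        using nn elim(3) by (intro nn_integral_cong) (auto simp: faults_def const indicator_def)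
      also have "\<dots> = of_nat (card (faults pol t \<omega>))" using fin by (simp add: emeasure_count_space)
      finally show ?case by simp
    qed
  qed
  also have "\<dots> = (\<integral>\<^sup>+n. emeasure M (?G n \<inter> {\<omega> \<in> space M. R n \<omega> \<notin> C}) \<partial>count_space UNIV)"
    by (subst nn_integral_count_space_nn_integral) auto
  also have "\<dots> \<le> (\<integral>\<^sup>+n. \<integral>\<^sup>+\<omega>. indicator (?G n) \<omega> * ennreal (?g (J (\<tau> (int n) \<omega>) \<omega>)) \<partial>M \<partial>count_space UNIV)"
  proof (rule nn_integral_mono)
    fix n :: nat
    show "emeasure M (?G n \<inter> {\<omega> \<in> space M. R n \<omega> \<notin> C}) \<le> (\<integral>\<^sup>+\<omega>. indicator (?G n) \<omega> * ennreal (?g (J (\<tau> (int n) \<omega>) \<omega>)) \<partial>M)"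
      using request_outside[OF _ G, of n C] by (cases "1 \<le> n") auto
  qed
  also have "\<dots> = (\<integral>\<^sup>+\<omega>. \<integral>\<^sup>+n. indicator (?G n) \<omega> * ennreal (?g (J (\<tau> (int n) \<omega>) \<omega>)) \<partial>count_space UNIV \<partial>M)"
    by (subst nn_integral_count_space_nn_integral) auto
  also have "\<dots> = (\<integral>\<^sup>+\<omega>. (\<Sum>r\<in>{1..Ms}. ennreal (?g r) * of_nat (Nr r 0 t \<omega>)) \<partial>M)"
  proof (rule nn_integral_cong_AE)
    show "AE \<omega> in M. (\<integral>\<^sup>+n. indicator (?G n) \<omega> * ennreal (?g (J (\<tau> (int n) \<omega>) \<omega>)) \<partial>count_space UNIV) = (\<Sum>r\<in>{1..Ms}. ennreal (?g r) * of_nat (Nr r 0 t \<omega>))"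
      using request_enumeration points_in_block J_range tau_path AE_space
    proof eventually_elim
      case (elim \<omega>)
      let ?K = "Kc t \<omega>"
      have K0: "Kc 0 \<omega> = 0"
      proof (rule ccontr)
        assume "Kc 0 \<omega> \<noteq> 0"
        then have "\<tau> (int 1) \<omega> \<le> 0" using elim(1)[rule_format, of 0 1] by simp
        then show False using elim(4) by simp
      qed
      have "indicator (?G n) \<omega> * ennreal (?g (J (\<tau> (int n) \<omega>) \<omega>)) = (\<Sum>r\<in>{1..Ms}. ennreal (?g r) * indicator {l. 1 \<le> l \<and> l \<le> ?K \<and> J (\<tau> (int l) \<omega>) \<omega> = r} n)" for n
      proof -
        have "\<omega> \<in> ?G n \<longleftrightarrow> 1 \<le> n \<and> n \<le> ?K" using elim(1)[rule_format, of t n] t elim(5) by auto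
        then have "ennreal (?g r) * indicator {l. 1 \<le> l \<and> l \<le> ?K \<and> J (\<tau> (int l) \<omega>) \<omega> = r} n = (if r = J (\<tau> (int n) \<omega>) \<omega> then indicator (?G n) \<omega> * ennreal (?g r) else 0)" for r
          by (simp add: indicator_def)
        moreover have "J (\<tau> (int n) \<omega>) \<omega> \<in> {1..Ms}" using elim(3) by blast
        ultimately show ?thesis by (simp add: sum.delta)
      qed
      then have "(\<integral>\<^sup>+n. indicator (?G n) \<omega> * ennreal (?g (J (\<tau> (int n) \<omega>) \<omega>)) \<partial>count_space UNIV)
         = (\<Sum>r\<in>{1..Ms}. ennreal (?g r) * emeasure (count_space UNIV) {l. 1 \<le> l \<and> l \<le> ?K \<and> J (\<tau> (int l) \<omega>) \<omega> = r})"
        by (simp only:) (subst nn_integral_sum, simp, intro sum.cong refl, subst nn_integral_cmult, simp, subst nn_integral_indicator, simp_all)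
      also have "\<dots> = (\<Sum>r\<in>{1..Ms}. ennreal (?g r) * of_nat (Nr r 0 t \<omega>))"
      proof (intro sum.cong refl arg_cong2[of _ _ _ _ "(*)"])
        fix r
        have fin: "finite {l. 1 \<le> l \<and> l \<le> ?K \<and> J (\<tau> (int l) \<omega>) \<omega> = r}" by (rule finite_subset[of _ "{..?K}"]) auto
        have "{n. 0 < \<tau> n \<omega> \<and> \<tau> n \<omega> \<le> 0 + t \<and> J (\<tau> n \<omega>) \<omega> = r} = int ` {l. Suc (Kc 0 \<omega>) \<le> l \<and> l < Suc (Kc (0 + t) \<omega>) \<and> J (\<tau> (int l) \<omega>) \<omega> = r}"
          using elim(2)[rule_format, of 0 t, THEN conjunct2, rule_format, of "\<lambda>n. J (\<tau> n \<omega>) \<omega> = r"] t by simp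
        also have "{l. Suc (Kc 0 \<omega>) \<le> l \<and> l < Suc (Kc (0 + t) \<omega>) \<and> J (\<tau> (int l) \<omega>) \<omega> = r} = {l. 1 \<le> l \<and> l \<le> ?K \<and> J (\<tau> (int l) \<omega>) \<omega> = r}"
          by (auto simp: K0)
        finally have "Nr r 0 t \<omega> = card {l. 1 \<le> l \<and> l \<le> ?K \<and> J (\<tau> (int l) \<omega>) \<omega> = r}"
          unfolding Nr_def by (simp only:) (rule card_image, simp)
        then show "emeasure (count_space UNIV) {l. 1 \<le> l \<and> l \<le> ?K \<and> J (\<tau> (int l) \<omega>) \<omega> = r} = of_nat (Nr r 0 t \<omega>)"
          using fin by simp
      qed
      finally show ?case .
    qed
  qed
  also have "\<dots> = (\<Sum>r\<in>{1..Ms}. ennreal (?g r) * (\<integral>\<^sup>+\<omega>. of_nat (Nr r 0 t \<omega>) \<partial>M))"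
    by (subst nn_integral_sum) (auto simp: nn_integral_cmult)
  also have "\<dots> \<le> (\<Sum>r\<in>{1..Ms}. ennreal (?g r) * ennreal (\<pi> r * t))"
    by (intro sum_mono mult_left_mono count_first_moment t) auto
  also have "\<dots> = ennreal ((\<Sum>r\<in>{1..Ms}. \<pi> r * ?g r) * t)"
    using t by (simp add: ennreal_mult[symmetric] sum_ennreal \<pi>_def stat_dist_def sum_distrib_right sum_distrib_left mult_ac)
  finally show ?thesis .
qed

lemma fault_prob_constant_content:
  assumes const: "\<And>r n. content (fst pol) (snd pol) r n = C"
  shows "fault_prob M \<tau> R pol \<le> ereal (\<Sum>r\<in>{1..Ms}. \<pi> r * (1 - measure (doc_pmf r) C))"
proof -
  let ?S = "\<Sum>r\<in>{1..Ms}. \<pi> r * (1 - measure (doc_pmf r) C)"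
  have S0: "0 \<le> ?S" by (intro sum_nonneg mult_nonneg_nonneg) (auto simp: \<pi>_def stat_dist_def)
  have "\<forall>\<^sub>F t in at_top. enn2ereal (\<integral>\<^sup>+ \<omega>. of_nat (card (faults pol t \<omega>)) \<partial>M) / ereal t \<le> ereal ?S"
    using eventually_gt_at_top[of "0::real"]
  proof eventually_elim
    case (elim t)
    have "enn2ereal (\<integral>\<^sup>+ \<omega>. of_nat (card (faults pol t \<omega>)) \<partial>M) \<le> enn2ereal (ennreal (?S * t))"
      using constant_content_faults[OF elim const] by (simp add: less_eq_ennreal.rep_eq)
    also have "\<dots> = ereal (?S * t)" using S0 elim by (simp add: enn2ereal_ennreal)
    finally have "enn2ereal (\<integral>\<^sup>+ \<omega>. of_nat (card (faults pol t \<omega>)) \<partial>M) / ereal t \<le> ereal (?S * t) / ereal t"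
      using elim by (intro ereal_divide_right_mono) auto
    then show ?case using elim by simp
  qed
  then show ?thesis unfolding fault_prob_faults by (rule Limsup_bounded)
qed

text \<open>Faults depend on a policy only through its contents, which permits replacing the static
  rule by one that is admissible on every history.\<close>

lemma fault_prob_cong:
  assumes "\<And>r n. content (fst pol) (snd pol) r n = content (fst pol') (snd pol') r n"
  shows "fault_prob M \<tau> R pol = fault_prob M \<tau> R pol'"
  unfolding fault_prob_faults faults_def by (simp add: assms)

section \<open>Popularities, the knapsack bound and the static set\<close>

abbreviation "pop \<equiv> avg_pop M Ms J q"

lemma sum_pi: "(\<Sum>r\<in>{1..Ms}. \<pi> r) = 1"
proof -
  have "(\<Sum>r\<in>{1..Ms}. \<pi> r) = measure M (\<Union>r\<in>{1..Ms}. {\<omega> \<in> space M. J 0 \<omega> = r})"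
    unfolding \<pi>_def stat_dist_def
    by (rule finite_measure_finite_Union[symmetric]) (auto simp: disjoint_family_on_def)
  also have "\<dots> = measure M (space M)"
  proof (rule finite_measure_eq_AE)
    show "AE \<omega> in M. (\<omega> \<in> (\<Union>r\<in>{1..Ms}. {\<omega> \<in> space M. J 0 \<omega> = r})) = (\<omega> \<in> space M)"
      using J_range by eventually_elim blast
  qed measurable
  finally show ?thesis by (simp add: prob_space)
qed

text \<open>The mean miss probability sees the states only through the popularities, which reduces
  the choice of a content to a knapsack problem with fixed values.\<close>

lemma miss_prob:
  assumes "finite C" "C \<subseteq> {1..}"
  shows "(\<Sum>r\<in>{1..Ms}. \<pi> r * (1 - measure (doc_pmf r) C)) = 1 - (\<Sum>i\<in>C. pop i)"
proof -
  have "measure (doc_pmf r) C = (\<Sum>i\<in>C. q r i)" if "r \<in> {1..Ms}" for r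
  proof -
    have "measure (doc_pmf r) C = (\<Sum>i\<in>C. pmf (doc_pmf r) i)" by (rule measure_measure_pmf_finite[OF assms(1)])
    also have "\<dots> = (\<Sum>i\<in>C. q r i)" using assms(2) that by (intro sum.cong) (auto simp: pmf_doc_pmf)
    finally show ?thesis .
  qed
  then have "(\<Sum>r\<in>{1..Ms}. \<pi> r * (1 - measure (doc_pmf r) C)) = (\<Sum>r\<in>{1..Ms}. \<pi> r - (\<Sum>i\<in>C. \<pi> r * q r i))"
    by (intro sum.cong) (simp_all add: right_diff_distrib sum_distrib_left)
  also have "\<dots> = 1 - (\<Sum>r\<in>{1..Ms}. \<Sum>i\<in>C. \<pi> r * q r i)" by (simp only: sum_subtractf sum_pi)
  also have "(\<Sum>r\<in>{1..Ms}. \<Sum>i\<in>C. \<pi> r * q r i) = (\<Sum>i\<in>C. pop i)"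
    unfolding avg_pop_def \<pi>_def by (rule sum.swap)
  finally show ?thesis .
qed

lemma pop_sums: "(\<lambda>i. pop (Suc i)) sums 1"
proof -
  have "(\<lambda>i. \<Sum>r\<in>{1..Ms}. \<pi> r * q r (Suc i)) sums (\<Sum>r\<in>{1..Ms}. \<pi> r * 1)"
    by (intro sums_sum sums_mult q_sums)
  then show ?thesis using sum_pi by (simp add: avg_pop_def \<pi>_def)
qed

lemma pop_tail: "(\<Sum>j. pop (m + 1 + j)) = 1 - (\<Sum>i\<in>{1..m}. pop i)"
proof -
  have "(\<Sum>i. pop (Suc i)) = (\<Sum>i. pop (Suc (i + m))) + (\<Sum>i<m. pop (Suc i))"
    using suminf_split_initial_segment[OF sums_summable[OF pop_sums], of m] by simp
  moreover have "(\<Sum>i<m. pop (Suc i)) = (\<Sum>i\<in>{1..m}. pop i)"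
    by (rule sum.reindex_bij_witness[of _ "\<lambda>i. i - 1" Suc]) auto
  ultimately show ?thesis using sums_unique[OF pop_sums] by (simp add: add.commute)
qed

end

text \<open>The fractional relaxation of the knapsack problem.\<close>
lemma knapsack_bound:
  fixes Q s :: "nat \<Rightarrow> real"
  assumes s: "\<And>i. 1 \<le> i \<Longrightarrow> 0 < s i" and Q: "\<And>i. 1 \<le> i \<Longrightarrow> 0 \<le> Q i"
    and ratio: "\<And>i. 1 \<le> i \<Longrightarrow> Q (Suc i) / s (Suc i) \<le> Q i / s i"
    and C: "cache_ok s x C" and n: "1 \<le> n" "x < (\<Sum>i\<in>{1..n}. s i)"
  shows "(\<Sum>i\<in>C. Q i) \<le> (\<Sum>i\<in>{1..n}. Q i)"
proof -
  have fin: "finite C" and sub: "C \<subseteq> {1..}" and size: "(\<Sum>i\<in>C. s i) \<le> x" using C by (auto simp: cache_ok_def)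
  have mono: "Q j / s j \<le> Q i / s i" if "1 \<le> i" "i \<le> j" for i j
    using that(2)
  proof (induction j rule: dec_induct)
    case (step k)
    then show ?case using ratio[of k] that(1) by (auto intro: order_trans)
  qed simp
  \<comment> \<open>The value per unit of size of document \<open>n\<close>: members of
    \<open>C\<close> outside \<open>{1..n}\<close> offer at most \<open>l\<close>, documents in
    \<open>{1..n}\<close> at least \<open>l\<close>.\<close>
  define l where "l = Q n / s n"
  have l: "0 \<le> l" using Q[OF n(1)] s[OF n(1)] by (simp add: l_def)
  have split: "sum h C = sum h (C \<inter> {1..n}) + sum h (C - {1..n})" "sum h {1..n} = sum h (C \<inter> {1..n}) + sum h ({1..n} - C)" for h :: "nat \<Rightarrow> real"
    using sum.Int_Diff[OF fin, of h "{1..n}"] sum.Int_Diff[of "{1..n}" h C] by (simp_all add: Int_commute)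
  have "(\<Sum>i\<in>C - {1..n}. Q i) \<le> (\<Sum>i\<in>C - {1..n}. l * s i)"
  proof (rule sum_mono)
    fix i assume i: "i \<in> C - {1..n}"
    then have "1 \<le> i" "n \<le> i" using sub by auto
    then show "Q i \<le> l * s i" using mono[OF n(1), of i] s[of i] by (simp add: l_def pos_divide_le_eq)
  qed
  also have "\<dots> = l * (\<Sum>i\<in>C - {1..n}. s i)" by (simp add: sum_distrib_left)
  \<comment> \<open>\<open>C\<close> has smaller total size than \<open>{1..n}\<close>, and removing
    the common part from both preserves this.\<close>
  also have "\<dots> \<le> l * (\<Sum>i\<in>{1..n} - C. s i)"
    using split[of s] size n(2) l by (intro mult_left_mono) linarith+
  also have "\<dots> = (\<Sum>i\<in>{1..n} - C. l * s i)" by (simp add: sum_distrib_left)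
  also have "\<dots> \<le> (\<Sum>i\<in>{1..n} - C. Q i)"
  proof (rule sum_mono)
    fix i assume i: "i \<in> {1..n} - C"
    then have "1 \<le> i" "i \<le> n" by auto
    then show "l * s i \<le> Q i" using mono[of i n] s[of i] by (simp add: l_def pos_le_divide_eq)
  qed
  finally show ?thesis using split[of Q] by linarith
qed

text \<open>Sizes bounded away from 0 bound the number of stored documents, so the
  \<open>GREATEST\<close> exists. The upper bound on sizes gives
  \<open>x < real (Suc m) * hi\<close>, which forces \<open>m\<close> to grow with
  \<open>x\<close>.\<close>

lemma static_set_props:
  fixes s :: "nat \<Rightarrow> real"
  assumes lo: "0 < lo" "\<And>i. 1 \<le> i \<Longrightarrow> lo \<le> s i" and hi: "\<And>i. 1 \<le> i \<Longrightarrow> s i \<le> hi" and x: "0 \<le> x"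
  obtains m where "static_set s x = {1..m}" "cache_ok s x {1..m}" "x < (\<Sum>i\<in>{1..Suc m}. s i)" "x < real (Suc m) * hi"
proof -
  let ?P = "\<lambda>m. (\<Sum>i = 1..m. s i) \<le> x"
  let ?m = "GREATEST m. ?P m"
  have bound: "\<forall>y. ?P y \<longrightarrow> y \<le> nat \<lfloor>x / lo\<rfloor>"
  proof (intro allI impI)
    fix y assume y: "?P y"
    have "real y * lo = (\<Sum>i = 1..y. lo)" by simp
    also have "\<dots> \<le> (\<Sum>i = 1..y. s i)" using lo by (intro sum_mono) auto
    finally have "real y \<le> x / lo" using y lo(1) by (simp add: field_simps)
    then show "y \<le> nat \<lfloor>x / lo\<rfloor>" by (simp add: le_nat_floor)
  qed
  have P0: "?P 0" using x by simp
  have Pm: "?P ?m" by (rule GreatestI_nat[of ?P 0 "nat \<lfloor>x / lo\<rfloor>", OF P0 bound[rule_format]])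
  have nP: "\<not> ?P (Suc ?m)"
  proof
    assume "?P (Suc ?m)"
    from Greatest_le_nat[of ?P "Suc ?m" "nat \<lfloor>x / lo\<rfloor>", OF this bound[rule_format]] show False by simp
  qed
  show ?thesis
  proof (rule that[of ?m])
    show "static_set s x = {1..?m}" by (simp add: static_set_def)
    show "cache_ok s x {1..?m}" using Pm by (auto simp: cache_ok_def)
    show lt: "x < (\<Sum>i\<in>{1..Suc ?m}. s i)" using nP by simp
    also have "\<dots> \<le> (\<Sum>i\<in>{1..Suc ?m}. hi)" using hi by (intro sum_mono) auto
    finally show "x < real (Suc ?m) * hi" by simp
  qed
qed

section \<open>Comparison of the static policy with the infimum over all policies\<close>

context request_sampling begin

lemma static_policy_asymptotically_optimal:
  assumes pi_pos: "\<And>r. r \<in> {1..Ms} \<Longrightarrow> 0 < \<pi> r"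
    and pop_pos: "\<And>i. 1 \<le> i \<Longrightarrow> 0 < pop i"
    and s: "finite \<Sigma>" "\<And>\<sigma>. \<sigma> \<in> \<Sigma> \<Longrightarrow> 0 < \<sigma>" "\<And>i. 1 \<le> i \<Longrightarrow> s i \<in> \<Sigma>"
    and ratio: "\<And>i. 1 \<le> i \<Longrightarrow> pop (Suc i) / s (Suc i) \<le> pop i / s i"
    and tail: "(\<lambda>i. \<Sum>j. pop (i + 1 + j)) \<sim>[at_top] (\<lambda>i. \<Sum>j. pop (i + j))"
  shows "(\<lambda>x. real_of_ereal (fault_prob M \<tau> R (static_policy s x)))
           \<sim>[at_top] (\<lambda>x. real_of_ereal (INF p \<in> policies s x. fault_prob M \<tau> R p))"
proof -
  have ne: "\<Sigma> \<noteq> {}" using s(3)[of 1] by auto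
  define lo where "lo = Min \<Sigma>"
  define hi where "hi = Max \<Sigma>"
  have lo: "0 < lo" "\<And>i. 1 \<le> i \<Longrightarrow> lo \<le> s i" and hi: "\<And>i. 1 \<le> i \<Longrightarrow> s i \<le> hi"
    using s ne by (auto simp: lo_def hi_def)
  have hi0: "0 < hi" using lo(1) lo(2)[of 1] hi[of 1] by simp
  define tl where "tl m = 1 - (\<Sum>i\<in>{1..m}. pop i)" for m
  have tl_pos: "0 < tl m" for m
  proof -
    have "summable (\<lambda>j. pop (m + 1 + j))"
      using summable_ignore_initial_segment[OF sums_summable[OF pop_sums], of m] by (simp add: add.commute)
    then have "0 < (\<Sum>j. pop (m + 1 + j))" using pop_pos by (intro suminf_pos) auto
    then show ?thesis by (simp only: tl_def pop_tail)
  qed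
  have tl_anti: "tl (Suc m) \<le> tl m" for m using pop_pos[of "Suc m"] by (simp add: tl_def)
  have ratio_lim: "(\<lambda>m. tl (Suc m) / tl m) \<longlonglongrightarrow> 1"
  proof -
    have "(\<lambda>i. (\<Sum>j. pop (i + 1 + j)) / (\<Sum>j. pop (i + j))) \<longlonglongrightarrow> 1"
    proof (rule asymp_equivD_strong[OF tail], rule always_eventually, rule allI, rule disjI1)
      show "(\<Sum>j. pop (i + 1 + j)) \<noteq> 0" for i
        unfolding pop_tail tl_def[symmetric] using tl_pos[of i] by simp
    qed
    \<comment> \<open>The tails in the hypothesis start at \<open>i + 1\<close> and at
      \<open>i\<close>. Taking \<open>i = Suc m\<close> makes them \<open>tl (Suc m)\<close> and
      \<open>tl m\<close> and avoids \<open>i = 0\<close>, where \<open>pop 0\<close> would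
      enter.\<close>
    from LIMSEQ_Suc[OF this] show ?thesis
    proof (rule Lim_transform_eventually[OF _ always_eventually], intro allI)
      fix m
      show "(\<Sum>j. pop (Suc m + 1 + j)) / (\<Sum>j. pop (Suc m + j)) = tl (Suc m) / tl m"
        using pop_tail[of m] pop_tail[of "Suc m"] by (simp add: tl_def)
    qed
  qed
  have tl0: "tl \<longlonglongrightarrow> 0"
  proof -
    have "(\<lambda>m. \<Sum>i<m. pop (Suc i)) \<longlonglongrightarrow> 1" using pop_sums by (simp add: sums_def)
    then have "(\<lambda>m. 1 - (\<Sum>i<m. pop (Suc i))) \<longlonglongrightarrow> 1 - 1" by (intro tendsto_intros)
    moreover have "(\<Sum>i<m. pop (Suc i)) = (\<Sum>i\<in>{1..m}. pop i)" for m
      by (rule sum.reindex_bij_witness[of _ "\<lambda>i. i - 1" Suc]) auto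
    ultimately show ?thesis by (simp add: tl_def[abs_def])
  qed
  define f where "f x = real_of_ereal (fault_prob M \<tau> R (static_policy s x))" for x
  define g where "g x = real_of_ereal (INF p \<in> policies s x. fault_prob M \<tau> R p)" for x
  have main: "\<forall>\<^sub>F x in at_top. 0 < g x \<and> g x \<le> f x \<and> f x \<le> (1 + \<eta>) * g x" if \<eta>: "0 < \<eta>" "\<eta> \<le> 1" for \<eta>
  proof -
    \<comment> \<open>One \<open>\<epsilon>\<close> is lost in the ratio of consecutive tails, one
      in the block estimate and one in its quadratic term. With
      \<open>\<eta> = 8 * \<epsilon>\<close> there is room for
      \<open>1 + \<epsilon> \<le> (1 + \<eta>) * (1 - 2 * \<epsilon>)\<close>.\<close>
    define \<epsilon> where "\<epsilon> = \<eta> / 8"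
    have \<epsilon>: "0 < \<epsilon>" "\<epsilon> \<le> 1 / 8" using \<eta> by (auto simp: \<epsilon>_def)
    obtain L D where L: "0 < L" and D: "0 \<le> D" and blk: "\<And>a C0 f s x \<delta>. 0 \<le> a \<Longrightarrow> 0 < \<delta> \<Longrightarrow> (C0, f) \<in> policies s x \<Longrightarrow>
      (\<And>C. cache_ok s x C \<Longrightarrow> \<delta> \<le> (\<Sum>r\<in>{1..Ms}. \<pi> r * (1 - measure (doc_pmf r) C))) \<Longrightarrow>
      L * (\<delta> * (1 - \<epsilon>) - D * \<delta>\<^sup>2) \<le> measure M (block_fault C0 f a (a + L))"
      by (rule uniform_block_bound[OF pi_pos \<epsilon>(1)]) blast+
    have "\<forall>\<^sub>F m in sequentially. 1 / (1 + \<epsilon>) < tl (Suc m) / tl m" using ratio_lim \<epsilon> by (intro order_tendstoD) auto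
    moreover have "\<forall>\<^sub>F m in sequentially. tl m < \<epsilon> / (D + 1)" using tl0 \<epsilon> D by (intro order_tendstoD) auto
    ultimately have "\<forall>\<^sub>F m in sequentially. 1 / (1 + \<epsilon>) < tl (Suc m) / tl m \<and> tl m < \<epsilon> / (D + 1)" by (rule eventually_conj)
    then obtain m0 where m0: "\<And>m. m \<ge> m0 \<Longrightarrow> 1 / (1 + \<epsilon>) < tl (Suc m) / tl m" "\<And>m. m \<ge> m0 \<Longrightarrow> tl m < \<epsilon> / (D + 1)"
      unfolding eventually_sequentially by blast
    have "\<forall>\<^sub>F x in at_top. real (Suc m0) * hi \<le> x" by (rule eventually_ge_at_top)
    then show ?thesis
    proof eventually_elim
      case (elim x)
      have "0 \<le> real (Suc m0) * hi" using hi0 by simp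
      then have x: "0 \<le> x" using elim by linarith
      obtain m where m: "static_set s x = {1..m}" "cache_ok s x {1..m}" "x < (\<Sum>i\<in>{1..Suc m}. s i)" "x < real (Suc m) * hi"
        by (rule static_set_props[OF lo hi x]) blast+
      \<comment> \<open>The threshold on \<open>x\<close> was chosen for this comparison, which
        yields \<open>m0 \<le> m\<close>.\<close>
      have "real (Suc m0) * hi < real (Suc m) * hi" using elim m(4) by linarith
      then have mm0: "m0 \<le> m" using hi0 by simp
      \<comment> \<open>The index \<open>Suc m\<close> is forced by the knapsack bound, which needs
        a total size strictly above \<open>x\<close>.\<close>
      define \<delta> where "\<delta> = tl (Suc m)"
      have \<delta>: "0 < \<delta>" unfolding \<delta>_def by (rule tl_pos)
      have knap: "\<delta> \<le> (\<Sum>r\<in>{1..Ms}. \<pi> r * (1 - measure (doc_pmf r) C))" if C: "cache_ok s x C" for C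
      proof -
        have "(\<Sum>i\<in>C. pop i) \<le> (\<Sum>i\<in>{1..Suc m}. pop i)"
        proof (rule knapsack_bound[OF _ _ ratio C _ m(3)])
          show "0 < s i" if "1 \<le> i" for i using lo(1) lo(2)[OF that] by linarith
          show "0 \<le> pop i" if "1 \<le> i" for i using pop_pos[OF that] by simp
        qed auto
        moreover have "finite C" "C \<subseteq> {1..}" using C by (auto simp: cache_ok_def)
        ultimately show ?thesis unfolding \<delta>_def tl_def by (subst miss_prob) auto
      qed
      have lower: "ereal (\<delta> * (1 - \<epsilon>) - D * \<delta>\<^sup>2) \<le> fault_prob M \<tau> R pol" if pol: "pol \<in> policies s x" for pol
      proof -
        obtain C0 h where p: "pol = (C0, h)" by force
        show ?thesis unfolding p
          by (rule fault_prob_ge[OF L]) (rule blk[OF _ \<delta> pol[unfolded p] knap])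
      qed
      have "content (fst (static_policy s x)) (snd (static_policy s x)) r n = {1..m}" for r n
        by (simp add: static_policy_def content_last m(1))
      note static = this
      have upper: "fault_prob M \<tau> R (static_policy s x) \<le> ereal (tl m)"
      proof -
        have "fault_prob M \<tau> R (static_policy s x) \<le> ereal (\<Sum>r\<in>{1..Ms}. \<pi> r * (1 - measure (doc_pmf r) {1..m}))"
          by (rule fault_prob_constant_content[OF static])
        also have "(\<Sum>r\<in>{1..Ms}. \<pi> r * (1 - measure (doc_pmf r) {1..m})) = tl m"
          unfolding tl_def by (rule miss_prob) auto
        finally show ?thesis .
      qed
      \<comment> \<open>\<open>static_policy s x\<close> is not itself in \<open>policies s x\<close>: its rule \<open>last cs\<close> may exceed the cache on a history that never occurs.\<close>
      define pol where "pol = ({1..m}, \<lambda>(rs :: nat list) (cs :: nat set list). {1..m})"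
      have pol_in: "pol \<in> policies s x" using m(2) by (simp add: policies_def pol_def)
      have eq: "fault_prob M \<tau> R pol = fault_prob M \<tau> R (static_policy s x)"
        by (rule fault_prob_cong) (simp only: static, simp add: pol_def content_constant)
      let ?I = "INF p \<in> policies s x. fault_prob M \<tau> R p"
      have I_le: "?I \<le> fault_prob M \<tau> R (static_policy s x)" unfolding eq[symmetric] by (rule INF_lower[OF pol_in])
      have I_ge: "ereal (\<delta> * (1 - \<epsilon>) - D * \<delta>\<^sup>2) \<le> ?I" by (rule INF_greatest) (rule lower)
      \<comment> \<open>Both extended reals lie between real bounds, so \<open>real_of_ereal\<close>
        returns their true values.\<close>
      obtain vf where vf: "fault_prob M \<tau> R (static_policy s x) = ereal vf"
        using upper order_trans[OF I_ge I_le] by (cases "fault_prob M \<tau> R (static_policy s x)") auto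
      obtain vg where vg: "?I = ereal vg" using I_ge I_le vf by (cases ?I) auto
      have fx: "f x = vf" and gx: "g x = vg" by (simp_all add: f_def g_def vf vg)
      have gf: "g x \<le> f x" using I_le unfolding vf vg fx gx by simp
      have fm: "f x \<le> tl m" using upper unfolding vf fx by simp
      have gm: "\<delta> * (1 - \<epsilon>) - D * \<delta>\<^sup>2 \<le> g x" using I_ge unfolding vg gx by simp
      have "\<delta> \<le> tl m" unfolding \<delta>_def by (rule tl_anti)
      then have "\<delta> < \<epsilon> / (D + 1)" using m0(2)[OF mm0] by linarith
      \<comment> \<open>The threshold \<open>\<epsilon> / (D + 1)\<close> makes the quadratic term
        \<open>D * \<delta>\<^sup>2\<close> at most \<open>\<epsilon> * \<delta>\<close>; the added
        1 is there because \<open>D\<close> is only known to be nonnegative.\<close>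
      then have "(D + 1) * \<delta> \<le> \<epsilon>" using D by (simp add: field_simps)
      then have "D * \<delta> \<le> \<epsilon>" using \<delta> by (simp add: distrib_right)
      then have "\<delta> * (D * \<delta>) \<le> \<delta> * \<epsilon>" using \<delta> by (intro mult_left_mono) auto
      then have gd: "\<delta> * (1 - 2 * \<epsilon>) \<le> g x" using gm by (simp add: power2_eq_square algebra_simps)
      have "0 < \<delta> * (1 - 2 * \<epsilon>)" using \<delta> \<epsilon> by (intro mult_pos_pos) auto
      then have g0: "0 < g x" using gd by linarith
      have "tl m \<le> (1 + \<epsilon>) * \<delta>" using m0(1)[OF mm0] tl_pos[of m] \<epsilon> by (simp add: \<delta>_def field_simps)
      then have "f x \<le> (1 + \<epsilon>) * \<delta>" using fm by linarith
      also have "\<dots> \<le> ((1 + \<eta>) * (1 - 2 * \<epsilon>)) * \<delta>"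
      proof (rule mult_right_mono)
        have "\<eta> * \<epsilon> \<le> 1 * \<epsilon>" using \<eta> \<epsilon> by (intro mult_right_mono) auto
        moreover have "(1 + \<eta>) * (1 - 2 * \<epsilon>) = 1 + \<eta> - 2 * \<epsilon> - 2 * (\<eta> * \<epsilon>)" by (simp add: algebra_simps)
        moreover have "\<eta> = 8 * \<epsilon>" by (simp add: \<epsilon>_def)
        ultimately show "1 + \<epsilon> \<le> (1 + \<eta>) * (1 - 2 * \<epsilon>)" using \<epsilon> by linarith
      qed (use \<delta> in simp)
      also have "\<dots> = (1 + \<eta>) * (\<delta> * (1 - 2 * \<epsilon>))" by simp
      also have "\<dots> \<le> (1 + \<eta>) * g x" using gd \<eta> by (intro mult_left_mono) auto
      finally show "0 < g x \<and> g x \<le> f x \<and> f x \<le> (1 + \<eta>) * g x" using g0 gf by blast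
    qed
  qed
  have "((\<lambda>x. f x / g x) \<longlongrightarrow> 1) at_top"
  proof (rule tendstoI)
    fix e :: real assume e: "0 < e"
    define \<eta> where "\<eta> = min 1 (e / 2)"
    have "0 < \<eta>" "\<eta> \<le> 1" "\<eta> < e" using e by (auto simp: \<eta>_def min_def)
    from main[OF this(1,2)] show "\<forall>\<^sub>F x in at_top. dist (f x / g x) 1 < e"
    proof eventually_elim
      case (elim x)
      then have "1 \<le> f x / g x" "f x / g x \<le> 1 + \<eta>" by (auto simp: pos_le_divide_eq pos_divide_le_eq)
      then show ?case using \<open>\<eta> < e\<close> by (simp add: dist_real_def)
    qed
  qed
  then have "f \<sim>[at_top] g" by (rule asymp_equivI')
  then show ?thesis unfolding f_def[abs_def] g_def[abs_def] .
qed

end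

theorem theorem3:
  fixes M :: "'a measure" and Ms :: nat
    and \<tau> :: "int \<Rightarrow> 'a \<Rightarrow> real"
    and J :: "real \<Rightarrow> 'a \<Rightarrow> nat" and T :: "int \<Rightarrow> 'a \<Rightarrow> real"
    and R :: "nat \<Rightarrow> 'a \<Rightarrow> nat" and q :: "nat \<Rightarrow> nat \<Rightarrow> real"
    and s :: "nat \<Rightarrow> real" and \<Sigma> :: "real set"
  assumes "prob_space M"
    and "unit_poisson M \<tau>"
    and "semi_markov M Ms J T"
    and "stationary_ergodic M J"
    and "indep_J_tau M J \<tau>"
    and "\<forall>r \<in> {1..Ms}. stat_dist M J r > 0"
    and "request_model M Ms J \<tau> R q"
    and "\<forall>i \<ge> 1. avg_pop M Ms J q i > 0"
    and "finite \<Sigma>" and "\<forall>\<sigma> \<in> \<Sigma>. 0 < \<sigma>" and "\<forall>i \<ge> 1. s i \<in> \<Sigma>"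
    and "\<forall>i \<ge> 1. avg_pop M Ms J q (Suc i) / s (Suc i) \<le> avg_pop M Ms J q i / s i"
    and "(\<lambda>i. \<Sum>j. avg_pop M Ms J q (i + 1 + j)) \<sim>[at_top] (\<lambda>i. \<Sum>j. avg_pop M Ms J q (i + j))"
  shows "(\<lambda>x. real_of_ereal (fault_prob M \<tau> R (static_policy s x)))
           \<sim>[at_top] (\<lambda>x. real_of_ereal (INF p \<in> policies s x. fault_prob M \<tau> R p))"
proof -
  note sm = assms(3)[unfolded semi_markov_def]
  obtain Q P where QP:
    "\<forall>n \<ge> 1. \<forall>j t. AE \<omega> in M. real_cond_exp M (mr_filt M J T n)
             (indicator {\<omega> \<in> space M. J (T (n + 1) \<omega>) \<omega> = j \<and> T (n + 1) \<omega> - T n \<omega> \<le> t}) \<omega>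
           = Q (J (T n \<omega>) \<omega>) j t"
    "\<forall>n \<ge> 1. \<forall>j. AE \<omega> in M. real_cond_exp M (mr_filt M J T n)
             (indicator {\<omega> \<in> space M. J (T (n + 1) \<omega>) \<omega> = j}) \<omega> = P (J (T n \<omega>) \<omega>) j"
    "\<forall>i \<in> {1..Ms}. \<forall>j \<in> {1..Ms}. (i, j) \<in> {(a, b). P a b > (0 :: real)}\<^sup>*"
    using sm by (elim conjE exE) (rule that)
  interpret prob_space M by (rule assms(1))
  interpret request_sampling M Ms J T Q P \<tau> R q
  proof unfold_locales
    show "(\<lambda>(t, \<omega>). J t \<omega>) \<in> measurable (borel \<Otimes>\<^sub>M M) (count_space UNIV)" using sm by (elim conjE)
    show "T n \<in> borel_measurable M" for n using sm by (elim conjE) (erule spec)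
    show "AE \<omega> in M. strict_mono (\<lambda>n. T n \<omega>) \<and> T 0 \<omega> \<le> 0 \<and> 0 < T 1 \<omega> \<and>
        (\<forall>t. \<exists>n. T n \<omega> \<le> t \<and> t < T (n + 1) \<omega>) \<and>
        (\<forall>n t. T n \<omega> \<le> t \<and> t < T (n + 1) \<omega> \<longrightarrow> J t \<omega> = J (T n \<omega>) \<omega>) \<and>
        (\<forall>t. J t \<omega> \<in> {1..Ms})" using sm by (elim conjE)
    show "AE \<omega> in M. real_cond_exp M (mr_filt M J T n)
             (indicator {\<omega> \<in> space M. J (T (n + 1) \<omega>) \<omega> = j \<and> T (n + 1) \<omega> - T n \<omega> \<le> t}) \<omega>
           = Q (J (T n \<omega>) \<omega>) j t" if "n \<ge> 1" for n j t
      using QP(1)[rule_format, OF that] .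
    show "AE \<omega> in M. real_cond_exp M (mr_filt M J T n)
             (indicator {\<omega> \<in> space M. J (T (n + 1) \<omega>) \<omega> = j}) \<omega> = P (J (T n \<omega>) \<omega>) j" if "n \<ge> 1" for n j
      using QP(2)[rule_format, OF that] .
    show "(i, j) \<in> {(a, b). P a b > 0}\<^sup>*" if "i \<in> {1..Ms}" "j \<in> {1..Ms}" for i j
      using QP(3)[rule_format, OF that] .
    show "distr M path_space (\<lambda>\<omega> t. J (t + u) \<omega>) = distr M path_space (\<lambda>\<omega> t. J t \<omega>)" for u
      using assms(4) unfolding stationary_ergodic_def by blast
    show "unit_poisson M \<tau>" "indep_J_tau M J \<tau>" by (rule assms)+
    show "R n \<in> measurable M (count_space UNIV)" for n using assms(7) by (simp add: request_model_def)
    show "0 \<le> q r i" if "r \<in> {1..Ms}" for r i using assms(7) that by (simp add: request_model_def)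
    show "(\<lambda>i. q r (Suc i)) sums 1" if "r \<in> {1..Ms}" for r using assms(7) that by (simp add: request_model_def)
    show "AE \<omega> in M. real_cond_exp M (req_filt M J \<tau> n)
            (indicator {\<omega> \<in> space M. \<forall>l \<in> {1..n}. R l \<omega> = i l}) \<omega> = (\<Prod>l = 1..n. q (J (\<tau> (int l) \<omega>) \<omega>) (i l))"
      if "n \<ge> 1" "\<And>l. l \<in> {1..n} \<Longrightarrow> 1 \<le> i l" for n i
      using assms(7)[unfolded request_model_def, THEN conjunct2, THEN conjunct2, rule_format, OF that(1)] that(2) by blast
  qed
  show ?thesis
    by (rule static_policy_asymptotically_optimal[of \<Sigma>]) (use assms(6,8-13) in \<open>auto simp: \<pi>_def\<close>)
qed

end
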